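(* Let $R$ be an integral domain. The assignment $$X \mapsto \big(\mathrm{C}_\bullet(X;R),\, \Delta,\, \varepsilon\big),$$ sending a globular set $X$ to its globular $R$-coalgebra and a morphism $F$ of globular sets to the induced chain map $\mathrm{C}_\bullet(F)$, is a full and faithful embedding (i.e. a well-defined fully faithful functor) of the category $\mathrm{Set}^{\mathbb{G}^{\mathrm{op}}}$ of (reflexive) globular sets into the category $\mathrm{coAlg}_R$ of counital cosymmetric $R$-coalgebras.
   Context: **Globular sets.** The globe category $\mathbb{G}$ has the non-negative integers as objects; its morphisms are generated by $\sigma_n,\tau_n : n\to n+1$ and $\iota_n : n\to n-1$ subject to $\tau_n\tau_{n-1}=\sigma_n\tau_{n-1}$, $\sigma_n\sigma_{n-1}=\tau_n\sigma_{n-1}$, $\iota_{n+1}\tau_n=\mathrm{id}_n$, $\iota_{n+1}\sigma_n=\mathrm{id}_n$. A (reflexive) globular set is a functor $X:\mathbb{G}^{\mathrm{op}}\to\mathrm{Set}$; morphisms are natural transformations. Write $X_n=X(n)$, $t_n=X(\tau_n)$, $s_n=X(\sigma_n)$ (maps $X_{n+1}\to X_n$), $i_n=X(\iota_n):X_{n-1}\to X_n$. For $x\in X_n$ and $k<n$, $t_kx$ denotes $t_k r(x)$ and $s_kx$ denotes $s_k r(x)$, where $r:X_n\to X_{k+1}$ is any composite of maps $s_j,t_j$ (the result does not depend on $r$). **Chains.** $\mathrm{C}_n(X;R)=R\{X_n\}/R\{i_n(X_{n-1})\}$ (free modules; nothing is quotiented for $n=0$), with $\partial_n=t_{n-1}-s_{n-1}$.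 **Counital cosymmetric $R$-coalgebras.** $\mathrm{Ch}_R$ is the category of homologically graded differential graded $R$-modules in non-negative degrees. An augmented one is a pair $(C,\varepsilon)$ with $\varepsilon:C\to R$ a chain map ($R$ in degree $0$). Let $\Sigma_2=\{1,T\}$ and let $W$ be the resolution $R[\Sigma_2]\xleftarrow{1-T}R[\Sigma_2]\xleftarrow{1+T}R[\Sigma_2]\xleftarrow{1-T}\cdots$ of $R$, with generator $e_k$ in degree $k$; let $\varepsilon_W:W\to R$ be the $R[\Sigma_2]$-linear augmentation with $\varepsilon_W(e_0)=1$. $\Sigma_2$ acts on $C\otimes C$ by $T(x\otimes y)=(-1)^{|x||y|}y\otimes x$. A counital cosymmetric $R$-coalgebra is an augmented differential graded $R$-module $(C,\varepsilon)$ with an $R[\Sigma_2]$-linear chain map $\Delta:W\otimes C\to C\otimes C$ such that $(\mathrm{id}\otimes\varepsilon)\Delta=\varepsilon_W\otimes\mathrm{id}=(\varepsilon\otimes\mathrm{id})\Delta$. Equivalently, writing $\Delta_k(c)=\Delta(e_k\otimes c)$, $\Delta$ is a family of maps $\Delta_k:C\to C\otimes C$ of degree $k$ with $\partial\Delta_k-(-1)^k\Delta_k\partial=(1+(-1)^kT)\Delta_{k-1}$, $\Delta_{-1}=0$ (plus the counit conditions). A coalgebra map $f:C'\to C$ is a chain map commuting with augmentations and with $(f\otimes f)\Delta'=\Delta(\mathrm{id}\otimes f)$. These form the category $\mathrm{coAlg}_R$. **Globular $R$-coalgebra of $X$.** It is $(\mathrm{C}_\bullet(X;R),\Delta,\varepsilon)$,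 where for $x\in X_n$ $$\Delta_k(x)=\begin{cases}0 & n<k\\ x\otimes x & n=k\\ t_kx\otimes x+(-1)^{(n+1)k}\,x\otimes s_kx & k<n,\end{cases}\qquad \varepsilon(x)=\begin{cases}1&n=0\\0&n>0.\end{cases}$$ *)

theory Defs
  imports "HOL-Algebra.Module" "HOL-Algebra.AbelCoset" "HOL.Hull"
begin

section \<open>Categories and fully faithful functors\<close>

text \<open>Hom-sets need not be disjoint, so composition and the action of a functor on arrows
  take the source and target objects as arguments.\<close>

record ('o, 'a) category =
  Ob :: "'o set"
  Hom :: "'o \<Rightarrow> 'o \<Rightarrow> 'a set"
  Idt :: "'o \<Rightarrow> 'a"
  Comp :: "'o \<Rightarrow> 'o \<Rightarrow> 'o \<Rightarrow> 'a \<Rightarrow> 'a \<Rightarrow> 'a"  \<comment> \<open>\<open>Comp A X Y Z g f\<close> is \<open>g\<close> after \<open>f\<close>, for \<open>f : X \<rightarrow> Y\<close> and \<open>g : Y \<rightarrow> Z\<close>\<close>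

locale category =
  fixes A :: "('o, 'a) category"
  assumes Idt_in: "X \<in> Ob A \<Longrightarrow> Idt A X \<in> Hom A X X"
    and Comp_in: "\<lbrakk>X \<in> Ob A; Y \<in> Ob A; Z \<in> Ob A; f \<in> Hom A X Y; g \<in> Hom A Y Z\<rbrakk>
      \<Longrightarrow> Comp A X Y Z g f \<in> Hom A X Z"
    and Comp_Idt: "\<lbrakk>X \<in> Ob A; Y \<in> Ob A; f \<in> Hom A X Y\<rbrakk> \<Longrightarrow> Comp A X X Y f (Idt A X) = f"
    and Idt_Comp: "\<lbrakk>X \<in> Ob A; Y \<in> Ob A; f \<in> Hom A X Y\<rbrakk> \<Longrightarrow> Comp A X Y Y (Idt A Y) f = f"
    and Comp_assoc: "\<lbrakk>X \<in> Ob A; Y \<in> Ob A; Z \<in> Ob A; V \<in> Ob A;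
        f \<in> Hom A X Y; g \<in> Hom A Y Z; h \<in> Hom A Z V\<rbrakk>
      \<Longrightarrow> Comp A X Z V h (Comp A X Y Z g f) = Comp A X Y V (Comp A Y Z V h g) f"

locale functor_between = A: category A + B: category B
  for A :: "('o, 'a) category" and B :: "('p, 'b) category" +
  fixes FO :: "'o \<Rightarrow> 'p" and FA :: "'o \<Rightarrow> 'o \<Rightarrow> 'a \<Rightarrow> 'b"
  assumes FO_in: "X \<in> Ob A \<Longrightarrow> FO X \<in> Ob B"
    and FA_in: "\<lbrakk>X \<in> Ob A; Y \<in> Ob A; f \<in> Hom A X Y\<rbrakk> \<Longrightarrow> FA X Y f \<in> Hom B (FO X) (FO Y)"
    and FA_Idt: "X \<in> Ob A \<Longrightarrow> FA X X (Idt A X) = Idt B (FO X)"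
    and FA_Comp: "\<lbrakk>X \<in> Ob A; Y \<in> Ob A; Z \<in> Ob A; f \<in> Hom A X Y; g \<in> Hom A Y Z\<rbrakk>
      \<Longrightarrow> FA X Z (Comp A X Y Z g f) = Comp B (FO X) (FO Y) (FO Z) (FA Y Z g) (FA X Y f)"

locale fully_faithful_functor = functor_between +
  assumes faithful: "\<lbrakk>X \<in> Ob A; Y \<in> Ob A\<rbrakk> \<Longrightarrow> inj_on (FA X Y) (Hom A X Y)"
    and full: "\<lbrakk>X \<in> Ob A; Y \<in> Ob A\<rbrakk> \<Longrightarrow> Hom B (FO X) (FO Y) \<subseteq> FA X Y ` Hom A X Y"


section \<open>Reflexive globular sets\<close>

text \<open>A functor on the (opposite of the) globe category, which is presented by generators and
  relations, is given by its values on objects and generators, subject to the relations.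
  Here \<open>src X n\<close> and \<open>tgt X n\<close> are the maps \<open>s\<^sub>n, t\<^sub>n : X\<^sub>n\<^sub>+\<^sub>1 \<rightarrow> X\<^sub>n\<close>, and
  \<open>idc X n\<close> is \<open>i\<^sub>n\<^sub>+\<^sub>1 : X\<^sub>n \<rightarrow> X\<^sub>n\<^sub>+\<^sub>1\<close> (note the shift).\<close>

record 'x globular_set =
  cells :: "nat \<Rightarrow> 'x set"
  src :: "nat \<Rightarrow> 'x \<Rightarrow> 'x"
  tgt :: "nat \<Rightarrow> 'x \<Rightarrow> 'x"
  idc :: "nat \<Rightarrow> 'x \<Rightarrow> 'x"

definition is_globular_set :: "'x globular_set \<Rightarrow> bool" where
  "is_globular_set X \<longleftrightarrow>
    (\<forall>n. src X n \<in> cells X (Suc n) \<rightarrow>\<^sub>E cells X n) \<and>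
    (\<forall>n. tgt X n \<in> cells X (Suc n) \<rightarrow>\<^sub>E cells X n) \<and>
    (\<forall>n. idc X n \<in> cells X n \<rightarrow>\<^sub>E cells X (Suc n)) \<and>
    (\<forall>n. \<forall>x\<in>cells X (Suc (Suc n)). tgt X n (tgt X (Suc n) x) = tgt X n (src X (Suc n) x)) \<and>
    (\<forall>n. \<forall>x\<in>cells X (Suc (Suc n)). src X n (src X (Suc n) x) = src X n (tgt X (Suc n) x)) \<and>
    (\<forall>n. \<forall>x\<in>cells X n. tgt X n (idc X n x) = x) \<and>
    (\<forall>n. \<forall>x\<in>cells X n. src X n (idc X n x) = x)"

definition globular_hom :: "'x globular_set \<Rightarrow> 'x globular_set \<Rightarrow> (nat \<Rightarrow> 'x \<Rightarrow> 'x) set" where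
  "globular_hom X Y = {F.
    (\<forall>n. F n \<in> cells X n \<rightarrow>\<^sub>E cells Y n) \<and>
    (\<forall>n. \<forall>x\<in>cells X (Suc n). F n (src X n x) = src Y n (F (Suc n) x)) \<and>
    (\<forall>n. \<forall>x\<in>cells X (Suc n). F n (tgt X n x) = tgt Y n (F (Suc n) x)) \<and>
    (\<forall>n. \<forall>x\<in>cells X n. F (Suc n) (idc X n x) = idc Y n (F n x))}"

definition globular_category :: "('x globular_set, nat \<Rightarrow> 'x \<Rightarrow> 'x) category" where
  "globular_category = \<lparr>
    Ob = {X. is_globular_set X},
    Hom = globular_hom,
    Idt = (\<lambda>X n. \<lambda>x\<in>cells X n. x),
    Comp = (\<lambda>X Y Z G F n. compose (cells X n) (G n) (F n))\<rparr>"

text \<open>For \<open>x \<in> X\<^sub>n\<close> and \<open>k < n\<close>, \<open>iter_tgt X k n x\<close> is \<open>t\<^sub>k t\<^sub>k\<^sub>+\<^sub>1 \<dots> t\<^sub>n\<^sub>-\<^sub>1 x \<in> X\<^sub>k\<close>,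
  and similarly for \<open>iter_src\<close>.\<close>

primrec iter_tgt :: "'x globular_set \<Rightarrow> nat \<Rightarrow> nat \<Rightarrow> 'x \<Rightarrow> 'x" where
  "iter_tgt X k 0 x = x"
| "iter_tgt X k (Suc n) x = (if k < Suc n then iter_tgt X k n (tgt X n x) else x)"

primrec iter_src :: "'x globular_set \<Rightarrow> nat \<Rightarrow> nat \<Rightarrow> 'x \<Rightarrow> 'x" where
  "iter_src X k 0 x = x"
| "iter_src X k (Suc n) x = (if k < Suc n then iter_src X k n (src X n x) else x)"


section \<open>Module constructions\<close>

text \<open>The \<open>mult\<close> and \<open>one\<close> fields of a module record carry no information.\<close>

definition mod_hom :: "('r, 'q) ring_scheme \<Rightarrow> ('r, 'm) module \<Rightarrow> ('r, 'n) module \<Rightarrow> ('m \<Rightarrow> 'n) set" where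
  "mod_hom R M N = {f \<in> carrier M \<rightarrow> carrier N.
    (\<forall>x\<in>carrier M. \<forall>y\<in>carrier M. f (x \<oplus>\<^bsub>M\<^esub> y) = f x \<oplus>\<^bsub>N\<^esub> f y) \<and>
    (\<forall>r\<in>carrier R. \<forall>x\<in>carrier M. f (r \<odot>\<^bsub>M\<^esub> x) = r \<odot>\<^bsub>N\<^esub> f x)}"

definition free_mod :: "('r, 'q) ring_scheme \<Rightarrow> 's set \<Rightarrow> ('r, 's \<Rightarrow> 'r) module" where
  "free_mod R S = \<lparr>
    carrier = {u \<in> S \<rightarrow>\<^sub>E carrier R. finite {s \<in> S. u s \<noteq> \<zero>\<^bsub>R\<^esub>}},
    mult = undefined, one = undefined,
    zero = (\<lambda>s\<in>S. \<zero>\<^bsub>R\<^esub>),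
    add = (\<lambda>u v. \<lambda>s\<in>S. u s \<oplus>\<^bsub>R\<^esub> v s),
    smult = (\<lambda>r u. \<lambda>s\<in>S. r \<otimes>\<^bsub>R\<^esub> u s)\<rparr>"

definition free_gen :: "('r, 'q) ring_scheme \<Rightarrow> 's set \<Rightarrow> 's \<Rightarrow> ('s \<Rightarrow> 'r)" where
  "free_gen R S x = (\<lambda>s\<in>S. if s = x then \<one>\<^bsub>R\<^esub> else \<zero>\<^bsub>R\<^esub>)"

definition free_lift :: "('r, 'q) ring_scheme \<Rightarrow> 's set \<Rightarrow> ('r, 'n) module \<Rightarrow> ('s \<Rightarrow> 'n) \<Rightarrow> ('s \<Rightarrow> 'r) \<Rightarrow> 'n" where
  "free_lift R S N f u = (\<Oplus>\<^bsub>N\<^esub>s \<in> {s \<in> S. u s \<noteq> \<zero>\<^bsub>R\<^esub>}. u s \<odot>\<^bsub>N\<^esub> f s)"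

definition quot_mod :: "('r, 'm) module \<Rightarrow> 'm set \<Rightarrow> ('r, 'm set) module" where
  "quot_mod M H = \<lparr>
    carrier = a_rcosets\<^bsub>M\<^esub> H,
    mult = undefined, one = undefined,
    zero = H,
    add = (<+>\<^bsub>M\<^esub>),
    smult = (\<lambda>r Q. \<Union>q\<in>Q. H +>\<^bsub>M\<^esub> (r \<odot>\<^bsub>M\<^esub> q))\<rparr>"

definition quot_lift :: "('m \<Rightarrow> 'n) \<Rightarrow> 'm set \<Rightarrow> 'n" where
  "quot_lift f Q = f (SOME q. q \<in> Q)"

definition fin_prod_mod :: "('r, 'q) ring_scheme \<Rightarrow> 'i set \<Rightarrow> ('i \<Rightarrow> ('r, 'm) module) \<Rightarrow> ('r, 'i \<Rightarrow> 'm) module" where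
  "fin_prod_mod R I M = \<lparr>
    carrier = (\<Pi>\<^sub>E i\<in>I. carrier (M i)),
    mult = undefined, one = undefined,
    zero = (\<lambda>i\<in>I. \<zero>\<^bsub>M i\<^esub>),
    add = (\<lambda>u v. \<lambda>i\<in>I. u i \<oplus>\<^bsub>M i\<^esub> v i),
    smult = (\<lambda>r u. \<lambda>i\<in>I. r \<odot>\<^bsub>M i\<^esub> u i)\<rparr>"

text \<open>The tensor product over \<open>R\<close>, as the free module on \<open>M \<times> N\<close> modulo the bilinearity relations.\<close>

definition bilin_gens :: "('r, 'q) ring_scheme \<Rightarrow> ('r, 'm) module \<Rightarrow> ('r, 'n) module \<Rightarrow> ('m \<times> 'n \<Rightarrow> 'r) set" where
  "bilin_gens R M N =
    (let S = carrier M \<times> carrier N; F = free_mod R S; g = (\<lambda>x y. free_gen R S (x, y)) in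
      {g (x \<oplus>\<^bsub>M\<^esub> x') y \<ominus>\<^bsub>F\<^esub> (g x y \<oplus>\<^bsub>F\<^esub> g x' y) | x x' y.
         x \<in> carrier M \<and> x' \<in> carrier M \<and> y \<in> carrier N} \<union>
      {g x (y \<oplus>\<^bsub>N\<^esub> y') \<ominus>\<^bsub>F\<^esub> (g x y \<oplus>\<^bsub>F\<^esub> g x y') | x y y'.
         x \<in> carrier M \<and> y \<in> carrier N \<and> y' \<in> carrier N} \<union>
      {g (r \<odot>\<^bsub>M\<^esub> x) y \<ominus>\<^bsub>F\<^esub> r \<odot>\<^bsub>F\<^esub> g x y | r x y.
         r \<in> carrier R \<and> x \<in> carrier M \<and> y \<in> carrier N} \<union>
      {g x (r \<odot>\<^bsub>N\<^esub> y) \<ominus>\<^bsub>F\<^esub> r \<odot>\<^bsub>F\<^esub> g x y | r x y.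
         r \<in> carrier R \<and> x \<in> carrier M \<and> y \<in> carrier N})"

definition bilin_rel :: "('r, 'q) ring_scheme \<Rightarrow> ('r, 'm) module \<Rightarrow> ('r, 'n) module \<Rightarrow> ('m \<times> 'n \<Rightarrow> 'r) set" where
  "bilin_rel R M N =
    (\<lambda>H. submodule H R (free_mod R (carrier M \<times> carrier N))) hull bilin_gens R M N"

definition tensor :: "('r, 'q) ring_scheme \<Rightarrow> ('r, 'm) module \<Rightarrow> ('r, 'n) module \<Rightarrow> ('r, ('m \<times> 'n \<Rightarrow> 'r) set) module" where
  "tensor R M N = quot_mod (free_mod R (carrier M \<times> carrier N)) (bilin_rel R M N)"

definition pure :: "('r, 'q) ring_scheme \<Rightarrow> ('r, 'm) module \<Rightarrow> ('r, 'n) module \<Rightarrow> 'm \<Rightarrow> 'n \<Rightarrow> ('m \<times> 'n \<Rightarrow> 'r) set" where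
  "pure R M N x y = bilin_rel R M N +>\<^bsub>free_mod R (carrier M \<times> carrier N)\<^esub>
     free_gen R (carrier M \<times> carrier N) (x, y)"

text \<open>The linear map \<open>M \<otimes> N \<rightarrow> P\<close> induced by a bilinear map \<open>b\<close>.\<close>

definition tensor_lift :: "('r, 'q) ring_scheme \<Rightarrow> ('r, 'm) module \<Rightarrow> ('r, 'n) module \<Rightarrow> ('r, 'p) module
    \<Rightarrow> ('m \<Rightarrow> 'n \<Rightarrow> 'p) \<Rightarrow> ('m \<times> 'n \<Rightarrow> 'r) set \<Rightarrow> 'p" where
  "tensor_lift R M N P b = quot_lift (free_lift R (carrier M \<times> carrier N) P (\<lambda>(x, y). b x y))"

definition tensor_hom :: "('r, 'q) ring_scheme \<Rightarrow> ('r, 'm) module \<Rightarrow> ('r, 'n) module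
    \<Rightarrow> ('r, 'm2) module \<Rightarrow> ('r, 'n2) module \<Rightarrow> ('m \<Rightarrow> 'm2) \<Rightarrow> ('n \<Rightarrow> 'n2)
    \<Rightarrow> ('m \<times> 'n \<Rightarrow> 'r) set \<Rightarrow> ('m2 \<times> 'n2 \<Rightarrow> 'r) set" where
  "tensor_hom R M N M' N' f g = tensor_lift R M N (tensor R M' N') (\<lambda>x y. pure R M' N' (f x) (g y))"

definition sign :: "('r, 'q) ring_scheme \<Rightarrow> nat \<Rightarrow> 'r" where
  "sign R k = (\<ominus>\<^bsub>R\<^esub> \<one>\<^bsub>R\<^esub>) [^]\<^bsub>R\<^esub> k"


section \<open>Differential graded modules in non-negative degrees\<close>

text \<open>\<open>diff C n\<close> is the differential \<open>C\<^sub>n\<^sub>+\<^sub>1 \<rightarrow> C\<^sub>n\<close>.\<close>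

record ('r, 'm) chain_complex =
  cmod :: "nat \<Rightarrow> ('r, 'm) module"
  diff :: "nat \<Rightarrow> 'm \<Rightarrow> 'm"

definition is_chain_complex :: "('r, 'q) ring_scheme \<Rightarrow> ('r, 'm, 'z) chain_complex_scheme \<Rightarrow> bool" where
  "is_chain_complex R C \<longleftrightarrow>
    (\<forall>n. module R (cmod C n)) \<and>
    (\<forall>n. diff C n \<in> mod_hom R (cmod C (Suc n)) (cmod C n)) \<and>
    (\<forall>n. \<forall>x\<in>carrier (cmod C (Suc (Suc n))). diff C n (diff C (Suc n) x) = \<zero>\<^bsub>cmod C n\<^esub>)"

definition is_chain_map :: "('r, 'q) ring_scheme \<Rightarrow> ('r, 'm, 'z) chain_complex_scheme
    \<Rightarrow> ('r, 'n, 'w) chain_complex_scheme \<Rightarrow> (nat \<Rightarrow> 'm \<Rightarrow> 'n) \<Rightarrow> bool" where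
  "is_chain_map R C D f \<longleftrightarrow>
    (\<forall>n. f n \<in> mod_hom R (cmod C n) (cmod D n)) \<and>
    (\<forall>n. \<forall>x\<in>carrier (cmod C (Suc n)). f n (diff C n x) = diff D n (f (Suc n) x))"

definition unit_complex :: "('r, 'q) ring_scheme \<Rightarrow> ('r, 'r) chain_complex" where
  "unit_complex R = \<lparr>
    cmod = (\<lambda>n. \<lparr>carrier = (if n = 0 then carrier R else {\<zero>\<^bsub>R\<^esub>}),
      mult = undefined, one = undefined,
      zero = \<zero>\<^bsub>R\<^esub>, add = (\<oplus>\<^bsub>R\<^esub>), smult = (\<otimes>\<^bsub>R\<^esub>)\<rparr>),
    diff = (\<lambda>n x. \<zero>\<^bsub>R\<^esub>)\<rparr>"

text \<open>An element of \<open>(C \<otimes> D)\<^sub>n\<close> is a family \<open>z\<close> with \<open>z p \<in> C\<^sub>p \<otimes> D\<^sub>n\<^sub>-\<^sub>p\<close> for \<open>p \<le> n\<close>.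
  Its differential is the one given by \<open>\<partial>(x \<otimes> y) = \<partial>x \<otimes> y + (-1)\<^sup>|\<^sup>x\<^sup>| x \<otimes> \<partial>y\<close>,
  written out by bidegree.\<close>

definition tensor_complex :: "('r, 'q) ring_scheme \<Rightarrow> ('r, 'm, 'z) chain_complex_scheme
    \<Rightarrow> ('r, 'n, 'w) chain_complex_scheme \<Rightarrow> ('r, nat \<Rightarrow> ('m \<times> 'n \<Rightarrow> 'r) set) chain_complex" where
  "tensor_complex R C D = \<lparr>
    cmod = (\<lambda>n. fin_prod_mod R {..n} (\<lambda>p. tensor R (cmod C p) (cmod D (n - p)))),
    diff = (\<lambda>n z. \<lambda>p\<in>{..n}.
      tensor_hom R (cmod C (Suc p)) (cmod D (n - p)) (cmod C p) (cmod D (n - p))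
        (diff C p) (\<lambda>y. y) (z (Suc p))
      \<oplus>\<^bsub>tensor R (cmod C p) (cmod D (n - p))\<^esub>
      sign R p \<odot>\<^bsub>tensor R (cmod C p) (cmod D (n - p))\<^esub>
        tensor_hom R (cmod C p) (cmod D (Suc (n - p))) (cmod C p) (cmod D (n - p))
          (\<lambda>x. x) (diff D (n - p)) (z p))\<rparr>"

text \<open>\<open>x \<otimes> y \<in> (C \<otimes> D)\<^sub>p\<^sub>+\<^sub>q\<close> for \<open>x \<in> C\<^sub>p\<close> and \<open>y \<in> D\<^sub>q\<close>.\<close>

definition gpure :: "('r, 'q) ring_scheme \<Rightarrow> ('r, 'm, 'z) chain_complex_scheme
    \<Rightarrow> ('r, 'n, 'w) chain_complex_scheme \<Rightarrow> nat \<Rightarrow> nat \<Rightarrow> 'm \<Rightarrow> 'n \<Rightarrow> nat \<Rightarrow> ('m \<times> 'n \<Rightarrow> 'r) set" where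
  "gpure R C D p q x y = (\<lambda>j\<in>{..p + q}.
    if j = p then pure R (cmod C p) (cmod D q) x y
    else \<zero>\<^bsub>tensor R (cmod C j) (cmod D (p + q - j))\<^esub>)"

text \<open>\<open>f \<otimes> g\<close> for degree-preserving \<open>f\<close> and \<open>g\<close>.\<close>

definition tensor_chain_map :: "('r, 'q) ring_scheme
    \<Rightarrow> ('r, 'm, 'z) chain_complex_scheme \<Rightarrow> ('r, 'n, 'w) chain_complex_scheme
    \<Rightarrow> ('r, 'm2, 'z2) chain_complex_scheme \<Rightarrow> ('r, 'n2, 'w2) chain_complex_scheme
    \<Rightarrow> (nat \<Rightarrow> 'm \<Rightarrow> 'm2) \<Rightarrow> (nat \<Rightarrow> 'n \<Rightarrow> 'n2)
    \<Rightarrow> nat \<Rightarrow> (nat \<Rightarrow> ('m \<times> 'n \<Rightarrow> 'r) set) \<Rightarrow> nat \<Rightarrow> ('m2 \<times> 'n2 \<Rightarrow> 'r) set" where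
  "tensor_chain_map R C D C' D' f g n z = (\<lambda>p\<in>{..n}.
    tensor_hom R (cmod C p) (cmod D (n - p)) (cmod C' p) (cmod D' (n - p)) (f p) (g (n - p)) (z p))"

text \<open>The canonical isomorphisms \<open>R \<otimes> C \<cong> C\<close> and \<open>C \<otimes> R \<cong> C\<close>; all but one component of an element
  of the left-hand side lies in a zero module.\<close>

definition left_unitor :: "('r, 'q) ring_scheme \<Rightarrow> ('r, 'm, 'z) chain_complex_scheme
    \<Rightarrow> nat \<Rightarrow> (nat \<Rightarrow> ('r \<times> 'm \<Rightarrow> 'r) set) \<Rightarrow> 'm" where
  "left_unitor R C n z =
    tensor_lift R (cmod (unit_complex R) 0) (cmod C n) (cmod C n) (\<lambda>r c. r \<odot>\<^bsub>cmod C n\<^esub> c) (z 0)"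

definition right_unitor :: "('r, 'q) ring_scheme \<Rightarrow> ('r, 'm, 'z) chain_complex_scheme
    \<Rightarrow> nat \<Rightarrow> (nat \<Rightarrow> ('m \<times> 'r \<Rightarrow> 'r) set) \<Rightarrow> 'm" where
  "right_unitor R C n z =
    tensor_lift R (cmod C n) (cmod (unit_complex R) 0) (cmod C n) (\<lambda>c r. r \<odot>\<^bsub>cmod C n\<^esub> c) (z n)"

text \<open>The action of \<open>T\<close> on \<open>C \<otimes> C\<close>, \<open>T(x \<otimes> y) = (-1)\<^sup>|\<^sup>x\<^sup>|\<^sup>|\<^sup>y\<^sup>| y \<otimes> x\<close>.\<close>

definition swap_action :: "('r, 'q) ring_scheme \<Rightarrow> ('r, 'm, 'z) chain_complex_scheme
    \<Rightarrow> nat \<Rightarrow> (nat \<Rightarrow> ('m \<times> 'm \<Rightarrow> 'r) set) \<Rightarrow> nat \<Rightarrow> ('m \<times> 'm \<Rightarrow> 'r) set" where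
  "swap_action R C n z = (\<lambda>p\<in>{..n}.
    sign R (p * (n - p)) \<odot>\<^bsub>tensor R (cmod C p) (cmod C (n - p))\<^esub>
      tensor_lift R (cmod C (n - p)) (cmod C p) (tensor R (cmod C p) (cmod C (n - p)))
        (\<lambda>x y. pure R (cmod C p) (cmod C (n - p)) y x) (z (n - p)))"


section \<open>The resolution W\<close>

text \<open>The group \<open>\<Sigma>\<^sub>2 = {1, T}\<close> is represented by \<open>bool\<close>, with \<open>False\<close> for \<open>1\<close> and \<open>True\<close> for \<open>T\<close>.
  Thus \<open>u :: bool \<Rightarrow> 'r\<close> stands for \<open>u False \<cdot> 1 + u True \<cdot> T\<close> in \<open>R[\<Sigma>\<^sub>2]\<close>, and in degree \<open>k\<close> of \<open>W\<close>
  for \<open>u False \<cdot> e\<^sub>k + u True \<cdot> T e\<^sub>k\<close>.\<close>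

definition T_mult :: "(bool \<Rightarrow> 'r) \<Rightarrow> bool \<Rightarrow> 'r" where
  "T_mult u = (\<lambda>g. u (\<not> g))"

text \<open>The differential \<open>W\<^sub>k\<^sub>+\<^sub>1 \<rightarrow> W\<^sub>k\<close> is multiplication by \<open>1 + (-1)\<^sup>k\<^sup>+\<^sup>1 T\<close>.\<close>

definition W_complex :: "('r, 'q) ring_scheme \<Rightarrow> ('r, bool \<Rightarrow> 'r) chain_complex" where
  "W_complex R = \<lparr>
    cmod = (\<lambda>k. free_mod R UNIV),
    diff = (\<lambda>k u. u \<oplus>\<^bsub>free_mod R UNIV\<^esub> sign R (Suc k) \<odot>\<^bsub>free_mod R UNIV\<^esub> T_mult u)\<rparr>"

definition W_aug :: "('r, 'q) ring_scheme \<Rightarrow> nat \<Rightarrow> (bool \<Rightarrow> 'r) \<Rightarrow> 'r" where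
  "W_aug R k u = (if k = 0 then u False \<oplus>\<^bsub>R\<^esub> u True else \<zero>\<^bsub>R\<^esub>)"


section \<open>Counital cosymmetric coalgebras\<close>

record ('r, 'm) coalgebra = "('r, 'm) chain_complex" +
  aug :: "nat \<Rightarrow> 'm \<Rightarrow> 'r"
  coprod :: "nat \<Rightarrow> (nat \<Rightarrow> ((bool \<Rightarrow> 'r) \<times> 'm \<Rightarrow> 'r) set) \<Rightarrow> nat \<Rightarrow> ('m \<times> 'm \<Rightarrow> 'r) set"

definition is_coalgebra :: "('r, 'q) ring_scheme \<Rightarrow> ('r, 'm) coalgebra \<Rightarrow> bool" where
  "is_coalgebra R C \<longleftrightarrow>
    (let W = W_complex R; U = unit_complex R;
         WC = tensor_complex R W C; CC = tensor_complex R C C in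
      is_chain_complex R C \<and>
      is_chain_map R C U (aug C) \<and>
      is_chain_map R WC CC (coprod C) \<and>
      (\<forall>n. \<forall>z\<in>carrier (cmod WC n).
        coprod C n (tensor_chain_map R W C W C (\<lambda>k. T_mult) (\<lambda>k c. c) n z)
          = swap_action R C n (coprod C n z)) \<and>
      (\<forall>n. \<forall>z\<in>carrier (cmod WC n).
        right_unitor R C n (tensor_chain_map R C C C U (\<lambda>k c. c) (aug C) n (coprod C n z))
          = left_unitor R C n (tensor_chain_map R W C U C (W_aug R) (\<lambda>k c. c) n z)) \<and>
      (\<forall>n. \<forall>z\<in>carrier (cmod WC n).
        left_unitor R C n (tensor_chain_map R C C U C (aug C) (\<lambda>k c. c) n (coprod C n z))
          = left_unitor R C n (tensor_chain_map R W C U C (W_aug R) (\<lambda>k c. c) n z)))"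

definition coalgebra_hom :: "('r, 'q) ring_scheme \<Rightarrow> ('r, 'm) coalgebra \<Rightarrow> ('r, 'm) coalgebra
    \<Rightarrow> (nat \<Rightarrow> 'm \<Rightarrow> 'm) set" where
  "coalgebra_hom R C' C = {f.
    (\<forall>n. f n \<in> extensional (carrier (cmod C' n))) \<and>
    is_chain_map R C' C f \<and>
    (\<forall>n. \<forall>c\<in>carrier (cmod C' n). aug C n (f n c) = aug C' n c) \<and>
    (\<forall>n. \<forall>z\<in>carrier (cmod (tensor_complex R (W_complex R) C') n).
      tensor_chain_map R C' C' C C f f n (coprod C' n z)
        = coprod C n (tensor_chain_map R (W_complex R) C' (W_complex R) C (\<lambda>k w. w) f n z))}"

definition coalgebra_category :: "('r, 'q) ring_scheme \<Rightarrow> (('r, 'm) coalgebra, nat \<Rightarrow> 'm \<Rightarrow> 'm) category" where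
  "coalgebra_category R = \<lparr>
    Ob = {C. is_coalgebra R C},
    Hom = coalgebra_hom R,
    Idt = (\<lambda>C n. \<lambda>c\<in>carrier (cmod C n). c),
    Comp = (\<lambda>C D E g f n. compose (carrier (cmod C n)) (g n) (f n))\<rparr>"


section \<open>The globular coalgebra of a globular set\<close>

primrec degenerate :: "'x globular_set \<Rightarrow> nat \<Rightarrow> 'x set" where
  "degenerate X 0 = {}"
| "degenerate X (Suc n) = idc X n ` cells X n"

definition degenerate_sub :: "('r, 'q) ring_scheme \<Rightarrow> 'x globular_set \<Rightarrow> nat \<Rightarrow> ('x \<Rightarrow> 'r) set" where
  "degenerate_sub R X n = {u \<in> carrier (free_mod R (cells X n)).
    \<forall>x \<in> cells X n - degenerate X n. u x = \<zero>\<^bsub>R\<^esub>}"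

definition chains :: "('r, 'q) ring_scheme \<Rightarrow> 'x globular_set \<Rightarrow> nat \<Rightarrow> ('r, ('x \<Rightarrow> 'r) set) module" where
  "chains R X n = quot_mod (free_mod R (cells X n)) (degenerate_sub R X n)"

definition cell_class :: "('r, 'q) ring_scheme \<Rightarrow> 'x globular_set \<Rightarrow> nat \<Rightarrow> 'x \<Rightarrow> ('x \<Rightarrow> 'r) set" where
  "cell_class R X n x = degenerate_sub R X n +>\<^bsub>free_mod R (cells X n)\<^esub> free_gen R (cells X n) x"

text \<open>The linear map on \<open>n\<close>-chains determined by its values \<open>f x\<close> on the cells
  (where \<open>f\<close> vanishes on degenerate cells).\<close>

definition chains_lift :: "('r, 'q) ring_scheme \<Rightarrow> 'x globular_set \<Rightarrow> nat \<Rightarrow> ('r, 'n) module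
    \<Rightarrow> ('x \<Rightarrow> 'n) \<Rightarrow> ('x \<Rightarrow> 'r) set \<Rightarrow> 'n" where
  "chains_lift R X n N f = quot_lift (free_lift R (cells X n) N f)"

definition globular_chains :: "('r, 'q) ring_scheme \<Rightarrow> 'x globular_set \<Rightarrow> ('r, ('x \<Rightarrow> 'r) set) chain_complex" where
  "globular_chains R X = \<lparr>
    cmod = chains R X,
    diff = (\<lambda>n. chains_lift R X (Suc n) (chains R X n)
      (\<lambda>x. cell_class R X n (tgt X n x) \<ominus>\<^bsub>chains R X n\<^esub> cell_class R X n (src X n x)))\<rparr>"

text \<open>\<open>Delta_cell R X k n x\<close> is \<open>\<Delta>\<^sub>k(x) \<in> (C \<otimes> C)\<^sub>n\<^sub>+\<^sub>k\<close> for \<open>x \<in> X\<^sub>n\<close>.\<close>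

definition Delta_cell :: "('r, 'q) ring_scheme \<Rightarrow> 'x globular_set \<Rightarrow> nat \<Rightarrow> nat \<Rightarrow> 'x
    \<Rightarrow> nat \<Rightarrow> (('x \<Rightarrow> 'r) set \<times> ('x \<Rightarrow> 'r) set \<Rightarrow> 'r) set" where
  "Delta_cell R X k n x =
    (let C = globular_chains R X; V = cmod (tensor_complex R C C) (n + k) in
      if n < k then \<zero>\<^bsub>V\<^esub>
      else if n = k then gpure R C C n n (cell_class R X n x) (cell_class R X n x)
      else gpure R C C k n (cell_class R X k (iter_tgt X k n x)) (cell_class R X n x)
        \<oplus>\<^bsub>V\<^esub> sign R ((n + 1) * k) \<odot>\<^bsub>V\<^esub>
          gpure R C C n k (cell_class R X n x) (cell_class R X k (iter_src X k n x)))"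

definition Delta :: "('r, 'q) ring_scheme \<Rightarrow> 'x globular_set \<Rightarrow> nat \<Rightarrow> nat \<Rightarrow> ('x \<Rightarrow> 'r) set
    \<Rightarrow> nat \<Rightarrow> (('x \<Rightarrow> 'r) set \<times> ('x \<Rightarrow> 'r) set \<Rightarrow> 'r) set" where
  "Delta R X k n = chains_lift R X n
    (cmod (tensor_complex R (globular_chains R X) (globular_chains R X)) (n + k)) (Delta_cell R X k n)"

text \<open>The coproduct is the \<open>R[\<Sigma>\<^sub>2]\<close>-linear map with \<open>\<Delta>(e\<^sub>k \<otimes> c) = \<Delta>\<^sub>k(c)\<close>, that is,
  \<open>\<Delta>((a e\<^sub>k + b T e\<^sub>k) \<otimes> c) = a \<Delta>\<^sub>k(c) + b T \<Delta>\<^sub>k(c)\<close>.\<close>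

definition globular_coalgebra :: "('r, 'q) ring_scheme \<Rightarrow> 'x globular_set \<Rightarrow> ('r, ('x \<Rightarrow> 'r) set) coalgebra" where
  "globular_coalgebra R X =
    (let C = globular_chains R X in \<lparr>
      cmod = cmod C,
      diff = diff C,
      aug = (\<lambda>n. chains_lift R X n (cmod (unit_complex R) n)
        (\<lambda>x. if n = 0 then \<one>\<^bsub>R\<^esub> else \<zero>\<^bsub>R\<^esub>)),
      coprod = (\<lambda>n z. let V = cmod (tensor_complex R C C) n in
        \<Oplus>\<^bsub>V\<^esub>k \<in> {..n}. tensor_lift R (cmod (W_complex R) k) (cmod C (n - k)) V
          (\<lambda>w c. w False \<odot>\<^bsub>V\<^esub> Delta R X k (n - k) c
            \<oplus>\<^bsub>V\<^esub> w True \<odot>\<^bsub>V\<^esub> swap_action R C n (Delta R X k (n - k) c))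
          (z k))\<rparr>)"

definition globular_chain_map :: "('r, 'q) ring_scheme \<Rightarrow> 'x globular_set \<Rightarrow> 'x globular_set
    \<Rightarrow> (nat \<Rightarrow> 'x \<Rightarrow> 'x) \<Rightarrow> nat \<Rightarrow> ('x \<Rightarrow> 'r) set \<Rightarrow> ('x \<Rightarrow> 'r) set" where
  "globular_chain_map R X Y F n = (\<lambda>c\<in>carrier (chains R X n).
    chains_lift R X n (chains R Y n) (\<lambda>x. cell_class R Y n (F n x)) c)"

end

theory Submission
  imports Defs
begin

text \<open>
  Chains of a globular set are free on its nondegenerate cells and all structure maps are linear,
  so every identity between them is checked on cells, or on tensors of cells.

  \<^emph>\<open>A globular set gives a coalgebra.\<close> Each \<open>\<Delta>\<^sub>k\<close> kills degenerate cells because every tensor in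
  \<open>\<Delta>\<^sub>k(x)\<close> has the factor \<open>x\<close>, which is \<open>0\<close> as a chain if \<open>x\<close> is degenerate. The identity with
  content is \<open>\<partial>\<Delta>\<^sub>k - (-1)\<^sup>k\<Delta>\<^sub>k\<partial> = (1 + (-1)\<^sup>kT)\<Delta>\<^sub>k\<^sub>-\<^sub>1\<close> (\<open>Delta_boundary_cell\<close>). Expand the boundary of
  \<open>t\<^sub>kx \<otimes> x \<plusminus> x \<otimes> s\<^sub>kx\<close>, where \<open>x\<close> has dimension \<open>n > k\<close>. The terms with a factor \<open>\<partial>x\<close> make up
  \<open>(-1)\<^sup>k\<Delta>\<^sub>k(\<partial>x)\<close>, since the source and the target of \<open>x\<close> have the same \<open>k\<close>-dimensional boundary for
  \<open>k < n - 1\<close>, while for \<open>k = n - 1\<close> a mixed term cancels (\<open>Delta_of_boundary\<close>). In the remaining terms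
  \<open>\<partial>t\<^sub>kx = t\<^sub>k\<^sub>-\<^sub>1x - s\<^sub>k\<^sub>-\<^sub>1x = \<partial>s\<^sub>kx\<close>, and these are the four terms of \<open>\<Delta>\<^sub>k\<^sub>-\<^sub>1x\<close> and its transpose.

  \<^emph>\<open>The functor is faithful.\<close> Nondegenerate cells are linearly independent, and a degenerate cell is
  the identity on its own target. Hence the chain map determines the image of every cell, by
  induction on the dimension (\<open>globular_faithful\<close>).

  \<^emph>\<open>The functor is full.\<close> Let \<open>f\<close> be a map of globular coalgebras and \<open>x\<close> an \<open>n\<close>-cell. Compatibility with
  \<open>\<Delta>\<^sub>n\<close> says \<open>f(x) \<otimes> f(x) = \<Delta>\<^sub>n(f(x))\<close>, so the coefficients \<open>a\<^sub>y\<close> of \<open>f(x)\<close> are orthogonal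
  idempotents of \<open>R\<close>. In an integral domain this leaves \<open>f(x) = 0\<close> or \<open>f(x) = y\<close> for one nondegenerate cell
  \<open>y\<close> (\<open>coalgebra_hom_cell_cases\<close>). In the second case, compatibility with \<open>\<Delta>\<^sub>k\<close> for \<open>k < n\<close>
  gives \<open>f(t\<^sub>kx) = t\<^sub>ky\<close> and \<open>f(s\<^sub>kx) = s\<^sub>ky\<close> as chains (\<open>coalgebra_hom_boundary_cells\<close>). In the first
  case \<open>n > 0\<close> by the counit, and \<open>x\<close> can only go to the identity on the image of its target. This
  recursion defines \<open>cell_map\<close>. What remains is that it respects sources and targets: for cells that
  survive, \<open>cell_map_iter\<close> repairs the degenerate \<open>t\<^sub>ky\<close> and \<open>s\<^sub>ky\<close>, which chains do not see; for
  cells that collapse, \<open>cell_map_parallel\<close> shows that source and target have the same image.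
\<close>

section \<open>Linear maps and spanning sets\<close>

text \<open>The span is generated inductively, so that statements about it are proved by following how an
  element is built, without a choice of coefficients.\<close>

inductive_set lin_span :: "('r, 'q) ring_scheme \<Rightarrow> ('r, 'm) module \<Rightarrow> 'm set \<Rightarrow> 'm set"
  for R :: "('r, 'q) ring_scheme" and M :: "('r, 'm) module" and A :: "'m set" where
  zero: "\<zero>\<^bsub>M\<^esub> \<in> lin_span R M A"
| gen: "a \<in> A \<Longrightarrow> a \<in> lin_span R M A"
| add: "\<lbrakk>u \<in> lin_span R M A; v \<in> lin_span R M A\<rbrakk> \<Longrightarrow> u \<oplus>\<^bsub>M\<^esub> v \<in> lin_span R M A"
| smult: "\<lbrakk>r \<in> carrier R; u \<in> lin_span R M A\<rbrakk> \<Longrightarrow> r \<odot>\<^bsub>M\<^esub> u \<in> lin_span R M A"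

text \<open>Two linear maps that agree on a spanning set are equal (\<open>mod_hom_eqI\<close>), and spanning sets pass to
  quotients, finite products and tensor products. This is how identities between maps on tensor
  products of arbitrary modules, which need not have bases, are reduced to generators.\<close>

definition spans :: "('r, 'q) ring_scheme \<Rightarrow> ('r, 'm) module \<Rightarrow> 'm set \<Rightarrow> bool" where
  "spans R M A \<longleftrightarrow> A \<subseteq> carrier M \<and> carrier M \<subseteq> lin_span R M A"

definition bilinear :: "('r, 'q) ring_scheme \<Rightarrow> ('r, 'm) module \<Rightarrow> ('r, 'n) module \<Rightarrow> ('r, 'p) module
    \<Rightarrow> ('m \<Rightarrow> 'n \<Rightarrow> 'p) \<Rightarrow> bool" where
  "bilinear R M N P b \<longleftrightarrow>
    (\<forall>y\<in>carrier N. (\<lambda>x. b x y) \<in> mod_hom R M P) \<and> (\<forall>x\<in>carrier M. b x \<in> mod_hom R N P)"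

lemma mod_homI:
  assumes "\<And>x. x \<in> carrier M \<Longrightarrow> f x \<in> carrier N"
    and "\<And>x y. \<lbrakk>x \<in> carrier M; y \<in> carrier M\<rbrakk> \<Longrightarrow> f (x \<oplus>\<^bsub>M\<^esub> y) = f x \<oplus>\<^bsub>N\<^esub> f y"
    and "\<And>r x. \<lbrakk>r \<in> carrier R; x \<in> carrier M\<rbrakk> \<Longrightarrow> f (r \<odot>\<^bsub>M\<^esub> x) = r \<odot>\<^bsub>N\<^esub> f x"
  shows "f \<in> mod_hom R M N"
  using assms by (simp add: mod_hom_def)

lemma mod_homD:
  assumes "f \<in> mod_hom R M N"
  shows "x \<in> carrier M \<Longrightarrow> f x \<in> carrier N"
    and "\<lbrakk>x \<in> carrier M; y \<in> carrier M\<rbrakk> \<Longrightarrow> f (x \<oplus>\<^bsub>M\<^esub> y) = f x \<oplus>\<^bsub>N\<^esub> f y"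
    and "\<lbrakk>r \<in> carrier R; x \<in> carrier M\<rbrakk> \<Longrightarrow> f (r \<odot>\<^bsub>M\<^esub> x) = r \<odot>\<^bsub>N\<^esub> f x"
  using assms by (auto simp: mod_hom_def)

lemma mod_hom_cong:
  assumes "f \<in> mod_hom R M N" "\<And>x. x \<in> carrier M \<Longrightarrow> f x = g x" "module R M"
  shows "g \<in> mod_hom R M N"
proof -
  interpret M: module R M by fact
  show ?thesis
  proof (rule mod_homI)
    fix x y assume xy: "x \<in> carrier M" "y \<in> carrier M"
    have "g (x \<oplus>\<^bsub>M\<^esub> y) = f (x \<oplus>\<^bsub>M\<^esub> y)" using assms(2) xy by simp
    then show "g (x \<oplus>\<^bsub>M\<^esub> y) = g x \<oplus>\<^bsub>N\<^esub> g y"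
      using mod_homD[OF assms(1)] assms(2) xy by simp
  next
    fix r x assume rx: "r \<in> carrier R" "x \<in> carrier M"
    have "g (r \<odot>\<^bsub>M\<^esub> x) = f (r \<odot>\<^bsub>M\<^esub> x)" using assms(2) rx by simp
    then show "g (r \<odot>\<^bsub>M\<^esub> x) = r \<odot>\<^bsub>N\<^esub> g x"
      using mod_homD[OF assms(1)] assms(2) rx by simp
  qed (use mod_homD[OF assms(1)] assms(2) in force)
qed

context cring
begin

lemmas mod_abelian = module.axioms(2)[of R]
lemmas mod_monoid = abelian_group.axioms(1)[OF mod_abelian]

lemmas mod_closed [simp] =
  abelian_monoid.a_closed[OF mod_monoid]
  abelian_monoid.zero_closed[OF mod_monoid]
  abelian_group.a_inv_closed[OF mod_abelian]
  abelian_group.minus_closed[OF mod_abelian]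
  module.smult_closed[of R]

lemmas mod_simps [simp] =
  abelian_monoid.l_zero[OF mod_monoid]
  abelian_monoid.r_zero[OF mod_monoid]
  module.smult_one[of R]
  module.smult_l_null[of R]
  module.smult_r_null[of R]

lemmas mod_ac =
  abelian_monoid.a_assoc[OF mod_monoid]
  abelian_monoid.a_comm[OF mod_monoid]
  abelian_monoid.a_lcomm[OF mod_monoid]

lemmas mod_l_distr = module.smult_l_distr[of R]
lemmas mod_r_distr = module.smult_r_distr[of R]
lemmas mod_assoc = module.smult_assoc1[of R]
lemmas mod_l_minus = module.smult_l_minus[of R]
lemmas mod_r_neg = abelian_group.r_neg[OF mod_abelian]

lemma mod_neg: "\<lbrakk>module R M; x \<in> carrier M\<rbrakk> \<Longrightarrow> \<ominus>\<^bsub>M\<^esub> x = (\<ominus> \<one>) \<odot>\<^bsub>M\<^esub> x"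
  by (simp add: mod_l_minus)

lemma mod_minus: "\<lbrakk>module R M; x \<in> carrier M; y \<in> carrier M\<rbrakk> \<Longrightarrow> x \<ominus>\<^bsub>M\<^esub> y = x \<oplus>\<^bsub>M\<^esub> (\<ominus> \<one>) \<odot>\<^bsub>M\<^esub> y"
  by (simp add: mod_l_minus a_minus_def)

lemma mod_smult_comm:
  "\<lbrakk>module R M; r \<in> carrier R; s \<in> carrier R; x \<in> carrier M\<rbrakk> \<Longrightarrow> r \<odot>\<^bsub>M\<^esub> (s \<odot>\<^bsub>M\<^esub> x) = s \<odot>\<^bsub>M\<^esub> (r \<odot>\<^bsub>M\<^esub> x)"
  by (metis mod_assoc m_comm)

lemma mod_eq_of_minus:
  assumes "module R M" "x \<in> carrier M" "y \<in> carrier M" "x \<ominus>\<^bsub>M\<^esub> y = \<zero>\<^bsub>M\<^esub>" shows "x = y"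
proof -
  interpret M: module R M by fact
  show ?thesis using assms by (metis M.minus_equality M.minus_minus M.a_inv_closed a_minus_def)
qed

lemma submodule_of_closed:
  assumes "module R M" "H \<subseteq> carrier M" "\<zero>\<^bsub>M\<^esub> \<in> H"
    and "\<And>a b. \<lbrakk>a \<in> H; b \<in> H\<rbrakk> \<Longrightarrow> a \<oplus>\<^bsub>M\<^esub> b \<in> H"
    and "\<And>r a. \<lbrakk>r \<in> carrier R; a \<in> H\<rbrakk> \<Longrightarrow> r \<odot>\<^bsub>M\<^esub> a \<in> H"
  shows "submodule H R M"
proof (rule module.submoduleI[OF assms(1-3)])
  fix a assume a: "a \<in> H"
  then have "a \<in> carrier M" using assms(2) by blast
  from mod_neg[OF assms(1) this] show "\<ominus>\<^bsub>M\<^esub> a \<in> H" using assms(5)[OF _ a, of "\<ominus> \<one>"] by simp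
qed (rule assms(4,5); assumption)+

lemma mod_hom_zero:
  assumes "module R M" "module R N" "f \<in> mod_hom R M N" shows "f \<zero>\<^bsub>M\<^esub> = \<zero>\<^bsub>N\<^esub>"
proof -
  have "f \<zero>\<^bsub>M\<^esub> = f (\<zero> \<odot>\<^bsub>M\<^esub> \<zero>\<^bsub>M\<^esub>)" using assms by simp
  also have "\<dots> = \<zero> \<odot>\<^bsub>N\<^esub> f \<zero>\<^bsub>M\<^esub>" by (rule mod_homD(3)[OF assms(3)]) (use assms in auto)
  finally show ?thesis using assms mod_homD(1)[OF assms(3)] by simp
qed

lemma mod_hom_minus:
  assumes "module R M" "module R N" "f \<in> mod_hom R M N" "x \<in> carrier M" "y \<in> carrier M"
  shows "f (x \<ominus>\<^bsub>M\<^esub> y) = f x \<ominus>\<^bsub>N\<^esub> f y"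
  using assms by (simp add: mod_minus mod_homD[OF assms(3)])

lemma mod_hom_comp:
  assumes "f \<in> mod_hom R M N" "g \<in> mod_hom R N P"
  shows "(\<lambda>x. g (f x)) \<in> mod_hom R M P"
  using mod_homD[OF assms(1)] mod_homD[OF assms(2)] by (auto intro!: mod_homI)

lemma mod_hom_id: "(\<lambda>x. x) \<in> mod_hom R M M"
  by (auto intro!: mod_homI)

lemma mod_hom_const_zero: "\<lbrakk>module R N\<rbrakk> \<Longrightarrow> (\<lambda>x. \<zero>\<^bsub>N\<^esub>) \<in> mod_hom R M N"
  by (auto intro!: mod_homI)

lemma mod_hom_plus:
  assumes "module R N" "f \<in> mod_hom R M N" "g \<in> mod_hom R M N"
  shows "(\<lambda>x. f x \<oplus>\<^bsub>N\<^esub> g x) \<in> mod_hom R M N"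
  using assms mod_homD[OF assms(2)] mod_homD[OF assms(3)]
  by (auto intro!: mod_homI simp: mod_ac mod_r_distr)

lemma mod_hom_scale:
  assumes "module R N" "f \<in> mod_hom R M N" "a \<in> carrier R"
  shows "(\<lambda>x. a \<odot>\<^bsub>N\<^esub> f x) \<in> mod_hom R M N"
  using assms mod_homD[OF assms(2)] 
  by (auto intro!: mod_homI simp: mod_r_distr mod_smult_comm)

lemma mod_hom_scalar:
  assumes "module R N" "f \<in> mod_hom R M (cmod (unit_complex R) 0)" "y \<in> carrier N"
  shows "(\<lambda>x. f x \<odot>\<^bsub>N\<^esub> y) \<in> mod_hom R M N"
  using assms mod_homD[OF assms(2)] 
  by (auto intro!: mod_homI simp: mod_l_distr mod_assoc unit_complex_def)

lemma mod_hom_finsum: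
  assumes "module R M" "module R N" "finite I" "\<And>i. i \<in> I \<Longrightarrow> f i \<in> mod_hom R M N"
  shows "(\<lambda>x. \<Oplus>\<^bsub>N\<^esub>i\<in>I. f i x) \<in> mod_hom R M N"
proof -
  interpret N: module R N by fact
  show ?thesis
    using assms(3,4)
  proof (induction I rule: finite_induct)
    case empty
    then show ?case using mod_hom_const_zero[OF assms(2)] by simp
  next
    case (insert i I)
    have "(\<lambda>x. f i x \<oplus>\<^bsub>N\<^esub> (\<Oplus>\<^bsub>N\<^esub>i\<in>I. f i x)) \<in> mod_hom R M N"
      using insert by (intro mod_hom_plus assms(2)) auto
    then show ?case
    proof (rule mod_hom_cong[OF _ _ assms(1)])
      fix x assume "x \<in> carrier M"
      then show "f i x \<oplus>\<^bsub>N\<^esub> (\<Oplus>\<^bsub>N\<^esub>i\<in>I. f i x) = (\<Oplus>\<^bsub>N\<^esub>i\<in>insert i I. f i x)"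
        using insert mod_homD(1) by (subst N.finsum_insert) (fastforce+)
    qed
  qed
qed

lemma spans_induct [consumes 3, case_names zero gen add smult]:
  assumes "spans R M A" "x \<in> carrier M" "module R M"
    and "P \<zero>\<^bsub>M\<^esub>" "\<And>a. a \<in> A \<Longrightarrow> P a"
    and "\<And>u v. \<lbrakk>u \<in> carrier M; v \<in> carrier M; P u; P v\<rbrakk> \<Longrightarrow> P (u \<oplus>\<^bsub>M\<^esub> v)"
    and "\<And>r u. \<lbrakk>r \<in> carrier R; u \<in> carrier M; P u\<rbrakk> \<Longrightarrow> P (r \<odot>\<^bsub>M\<^esub> u)"
  shows "P x"
proof -
  have "x \<in> lin_span R M A" using assms(1,2) by (auto simp: spans_def)
  then have "x \<in> carrier M \<and> P x"
    using assms(1,3-) by induction (auto simp: spans_def)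
  then show ?thesis ..
qed

lemma spansD: "spans R M A \<Longrightarrow> a \<in> A \<Longrightarrow> a \<in> carrier M"
  by (auto simp: spans_def)

lemma spans_carrier: "spans R M (carrier M)"
  by (auto simp: spans_def intro: lin_span.gen)

lemma mod_hom_eqI:
  assumes "spans R M A" "module R M" "module R N" "f \<in> mod_hom R M N" "g \<in> mod_hom R M N"
    and "\<And>a. a \<in> A \<Longrightarrow> f a = g a" "x \<in> carrier M"
  shows "f x = g x"
  using assms(1,7,2)
proof (induction rule: spans_induct)
  show "f \<zero>\<^bsub>M\<^esub> = g \<zero>\<^bsub>M\<^esub>"
    by (simp add: mod_hom_zero[OF assms(2,3,4)] mod_hom_zero[OF assms(2,3,5)])
next
  case (gen a)
  then show ?case by (rule assms(6))
next
  case (add u v)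
  then show ?case by (simp add: mod_homD[OF assms(4)] mod_homD[OF assms(5)])
next
  case (smult r u)
  then show ?case by (simp add: mod_homD[OF assms(4)] mod_homD[OF assms(5)])
qed

lemma lin_span_hom_image:
  assumes "spans R M A" "x \<in> carrier M" "module R M" "module R N" "f \<in> mod_hom R M N"
    "\<And>a. a \<in> A \<Longrightarrow> f a \<in> lin_span R N B"
  shows "f x \<in> lin_span R N B"
  using assms(1,2,3)
proof (induction rule: spans_induct)
  case zero
  show ?case by (simp add: mod_hom_zero[OF assms(3-5)] lin_span.zero)
next
  case (gen a)
  then show ?case by (rule assms(6))
next
  case (add u v)
  then show ?case by (simp add: mod_homD[OF assms(5)] lin_span.add)
next
  case (smult r u)
  then show ?case by (simp add: mod_homD[OF assms(5)] lin_span.smult)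
qed

lemma bilinearI:
  assumes "\<And>y. y \<in> carrier N \<Longrightarrow> (\<lambda>x. b x y) \<in> mod_hom R M P"
    and "\<And>x. x \<in> carrier M \<Longrightarrow> b x \<in> mod_hom R N P"
  shows "bilinear R M N P b"
  using assms by (simp add: bilinear_def)

lemma bilinearD:
  assumes "bilinear R M N P b"
  shows "y \<in> carrier N \<Longrightarrow> (\<lambda>x. b x y) \<in> mod_hom R M P" "x \<in> carrier M \<Longrightarrow> b x \<in> mod_hom R N P"
  using assms by (simp_all add: bilinear_def)

lemma bilinear_closed:
  "\<lbrakk>bilinear R M N P b; x \<in> carrier M; y \<in> carrier N\<rbrakk> \<Longrightarrow> b x y \<in> carrier P"
  by (rule mod_homD(1)[OF bilinearD(2)])

lemma lin_span_bilinear: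
  assumes "spans R M A" "spans R N B" "module R M" "module R N" "module R P" "bilinear R M N P b"
    and "\<And>x y. \<lbrakk>x \<in> A; y \<in> B\<rbrakk> \<Longrightarrow> b x y \<in> lin_span R P C" "x \<in> carrier M" "y \<in> carrier N"
  shows "b x y \<in> lin_span R P C"
proof (rule lin_span_hom_image[OF assms(1,8,3,5) bilinearD(1)[OF assms(6,9)]])
  fix a assume a: "a \<in> A"
  then have "a \<in> carrier M" using spansD[OF assms(1)] by simp
  from bilinearD(2)[OF assms(6) this] show "b a y \<in> lin_span R P C"
    by (rule lin_span_hom_image[OF assms(2,9,4,5)]) (rule assms(7)[OF a])
qed

section \<open>Free modules\<close>

lemma free_mod_sel:
  "carrier (free_mod R S) = {u \<in> S \<rightarrow>\<^sub>E carrier R. finite {s \<in> S. u s \<noteq> \<zero>}}"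
  "\<zero>\<^bsub>free_mod R S\<^esub> = (\<lambda>s\<in>S. \<zero>)"
  "u \<oplus>\<^bsub>free_mod R S\<^esub> v = (\<lambda>s\<in>S. u s \<oplus> v s)"
  "r \<odot>\<^bsub>free_mod R S\<^esub> u = (\<lambda>s\<in>S. r \<otimes> u s)"
  by (simp_all add: free_mod_def)

lemma free_mod_closed_add:
  assumes "u \<in> carrier (free_mod R S)" "v \<in> carrier (free_mod R S)"
  shows "u \<oplus>\<^bsub>free_mod R S\<^esub> v \<in> carrier (free_mod R S)"
proof -
  have "{s \<in> S. u s \<oplus> v s \<noteq> \<zero>} \<subseteq> {s \<in> S. u s \<noteq> \<zero>} \<union> {s \<in> S. v s \<noteq> \<zero>}" by auto
  from finite_subset[OF this] show ?thesis using assms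
    by (auto simp: free_mod_sel PiE_iff cong: conj_cong)
qed

lemma free_mod_closed_smult:
  assumes "r \<in> carrier R" "u \<in> carrier (free_mod R S)"
  shows "r \<odot>\<^bsub>free_mod R S\<^esub> u \<in> carrier (free_mod R S)"
proof -
  have "{s \<in> S. r \<otimes> u s \<noteq> \<zero>} \<subseteq> {s \<in> S. u s \<noteq> \<zero>}" using assms(1) by auto
  from finite_subset[OF this] show ?thesis using assms
    by (auto simp: free_mod_sel PiE_iff cong: conj_cong)
qed

lemma free_mod_module [simp]: "module R (free_mod R S)"
proof (rule moduleI)
  show "abelian_group (free_mod R S)"
  proof (rule abelian_groupI)
    fix u v assume "u \<in> carrier (free_mod R S)" "v \<in> carrier (free_mod R S)"
    then show "u \<oplus>\<^bsub>free_mod R S\<^esub> v \<in> carrier (free_mod R S)" by (rule free_mod_closed_add)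
  next
    fix u assume u: "u \<in> carrier (free_mod R S)"
    show "\<exists>y\<in>carrier (free_mod R S). y \<oplus>\<^bsub>free_mod R S\<^esub> u = \<zero>\<^bsub>free_mod R S\<^esub>"
    proof
      show "(\<ominus> \<one>) \<odot>\<^bsub>free_mod R S\<^esub> u \<in> carrier (free_mod R S)" by (rule free_mod_closed_smult) (use u in auto)
      show "((\<ominus> \<one>) \<odot>\<^bsub>free_mod R S\<^esub> u) \<oplus>\<^bsub>free_mod R S\<^esub> u = \<zero>\<^bsub>free_mod R S\<^esub>"
        using u by (auto simp: free_mod_sel fun_eq_iff PiE_iff l_minus l_neg)
    qed
  qed (auto simp: free_mod_sel fun_eq_iff PiE_iff a_ac extensional_def)
  show "\<one> \<odot>\<^bsub>free_mod R S\<^esub> x = x" if "x \<in> carrier (free_mod R S)" for x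
    using that by (auto simp: free_mod_sel fun_eq_iff PiE_iff extensional_def)
  fix a assume "a \<in> carrier R"
  then show "a \<odot>\<^bsub>free_mod R S\<^esub> x \<in> carrier (free_mod R S)" if "x \<in> carrier (free_mod R S)" for x
    using that by (rule free_mod_closed_smult)
qed (auto simp: free_mod_sel fun_eq_iff PiE_iff l_distr r_distr m_assoc is_cring)

lemma free_gen_closed [simp]: "free_gen R S x \<in> carrier (free_mod R S)"
proof -
  have "{s \<in> S. (if s = x then \<one> else \<zero>) \<noteq> \<zero>} \<subseteq> {x}" by auto
  from finite_subset[OF this] show ?thesis
    by (auto simp: free_mod_sel free_gen_def cong: conj_cong)
qed

lemma free_mod_spans: "spans R (free_mod R S) (free_gen R S ` S)"
  unfolding spans_def
proof (intro conjI subsetI)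
  show "u \<in> lin_span R (free_mod R S) (free_gen R S ` S)" if "u \<in> carrier (free_mod R S)" for u
  proof -
    have "finite {s \<in> S. u s \<noteq> \<zero>}" using that by (simp add: free_mod_sel)
    then show ?thesis using that
    \<comment> \<open>Subtracting the term at one point of the support makes the support smaller.\<close>
    proof (induction "{s \<in> S. u s \<noteq> \<zero>}" arbitrary: u rule: finite_induct)
      case empty
      then have "u = \<zero>\<^bsub>free_mod R S\<^esub>" by (auto simp: free_mod_sel fun_eq_iff PiE_iff extensional_def)
      then show ?case by (simp add: lin_span.zero)
    next
      case (insert x F)
      have x: "x \<in> S" and ux: "u x \<in> carrier R" using insert by (auto simp: free_mod_sel)
      let ?v = "u(x := \<zero>)"
      have F: "F = {s \<in> S. ?v s \<noteq> \<zero>}" using insert by auto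
      have v: "?v \<in> carrier (free_mod R S)"
        using insert(1) insert(5) x unfolding F by (auto simp: free_mod_sel PiE_iff extensional_def)
      have "u = ?v \<oplus>\<^bsub>free_mod R S\<^esub> u x \<odot>\<^bsub>free_mod R S\<^esub> free_gen R S x"
        using insert(5) x by (auto simp: free_mod_sel free_gen_def fun_eq_iff PiE_iff extensional_def)
      also have "\<dots> \<in> lin_span R (free_mod R S) (free_gen R S ` S)"
        using insert(3)[OF F v] ux x by (auto intro: lin_span.intros)
      finally show ?case .
    qed
  qed
qed auto

text \<open>Cancellation can make the support of \<open>u + v\<close> or of \<open>r u\<close> smaller than expected. Summing over any
  finite set that contains the support makes the linearity of \<open>free_lift\<close> visible.\<close>

lemma free_lift_superset:
  assumes "module R N" "f \<in> S \<rightarrow> carrier N" "u \<in> carrier (free_mod R S)"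
    and "finite A" "{s \<in> S. u s \<noteq> \<zero>} \<subseteq> A" "A \<subseteq> S"
  shows "free_lift R S N f u = (\<Oplus>\<^bsub>N\<^esub>s\<in>A. u s \<odot>\<^bsub>N\<^esub> f s)"
proof -
  interpret N: module R N by fact
  have c: "s \<in> S" "f s \<in> carrier N" "u s \<in> carrier R" if "s \<in> A" for s
    using that assms by (auto simp: free_mod_sel)
  show ?thesis unfolding free_lift_def
  proof (rule N.add.finprod_mono_neutral_cong_left[OF assms(4,5)])
    fix s assume "s \<in> A - {s \<in> S. u s \<noteq> \<zero>}"
    with c[of s] show "u s \<odot>\<^bsub>N\<^esub> f s = \<zero>\<^bsub>N\<^esub>" by simp
  qed (use c in \<open>auto\<close>)
qed

lemma free_lift_hom:
  assumes N: "module R N" and f: "f \<in> S \<rightarrow> carrier N"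
  shows "free_lift R S N f \<in> mod_hom R (free_mod R S) N"
proof -
  interpret N: module R N by fact
  let ?s = "\<lambda>u. {s \<in> S. u s \<noteq> \<zero>}"
  have fin: "finite (?s u)" if "u \<in> carrier (free_mod R S)" for u
    using that by (auto simp: free_mod_sel)
  have val: "u s \<in> carrier R" if "u \<in> carrier (free_mod R S)" "s \<in> S" for u s
    using that by (auto simp: free_mod_sel)
  have fc: "f s \<in> carrier N" if "s \<in> S" for s using f that by auto
  show ?thesis
  proof (rule mod_homI)
    fix u assume u: "u \<in> carrier (free_mod R S)"
    note uv = val[OF u]
    show "free_lift R S N f u \<in> carrier N"
      unfolding free_lift_def by (rule N.finsum_closed) (auto simp: uv fc)
    fix r assume r: "r \<in> carrier R"
    have "free_lift R S N f (r \<odot>\<^bsub>free_mod R S\<^esub> u)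
      = (\<Oplus>\<^bsub>N\<^esub>s\<in>?s u. (r \<odot>\<^bsub>free_mod R S\<^esub> u) s \<odot>\<^bsub>N\<^esub> f s)"
      by (rule free_lift_superset[OF N f free_mod_closed_smult[OF r u] fin[OF u]])
        (auto simp: free_mod_sel(4) r)
    also have "\<dots> = (\<Oplus>\<^bsub>N\<^esub>s\<in>?s u. r \<odot>\<^bsub>N\<^esub> (u s \<odot>\<^bsub>N\<^esub> f s))"
      by (rule N.finsum_cong') (auto simp: free_mod_sel(4) r uv fc N.smult_assoc1)
    also have "\<dots> = r \<odot>\<^bsub>N\<^esub> free_lift R S N f u"
      unfolding free_lift_def
      by (rule N.finsum_smult_ldistr[symmetric]) (auto simp: fin[OF u] r uv fc)
    finally show "free_lift R S N f (r \<odot>\<^bsub>free_mod R S\<^esub> u) = r \<odot>\<^bsub>N\<^esub> free_lift R S N f u" .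
  next
    fix u v assume u: "u \<in> carrier (free_mod R S)" and v: "v \<in> carrier (free_mod R S)"
    note uv = val[OF u] val[OF v]
    let ?A = "?s u \<union> ?s v"
    have A: "finite ?A" using fin[OF u] fin[OF v] by simp
    have "free_lift R S N f (u \<oplus>\<^bsub>free_mod R S\<^esub> v)
      = (\<Oplus>\<^bsub>N\<^esub>s\<in>?A. (u \<oplus>\<^bsub>free_mod R S\<^esub> v) s \<odot>\<^bsub>N\<^esub> f s)"
      by (rule free_lift_superset[OF N f free_mod_closed_add[OF u v] A]) (auto simp: free_mod_sel(3))
    also have "\<dots> = (\<Oplus>\<^bsub>N\<^esub>s\<in>?A. u s \<odot>\<^bsub>N\<^esub> f s \<oplus>\<^bsub>N\<^esub> v s \<odot>\<^bsub>N\<^esub> f s)"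
      by (rule N.finsum_cong') (auto simp: free_mod_sel(3) uv fc N.smult_l_distr)
    also have "\<dots> = (\<Oplus>\<^bsub>N\<^esub>s\<in>?A. u s \<odot>\<^bsub>N\<^esub> f s) \<oplus>\<^bsub>N\<^esub> (\<Oplus>\<^bsub>N\<^esub>s\<in>?A. v s \<odot>\<^bsub>N\<^esub> f s)"
      by (rule N.finsum_addf) (auto simp: uv fc)
    also have "(\<Oplus>\<^bsub>N\<^esub>s\<in>?A. u s \<odot>\<^bsub>N\<^esub> f s) = free_lift R S N f u"
      by (rule free_lift_superset[OF N f u A, symmetric]) auto
    also have "(\<Oplus>\<^bsub>N\<^esub>s\<in>?A. v s \<odot>\<^bsub>N\<^esub> f s) = free_lift R S N f v"
      by (rule free_lift_superset[OF N f v A, symmetric]) auto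
    finally show "free_lift R S N f (u \<oplus>\<^bsub>free_mod R S\<^esub> v) = free_lift R S N f u \<oplus>\<^bsub>N\<^esub> free_lift R S N f v" .
  qed
qed

lemma free_lift_gen:
  assumes N: "module R N" and f: "f \<in> S \<rightarrow> carrier N" and x: "x \<in> S"
  shows "free_lift R S N f (free_gen R S x) = f x"
proof -
  interpret N: module R N by fact
  have fx: "f x \<in> carrier N" using f x by auto
  have "free_lift R S N f (free_gen R S x) = (\<Oplus>\<^bsub>N\<^esub>s\<in>{x}. free_gen R S x s \<odot>\<^bsub>N\<^esub> f s)"
    by (rule free_lift_superset[OF N f free_gen_closed]) (use x in \<open>auto simp: free_gen_def\<close>)
  then show ?thesis using fx x by (simp add: free_gen_def)
qed

section \<open>Quotient modules\<close>

lemma submodule_abelian_subgroup: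
  assumes "module R M" "submodule H R M" shows "abelian_subgroup H M"
  using assms by (intro abelian_subgroupI3 additive_subgroupI submodule.axioms(1) mod_abelian)

lemma quot_mod_carrier: "carrier (quot_mod M H) = (\<lambda>x. H +>\<^bsub>M\<^esub> x) ` carrier M"
  by (auto simp: quot_mod_def A_RCOSETS_def')

text \<open>Scalar multiplication on the quotient is a union over all representatives of a coset; they all give
  the same coset because \<open>H\<close> is closed under scalars.\<close>

lemma quot_mod_sel:
  assumes "module R M" "submodule H R M"
  shows "\<zero>\<^bsub>quot_mod M H\<^esub> = H +>\<^bsub>M\<^esub> \<zero>\<^bsub>M\<^esub>"
    and "\<lbrakk>x \<in> carrier M; y \<in> carrier M\<rbrakk> \<Longrightarrow>
      (H +>\<^bsub>M\<^esub> x) \<oplus>\<^bsub>quot_mod M H\<^esub> (H +>\<^bsub>M\<^esub> y) = H +>\<^bsub>M\<^esub> (x \<oplus>\<^bsub>M\<^esub> y)"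
    and "\<lbrakk>r \<in> carrier R; x \<in> carrier M\<rbrakk> \<Longrightarrow> r \<odot>\<^bsub>quot_mod M H\<^esub> (H +>\<^bsub>M\<^esub> x) = H +>\<^bsub>M\<^esub> (r \<odot>\<^bsub>M\<^esub> x)"
proof -
  interpret M: module R M by fact
  interpret H: abelian_subgroup H M by (rule submodule_abelian_subgroup[OF assms])
  show "\<zero>\<^bsub>quot_mod M H\<^esub> = H +>\<^bsub>M\<^esub> \<zero>\<^bsub>M\<^esub>" by (simp add: quot_mod_def H.a_rcos_const)
  show "(H +>\<^bsub>M\<^esub> x) \<oplus>\<^bsub>quot_mod M H\<^esub> (H +>\<^bsub>M\<^esub> y) = H +>\<^bsub>M\<^esub> (x \<oplus>\<^bsub>M\<^esub> y)"
    if "x \<in> carrier M" "y \<in> carrier M" using that by (simp add: quot_mod_def H.a_rcos_sum)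
  show "r \<odot>\<^bsub>quot_mod M H\<^esub> (H +>\<^bsub>M\<^esub> x) = H +>\<^bsub>M\<^esub> (r \<odot>\<^bsub>M\<^esub> x)"
    if r: "r \<in> carrier R" and x: "x \<in> carrier M"
  proof -
    have "H +>\<^bsub>M\<^esub> (r \<odot>\<^bsub>M\<^esub> q) = H +>\<^bsub>M\<^esub> (r \<odot>\<^bsub>M\<^esub> x)" if q: "q \<in> H +>\<^bsub>M\<^esub> x" for q
    proof -
      have qc: "q \<in> carrier M" using q x H.a_elemrcos_carrier by blast
      have "q \<oplus>\<^bsub>M\<^esub> \<ominus>\<^bsub>M\<^esub> x \<in> H" using q x H.a_rcos_module_imp by blast
      then have "r \<odot>\<^bsub>M\<^esub> (q \<oplus>\<^bsub>M\<^esub> \<ominus>\<^bsub>M\<^esub> x) \<in> H" using assms(2) r by (simp add: submodule.smult_closed)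
      then have "r \<odot>\<^bsub>M\<^esub> q \<oplus>\<^bsub>M\<^esub> \<ominus>\<^bsub>M\<^esub> (r \<odot>\<^bsub>M\<^esub> x) \<in> H"
        using r x qc by (simp add: M.smult_r_distr M.smult_r_minus)
      then have "r \<odot>\<^bsub>M\<^esub> q \<in> H +>\<^bsub>M\<^esub> (r \<odot>\<^bsub>M\<^esub> x)"
        using H.a_rcos_module_rev r x qc by simp
      then show ?thesis using H.a_repr_independence' r x by simp
    qed
    moreover have "x \<in> H +>\<^bsub>M\<^esub> x" using x by (rule H.a_rcos_self)
    ultimately have "(\<Union>q\<in>H +>\<^bsub>M\<^esub> x. H +>\<^bsub>M\<^esub> (r \<odot>\<^bsub>M\<^esub> q)) = H +>\<^bsub>M\<^esub> (r \<odot>\<^bsub>M\<^esub> x)" by blast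
    then show ?thesis by (simp add: quot_mod_def)
  qed
qed

lemma quot_mod_module:
  assumes "module R M" "submodule H R M" shows "module R (quot_mod M H)"
proof -
  interpret M: module R M by fact
  note [simp] = quot_mod_sel[OF assms]
  show ?thesis
  proof (rule moduleI)
    show "abelian_group (quot_mod M H)"
    proof (rule abelian_groupI)
      fix Q assume "Q \<in> carrier (quot_mod M H)"
      then obtain x where x: "x \<in> carrier M" "Q = H +>\<^bsub>M\<^esub> x" by (auto simp: quot_mod_carrier)
      have "(H +>\<^bsub>M\<^esub> (\<ominus>\<^bsub>M\<^esub> x)) \<oplus>\<^bsub>quot_mod M H\<^esub> Q = \<zero>\<^bsub>quot_mod M H\<^esub>"
        using x by (simp add: M.l_neg)
      then show "\<exists>y\<in>carrier (quot_mod M H). y \<oplus>\<^bsub>quot_mod M H\<^esub> Q = \<zero>\<^bsub>quot_mod M H\<^esub>"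
        using x by (auto simp: quot_mod_carrier)
    qed (auto simp: quot_mod_carrier M.a_ac)
  qed (auto simp: quot_mod_carrier M.smult_l_distr M.smult_r_distr M.smult_assoc1 is_cring)
qed

lemma quot_proj_hom:
  assumes "module R M" "submodule H R M"
  shows "(\<lambda>x. H +>\<^bsub>M\<^esub> x) \<in> mod_hom R M (quot_mod M H)"
  using quot_mod_sel[OF assms] by (auto intro!: mod_homI simp: quot_mod_carrier)

lemma quot_proj_zero_iff:
  assumes "module R M" "submodule H R M" "x \<in> carrier M"
  shows "H +>\<^bsub>M\<^esub> x = \<zero>\<^bsub>quot_mod M H\<^esub> \<longleftrightarrow> x \<in> H"
proof -
  interpret H: abelian_subgroup H M by (rule submodule_abelian_subgroup[OF assms(1,2)])
  show ?thesis using H.a_rcos_const H.a_rcos_self assms(3) by (auto simp: quot_mod_def)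
qed

lemma quot_mod_spans:
  assumes "module R M" "submodule H R M" "spans R M A"
  shows "spans R (quot_mod M H) ((\<lambda>x. H +>\<^bsub>M\<^esub> x) ` A)"
proof -
  have "H +>\<^bsub>M\<^esub> x \<in> lin_span R (quot_mod M H) ((\<lambda>x. H +>\<^bsub>M\<^esub> x) ` A)" if "x \<in> carrier M" for x
    by (rule lin_span_hom_image[OF assms(3) that _ _ quot_proj_hom])
      (use assms in \<open>auto intro: lin_span.gen simp: quot_mod_module\<close>)
  then show ?thesis using spansD[OF assms(3)] by (auto simp: spans_def quot_mod_carrier)
qed

text \<open>A map that vanishes on \<open>H\<close> is constant on cosets, so the choice of a representative is immaterial.\<close>

lemma quot_lift_coset:
  assumes "module R M" "submodule H R M" "module R N" "f \<in> mod_hom R M N"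
    and "\<And>h. h \<in> H \<Longrightarrow> f h = \<zero>\<^bsub>N\<^esub>" and x: "x \<in> carrier M"
  shows "quot_lift f (H +>\<^bsub>M\<^esub> x) = f x"
proof -
  interpret M: module R M by fact
  interpret H: abelian_subgroup H M by (rule submodule_abelian_subgroup[OF assms(1,2)])
  have "f q = f x" if q: "q \<in> H +>\<^bsub>M\<^esub> x" for q
  proof -
    have qc: "q \<in> carrier M" using q x H.a_elemrcos_carrier by blast
    have "f (q \<ominus>\<^bsub>M\<^esub> x) = \<zero>\<^bsub>N\<^esub>" using q x H.a_rcos_module_imp assms(5) by (simp add: a_minus_def)
    then show ?thesis
      using mod_hom_minus[OF assms(1,3,4) qc x] mod_eq_of_minus[OF assms(3)] mod_homD(1)[OF assms(4)] qc x by simp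
  qed
  moreover have "x \<in> H +>\<^bsub>M\<^esub> x" using x by (rule H.a_rcos_self)
  ultimately show ?thesis unfolding quot_lift_def by (metis someI)
qed

lemma quot_lift_hom:
  assumes "module R M" "submodule H R M" "module R N" "f \<in> mod_hom R M N"
    and "\<And>h. h \<in> H \<Longrightarrow> f h = \<zero>\<^bsub>N\<^esub>"
  shows "quot_lift f \<in> mod_hom R (quot_mod M H) N"
  by (rule mod_homI) (use assms(1,3) mod_homD[OF assms(4)] in
     \<open>auto simp: quot_mod_carrier quot_mod_sel[OF assms(1,2)] quot_lift_coset[OF assms]\<close>)

section \<open>Finite products of modules\<close>

lemma fin_prod_sel:
  "carrier (fin_prod_mod R I M) = (\<Pi>\<^sub>E i\<in>I. carrier (M i))"
  "\<zero>\<^bsub>fin_prod_mod R I M\<^esub> = (\<lambda>i\<in>I. \<zero>\<^bsub>M i\<^esub>)"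
  "u \<oplus>\<^bsub>fin_prod_mod R I M\<^esub> v = (\<lambda>i\<in>I. u i \<oplus>\<^bsub>M i\<^esub> v i)"
  "r \<odot>\<^bsub>fin_prod_mod R I M\<^esub> u = (\<lambda>i\<in>I. r \<odot>\<^bsub>M i\<^esub> u i)"
  by (simp_all add: fin_prod_mod_def)

lemma fin_prod_module:
  assumes M: "\<And>i. i \<in> I \<Longrightarrow> module R (M i)"
  shows "module R (fin_prod_mod R I M)"
proof (rule moduleI)
  show "abelian_group (fin_prod_mod R I M)"
  proof (rule abelian_groupI)
    fix u assume u: "u \<in> carrier (fin_prod_mod R I M)"
    show "\<exists>y\<in>carrier (fin_prod_mod R I M). y \<oplus>\<^bsub>fin_prod_mod R I M\<^esub> u = \<zero>\<^bsub>fin_prod_mod R I M\<^esub>"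
    proof
      show "(\<lambda>i\<in>I. \<ominus>\<^bsub>M i\<^esub> u i) \<in> carrier (fin_prod_mod R I M)" using u M by (auto simp: fin_prod_sel PiE_iff)
      show "(\<lambda>i\<in>I. \<ominus>\<^bsub>M i\<^esub> u i) \<oplus>\<^bsub>fin_prod_mod R I M\<^esub> u = \<zero>\<^bsub>fin_prod_mod R I M\<^esub>"
        using u M by (auto simp: fin_prod_sel fun_eq_iff PiE_iff abelian_group.l_neg[OF mod_abelian])
    qed
  qed (use M in \<open>auto simp: fin_prod_sel fun_eq_iff PiE_iff mod_ac extensional_def\<close>)
qed (use M in \<open>auto simp: fin_prod_sel fun_eq_iff PiE_iff mod_l_distr mod_r_distr mod_assoc is_cring extensional_def\<close>)

lemma fin_prod_component_hom:
  "i \<in> I \<Longrightarrow> (\<lambda>u. u i) \<in> mod_hom R (fin_prod_mod R I M) (M i)"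
  by (auto intro!: mod_homI simp: fin_prod_sel)

lemma fin_prod_tuple_hom:
  assumes "module R N" "\<And>i. i \<in> I \<Longrightarrow> f i \<in> mod_hom R N (M i)"
  shows "(\<lambda>x. \<lambda>i\<in>I. f i x) \<in> mod_hom R N (fin_prod_mod R I M)"
  using mod_homD[OF assms(2)] by (auto intro!: mod_homI simp: fin_prod_sel fun_eq_iff)

lemma fin_prod_inject_hom:
  assumes "\<And>i. i \<in> I \<Longrightarrow> module R (M i)" "p \<in> I"
  shows "(\<lambda>x. \<lambda>i\<in>I. if i = p then x else \<zero>\<^bsub>M i\<^esub>) \<in> mod_hom R (M p) (fin_prod_mod R I M)"
  using assms by (auto intro!: mod_homI simp: fin_prod_sel fun_eq_iff)

lemma fin_prod_spans:
  assumes M: "\<And>i. i \<in> I \<Longrightarrow> module R (M i)" and "finite I" and A: "\<And>i. i \<in> I \<Longrightarrow> spans R (M i) (A i)"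
  shows "spans R (fin_prod_mod R I M) (\<Union>p\<in>I. (\<lambda>x. \<lambda>i\<in>I. if i = p then x else \<zero>\<^bsub>M i\<^esub>) ` A p)"
    (is "spans R ?P (\<Union>p\<in>I. ?inj p ` A p)")
proof -
  let ?B = "\<Union>p\<in>I. ?inj p ` A p"
  have inj: "?inj p x \<in> lin_span R ?P ?B" if "p \<in> I" "x \<in> carrier (M p)" for p x
  proof (rule lin_span_hom_image[OF A[OF that(1)] that(2) M[OF that(1)], where f = "?inj p"])
    show "module R ?P" by (rule fin_prod_module) (rule M)
    show "?inj p \<in> mod_hom R (M p) ?P" using M that(1) by (rule fin_prod_inject_hom)
    show "?inj p a \<in> lin_span R ?P ?B" if "a \<in> A p" for a
      using that \<open>p \<in> I\<close> by (intro lin_span.gen) blast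
  qed
  have *: "(\<lambda>i\<in>I. if i \<in> J then z i else \<zero>\<^bsub>M i\<^esub>) \<in> lin_span R ?P ?B"
    if z: "z \<in> carrier ?P" and J: "finite J" "J \<subseteq> I" for z J
    using J
  proof (induction J rule: finite_induct)
    case empty
    show ?case using lin_span.zero[of ?P R ?B] by (simp only: fin_prod_sel empty_iff if_False)
  next
    case (insert p J)
    have zc: "z i \<in> carrier (M i)" if "i \<in> I" for i using z that by (auto simp: fin_prod_sel)
    have "(\<lambda>i\<in>I. if i \<in> insert p J then z i else \<zero>\<^bsub>M i\<^esub>)
        = (\<lambda>i\<in>I. if i \<in> J then z i else \<zero>\<^bsub>M i\<^esub>) \<oplus>\<^bsub>?P\<^esub> ?inj p (z p)"
      using insert(2,4) M zc by (auto simp: fin_prod_sel fun_eq_iff)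
    also have "\<dots> \<in> lin_span R ?P ?B"
    proof (rule lin_span.add)
      show "(\<lambda>i\<in>I. if i \<in> J then z i else \<zero>\<^bsub>M i\<^esub>) \<in> lin_span R ?P ?B" using insert by blast
      show "?inj p (z p) \<in> lin_span R ?P ?B" using insert(4) by (intro inj zc) simp_all
    qed
    finally show ?case .
  qed
  have "z \<in> lin_span R ?P ?B" if z: "z \<in> carrier ?P" for z
  proof -
    have "z = (\<lambda>i\<in>I. if i \<in> I then z i else \<zero>\<^bsub>M i\<^esub>)"
      using z by (auto simp: fin_prod_sel fun_eq_iff PiE_iff extensional_def)
    then show ?thesis using *[OF z \<open>finite I\<close> subset_refl] by simp
  qed
  moreover have "?B \<subseteq> carrier ?P"
  proof
    fix b assume "b \<in> ?B"
    then obtain p x where px: "p \<in> I" "x \<in> A p" "b = ?inj p x" by blast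
    then have "x \<in> carrier (M p)" using spansD[OF A[OF px(1)]] by simp
    then show "b \<in> carrier ?P" using px M by (auto simp: fin_prod_sel PiE_iff)
  qed
  ultimately show ?thesis by (auto simp: spans_def)
qed

section \<open>Tensor products\<close>

lemma bilinear_post:
  "\<lbrakk>bilinear R M N P b; h \<in> mod_hom R P Q\<rbrakk> \<Longrightarrow> bilinear R M N Q (\<lambda>x y. h (b x y))"
  unfolding bilinear_def by (auto intro: mod_hom_comp)

lemma bilinear_pre:
  assumes "bilinear R M N P b" "f \<in> mod_hom R M' M" "g \<in> mod_hom R N' N"
  shows "bilinear R M' N' P (\<lambda>x y. b (f x) (g y))"
proof (rule bilinearI)
  fix y assume "y \<in> carrier N'"
  then show "(\<lambda>x. b (f x) (g y)) \<in> mod_hom R M' P"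
    by (intro mod_hom_comp[OF assms(2) bilinearD(1)[OF assms(1)]] mod_homD(1)[OF assms(3)])
next
  fix x assume "x \<in> carrier M'"
  then show "(\<lambda>y. b (f x) (g y)) \<in> mod_hom R N' P"
    by (intro mod_hom_comp[OF assms(3) bilinearD(2)[OF assms(1)]] mod_homD(1)[OF assms(2)])
qed

lemma bilinear_flip: "bilinear R M N P b \<Longrightarrow> bilinear R N M P (\<lambda>x y. b y x)"
  by (auto simp: bilinear_def)

lemma bilinear_minus:
  assumes "bilinear R M N P b" "module R M" "module R N" "module R P" "x \<in> carrier M" "x' \<in> carrier M" "y \<in> carrier N"
  shows "b (x \<ominus>\<^bsub>M\<^esub> x') y = b x y \<ominus>\<^bsub>P\<^esub> b x' y"
  using mod_hom_minus[OF assms(2,4) bilinearD(1)[OF assms(1,7)] assms(5,6)] .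

lemma bilinear_zero:
  assumes "bilinear R M N P b" "module R M" "module R N" "module R P"
  shows "y \<in> carrier N \<Longrightarrow> b \<zero>\<^bsub>M\<^esub> y = \<zero>\<^bsub>P\<^esub>" "x \<in> carrier M \<Longrightarrow> b x \<zero>\<^bsub>N\<^esub> = \<zero>\<^bsub>P\<^esub>"
  using mod_hom_zero[OF assms(2,4) bilinearD(1)[OF assms(1)]] mod_hom_zero[OF assms(3,4) bilinearD(2)[OF assms(1)]] by auto

lemma mod_minus_zero: "\<lbrakk>module R M; x \<in> carrier M\<rbrakk> \<Longrightarrow> x \<ominus>\<^bsub>M\<^esub> x = \<zero>\<^bsub>M\<^esub>"
  by (simp add: a_minus_def mod_r_neg)

text \<open>Used from right to left to see that a bilinear map factors through the tensor product, and from
  left to right, for the quotient map, to see that pure tensors are bilinear.\<close>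

lemma bilin_gens_killed_iff:
  fixes M :: "('a, 'm) module" and N :: "('a, 'n) module" and P :: "('a, 'p) module"
  assumes M: "module R M" and N: "module R N" and P: "module R P"
    and h: "h \<in> mod_hom R (free_mod R (carrier M \<times> carrier N)) P"
  shows "(\<forall>u\<in>bilin_gens R M N. h u = \<zero>\<^bsub>P\<^esub>) \<longleftrightarrow>
    bilinear R M N P (\<lambda>x y. h (free_gen R (carrier M \<times> carrier N) (x, y)))"
proof -
  let ?F = "free_mod R (carrier M \<times> carrier N)"
  let ?g = "\<lambda>x y. free_gen R (carrier M \<times> carrier N) (x, y)"
  let ?b = "\<lambda>x y. h (?g x y)"
  have bc: "?b x y \<in> carrier P" for x y by (rule mod_homD(1)[OF h]) simp
  have hm: "h (u \<ominus>\<^bsub>?F\<^esub> v) = \<zero>\<^bsub>P\<^esub> \<longleftrightarrow> h u = h v" if "u \<in> carrier ?F" "v \<in> carrier ?F" for u v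
    using mod_hom_minus[OF free_mod_module P h that] mod_eq_of_minus[OF P] mod_minus_zero[OF P]
      mod_homD(1)[OF h] that by metis
  have 1: "h (?g x y \<ominus>\<^bsub>?F\<^esub> (?g x' y' \<oplus>\<^bsub>?F\<^esub> ?g x'' y'')) = \<zero>\<^bsub>P\<^esub> \<longleftrightarrow> ?b x y = ?b x' y' \<oplus>\<^bsub>P\<^esub> ?b x'' y''"
    for x y x' y' x'' y'' by (subst hm) (simp_all add: mod_homD(2)[OF h])
  have 2: "h (?g x y \<ominus>\<^bsub>?F\<^esub> r \<odot>\<^bsub>?F\<^esub> ?g x' y') = \<zero>\<^bsub>P\<^esub> \<longleftrightarrow> ?b x y = r \<odot>\<^bsub>P\<^esub> ?b x' y'"
    if "r \<in> carrier R" for r x y x' y' using that by (subst hm) (simp_all add: mod_homD(3)[OF h])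
  show ?thesis
  proof
    assume L: "\<forall>u\<in>bilin_gens R M N. h u = \<zero>\<^bsub>P\<^esub>"
    show "bilinear R M N P ?b"
    proof (rule bilinearI; rule mod_homI)
      fix y x x' assume "y \<in> carrier N" "x \<in> carrier M" "x' \<in> carrier M"
      then have "?g (x \<oplus>\<^bsub>M\<^esub> x') y \<ominus>\<^bsub>?F\<^esub> (?g x y \<oplus>\<^bsub>?F\<^esub> ?g x' y) \<in> bilin_gens R M N"
        unfolding bilin_gens_def Let_def by blast
      with L 1 show "?b (x \<oplus>\<^bsub>M\<^esub> x') y = ?b x y \<oplus>\<^bsub>P\<^esub> ?b x' y" by blast
    next
      fix y y' x assume "y \<in> carrier N" "y' \<in> carrier N" "x \<in> carrier M"
      then have "?g x (y \<oplus>\<^bsub>N\<^esub> y') \<ominus>\<^bsub>?F\<^esub> (?g x y \<oplus>\<^bsub>?F\<^esub> ?g x y') \<in> bilin_gens R M N"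
        unfolding bilin_gens_def Let_def by blast
      with L 1 show "?b x (y \<oplus>\<^bsub>N\<^esub> y') = ?b x y \<oplus>\<^bsub>P\<^esub> ?b x y'" by blast
    next
      fix y x r assume r: "r \<in> carrier R" and "y \<in> carrier N" "x \<in> carrier M"
      then have "?g (r \<odot>\<^bsub>M\<^esub> x) y \<ominus>\<^bsub>?F\<^esub> r \<odot>\<^bsub>?F\<^esub> ?g x y \<in> bilin_gens R M N"
        unfolding bilin_gens_def Let_def by blast
      with L 2[OF r] show "?b (r \<odot>\<^bsub>M\<^esub> x) y = r \<odot>\<^bsub>P\<^esub> ?b x y" by blast
    next
      fix y x r assume r: "r \<in> carrier R" and "y \<in> carrier N" "x \<in> carrier M"
      then have "?g x (r \<odot>\<^bsub>N\<^esub> y) \<ominus>\<^bsub>?F\<^esub> r \<odot>\<^bsub>?F\<^esub> ?g x y \<in> bilin_gens R M N"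
        unfolding bilin_gens_def Let_def by blast
      with L 2[OF r] show "?b x (r \<odot>\<^bsub>N\<^esub> y) = r \<odot>\<^bsub>P\<^esub> ?b x y" by blast
    qed (rule bc)+
  next
    assume B: "bilinear R M N P ?b"
    show "\<forall>u\<in>bilin_gens R M N. h u = \<zero>\<^bsub>P\<^esub>"
    proof
      fix u assume "u \<in> bilin_gens R M N"
      then consider
        (a) x x' y where "u = ?g (x \<oplus>\<^bsub>M\<^esub> x') y \<ominus>\<^bsub>?F\<^esub> (?g x y \<oplus>\<^bsub>?F\<^esub> ?g x' y)"
          "x \<in> carrier M" "x' \<in> carrier M" "y \<in> carrier N"
        | (b) x y y' where "u = ?g x (y \<oplus>\<^bsub>N\<^esub> y') \<ominus>\<^bsub>?F\<^esub> (?g x y \<oplus>\<^bsub>?F\<^esub> ?g x y')"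
          "x \<in> carrier M" "y \<in> carrier N" "y' \<in> carrier N"
        | (c) r x y where "u = ?g (r \<odot>\<^bsub>M\<^esub> x) y \<ominus>\<^bsub>?F\<^esub> r \<odot>\<^bsub>?F\<^esub> ?g x y"
          "r \<in> carrier R" "x \<in> carrier M" "y \<in> carrier N"
        | (d) r x y where "u = ?g x (r \<odot>\<^bsub>N\<^esub> y) \<ominus>\<^bsub>?F\<^esub> r \<odot>\<^bsub>?F\<^esub> ?g x y"
          "r \<in> carrier R" "x \<in> carrier M" "y \<in> carrier N"
        unfolding bilin_gens_def Let_def by blast
      then show "h u = \<zero>\<^bsub>P\<^esub>"
      proof cases
        case a then show ?thesis using mod_homD(2)[OF bilinearD(1)[OF B a(4)] a(2,3)] 1 by simp
      next
        case b then show ?thesis using mod_homD(2)[OF bilinearD(2)[OF B b(2)] b(3,4)] 1 by simp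
      next
        case c then show ?thesis using mod_homD(3)[OF bilinearD(1)[OF B c(4)] c(2,3)] 2[OF c(2)] by simp
      next
        case d then show ?thesis using mod_homD(3)[OF bilinearD(2)[OF B d(3)] d(2,4)] 2[OF d(2)] by simp
      qed
    qed
  qed
qed

lemma bilin_gens_carrier:
  assumes "module R M" "module R N"
  shows "bilin_gens R M N \<subseteq> carrier (free_mod R (carrier M \<times> carrier N))"
  unfolding bilin_gens_def Let_def by auto

lemma bilin_rel_submodule:
  assumes "module R M" "module R N"
  shows "submodule (bilin_rel R M N) R (free_mod R (carrier M \<times> carrier N))"
proof -
  let ?F = "free_mod R (carrier M \<times> carrier N)"
  interpret F: module R ?F by simp
  have "submodule (carrier ?F) R ?F" by (rule submodule_of_closed) auto
  then have sub: "bilin_rel R M N \<subseteq> carrier ?F"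
    unfolding bilin_rel_def using bilin_gens_carrier[OF assms] by (intro hull_minimal) auto
  note E = F.submoduleE
  show ?thesis
  proof (rule submodule_of_closed[OF _ sub])
    show "\<zero>\<^bsub>?F\<^esub> \<in> bilin_rel R M N" unfolding bilin_rel_def hull_def
    proof (rule InterI; clarify)
      fix H assume "submodule H R ?F"
      then show "\<zero>\<^bsub>?F\<^esub> \<in> H"
        using subgroup.one_closed[OF submodule.axioms(1), of H R ?F] by simp
    qed
    show "a \<oplus>\<^bsub>?F\<^esub> b \<in> bilin_rel R M N" if "a \<in> bilin_rel R M N" "b \<in> bilin_rel R M N" for a b
      using that E(5) unfolding bilin_rel_def hull_def by blast
    show "r \<odot>\<^bsub>?F\<^esub> a \<in> bilin_rel R M N" if "r \<in> carrier R" "a \<in> bilin_rel R M N" for r a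
      using that E(4) unfolding bilin_rel_def hull_def by blast
  qed simp
qed

text \<open>The kernel of \<open>h\<close> is a submodule, so it contains the submodule generated by the relations.\<close>

lemma bilin_rel_killed:
  fixes M :: "('a, 'm) module" and N :: "('a, 'n) module" and P :: "('a, 'p) module"
  assumes M: "module R M" and N: "module R N" and P: "module R P"
    and h: "h \<in> mod_hom R (free_mod R (carrier M \<times> carrier N)) P"
    and gens: "\<forall>u\<in>bilin_gens R M N. h u = \<zero>\<^bsub>P\<^esub>" and u: "u \<in> bilin_rel R M N"
  shows "h u = \<zero>\<^bsub>P\<^esub>"
proof -
  let ?F = "free_mod R (carrier M \<times> carrier N)"
  let ?K = "{u \<in> carrier ?F. h u = \<zero>\<^bsub>P\<^esub>}"
  have "submodule ?K R ?F"
    by (rule submodule_of_closed) (auto simp: mod_hom_zero[OF _ P h] mod_homD(2,3)[OF h] P)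
  then have "bilin_rel R M N \<subseteq> ?K"
    unfolding bilin_rel_def using gens bilin_gens_carrier[OF M N] by (intro hull_minimal) auto
  with u show ?thesis by blast
qed

lemma tensor_module [simp]: "\<lbrakk>module R M; module R N\<rbrakk> \<Longrightarrow> module R (tensor R M N)"
  unfolding tensor_def by (intro quot_mod_module bilin_rel_submodule free_mod_module)

lemma pure_bilinear:
  assumes "module R M" "module R N"
  shows "bilinear R M N (tensor R M N) (pure R M N)"
proof -
  let ?F = "free_mod R (carrier M \<times> carrier N)"
  note S = bilin_rel_submodule[OF assms]
  let ?p = "\<lambda>u. bilin_rel R M N +>\<^bsub>?F\<^esub> u"
  have p: "?p \<in> mod_hom R ?F (tensor R M N)"
    unfolding tensor_def by (rule quot_proj_hom[OF free_mod_module S])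
  have "?p u = \<zero>\<^bsub>tensor R M N\<^esub>" if "u \<in> bilin_gens R M N" for u
  proof -
    have "u \<in> bilin_rel R M N" using that hull_subset unfolding bilin_rel_def by fast
    then show ?thesis unfolding tensor_def
      using quot_proj_zero_iff[OF free_mod_module S] that bilin_gens_carrier[OF assms] by blast
  qed
  then show ?thesis
    using bilin_gens_killed_iff[OF assms tensor_module[OF assms] p] by (simp add: pure_def[abs_def])
qed

lemma pure_closed [simp]:
  "\<lbrakk>module R M; module R N; x \<in> carrier M; y \<in> carrier N\<rbrakk> \<Longrightarrow> pure R M N x y \<in> carrier (tensor R M N)"
  by (rule bilinear_closed[OF pure_bilinear])

lemma tensor_spans:
  assumes M: "module R M" and N: "module R N" and A: "spans R M A" and B: "spans R N B"
  shows "spans R (tensor R M N) {pure R M N a b |a b. a \<in> A \<and> b \<in> B}" (is "spans R ?T ?S")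
proof -
  let ?F = "free_mod R (carrier M \<times> carrier N)"
  let ?p = "\<lambda>u. bilin_rel R M N +>\<^bsub>?F\<^esub> u"
  note sub = bilin_rel_submodule[OF M N]
  have "?p u \<in> lin_span R ?T ?S" if "u \<in> carrier ?F" for u
  proof (rule lin_span_hom_image[OF free_mod_spans that free_mod_module tensor_module[OF M N]])
    show "?p \<in> mod_hom R ?F ?T" unfolding tensor_def by (rule quot_proj_hom[OF free_mod_module sub])
    fix a assume "a \<in> free_gen R (carrier M \<times> carrier N) ` (carrier M \<times> carrier N)"
    then obtain x y where xy: "x \<in> carrier M" "y \<in> carrier N" "?p a = pure R M N x y"
      by (auto simp: pure_def)
    show "?p a \<in> lin_span R ?T ?S" unfolding xy(3)
      by (rule lin_span_bilinear[OF A B M N tensor_module[OF M N] pure_bilinear[OF M N] _ xy(1,2)])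
        (blast intro: lin_span.gen)
  qed
  then have "carrier ?T \<subseteq> lin_span R ?T ?S" by (auto simp: tensor_def quot_mod_carrier)
  moreover have "?S \<subseteq> carrier ?T" using spansD[OF A] spansD[OF B] M N by auto
  ultimately show ?thesis by (simp add: spans_def)
qed

lemma
  assumes M: "module R M" and N: "module R N" and P: "module R P" and b: "bilinear R M N P b"
  shows tensor_lift_hom: "tensor_lift R M N P b \<in> mod_hom R (tensor R M N) P"
    and tensor_lift_pure: "\<lbrakk>x \<in> carrier M; y \<in> carrier N\<rbrakk> \<Longrightarrow> tensor_lift R M N P b (pure R M N x y) = b x y"
proof -
  let ?S = "carrier M \<times> carrier N"
  let ?l = "free_lift R ?S P (\<lambda>(x, y). b x y)"
  have f: "(\<lambda>(x, y). b x y) \<in> ?S \<rightarrow> carrier P" using bilinear_closed[OF b] by auto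
  note l = free_lift_hom[OF P f]
  have "?l (free_gen R ?S (x, y)) = b x y" if "x \<in> carrier M" "y \<in> carrier N" for x y
    using free_lift_gen[OF P f, of "(x, y)"] that by simp
  note gen = this
  have "bilinear R M N P (\<lambda>x y. ?l (free_gen R ?S (x, y)))"
  proof (rule bilinearI)
    show "(\<lambda>x. ?l (free_gen R ?S (x, y))) \<in> mod_hom R M P" if "y \<in> carrier N" for y
      using bilinearD(1)[OF b that] by (rule mod_hom_cong) (use that M gen in auto)
    show "(\<lambda>y. ?l (free_gen R ?S (x, y))) \<in> mod_hom R N P" if "x \<in> carrier M" for x
      using bilinearD(2)[OF b that] by (rule mod_hom_cong) (use that N gen in auto)
  qed
  then have kill: "?l u = \<zero>\<^bsub>P\<^esub>" if "u \<in> bilin_rel R M N" for u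
    using bilin_gens_killed_iff[OF M N P l] bilin_rel_killed[OF M N P l _ that] by blast
  note sub = bilin_rel_submodule[OF M N]
  show "tensor_lift R M N P b \<in> mod_hom R (tensor R M N) P"
    unfolding tensor_lift_def tensor_def by (rule quot_lift_hom[OF free_mod_module sub P l kill])
  show "tensor_lift R M N P b (pure R M N x y) = b x y" if "x \<in> carrier M" "y \<in> carrier N"
    unfolding tensor_lift_def pure_def
    using quot_lift_coset[OF free_mod_module sub P l kill free_gen_closed] gen[OF that] by simp
qed

lemma tensor_hom_bilinear:
  assumes "module R M'" "module R N'" "f \<in> mod_hom R M M'" "g \<in> mod_hom R N N'"
  shows "bilinear R M N (tensor R M' N') (\<lambda>x y. pure R M' N' (f x) (g y))"
  using bilinear_pre[OF pure_bilinear assms(3,4)] assms by simp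

lemma
  assumes "module R M" "module R N" "module R M'" "module R N'" "f \<in> mod_hom R M M'" "g \<in> mod_hom R N N'"
  shows tensor_hom_hom: "tensor_hom R M N M' N' f g \<in> mod_hom R (tensor R M N) (tensor R M' N')"
    and tensor_hom_pure: "\<lbrakk>x \<in> carrier M; y \<in> carrier N\<rbrakk> \<Longrightarrow>
      tensor_hom R M N M' N' f g (pure R M N x y) = pure R M' N' (f x) (g y)"
  unfolding tensor_hom_def
  by (rule tensor_lift_hom tensor_lift_pure; use assms tensor_hom_bilinear[OF assms(3-6)] in simp)+

lemma tensor_hom_zero:
  assumes "module R M" "module R N" "module R M'" "module R N'" "f \<in> mod_hom R M M'" "g \<in> mod_hom R N N'"
  shows "tensor_hom R M N M' N' f g \<zero>\<^bsub>tensor R M N\<^esub> = \<zero>\<^bsub>tensor R M' N'\<^esub>"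
  by (rule mod_hom_zero[OF _ _ tensor_hom_hom[OF assms]]) (use assms in auto)

section \<open>Signs\<close>

lemma sign_parity: "sign R k = (if even k then \<one> else \<ominus> \<one>)"
  by (induction k) (auto simp: sign_def l_minus)

lemma sign_closed [simp]: "sign R k \<in> carrier R"
  by (simp add: sign_parity)

lemma sign_zero [simp]: "sign R 0 = \<one>"
  by (simp add: sign_parity)

lemma sign_square: "sign R k \<otimes> sign R k = \<one>"
  by (auto simp: sign_parity l_minus r_minus)

section \<open>Tensor products of complexes\<close>

text \<open>What makes the tensor product of two complexes consist of modules (\<open>graded\<close>) and its differential
  linear (\<open>dgraded\<close>).\<close>

definition graded :: "('a, 'm, 'z) chain_complex_scheme \<Rightarrow> bool" where
  "graded C \<longleftrightarrow> (\<forall>n. module R (cmod C n))"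

definition dgraded :: "('a, 'm, 'z) chain_complex_scheme \<Rightarrow> bool" where
  "dgraded C \<longleftrightarrow> graded C \<and> (\<forall>n. diff C n \<in> mod_hom R (cmod C (Suc n)) (cmod C n))"

lemma graded_module [simp]: "graded C \<Longrightarrow> module R (cmod C n)"
  by (simp add: graded_def)

lemma dgraded_graded: "dgraded C \<Longrightarrow> graded C"
  by (simp add: dgraded_def)

lemma dgraded_diff: "dgraded C \<Longrightarrow> diff C n \<in> mod_hom R (cmod C (Suc n)) (cmod C n)"
  by (simp add: dgraded_def)

lemma diff_closed [simp]: "dgraded C \<Longrightarrow> x \<in> carrier (cmod C (Suc n)) \<Longrightarrow> diff C n x \<in> carrier (cmod C n)"
  by (rule mod_homD(1)[OF dgraded_diff])

lemma cmod_tensor_complex: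
  "cmod (tensor_complex R C D) n = fin_prod_mod R {..n} (\<lambda>p. tensor R (cmod C p) (cmod D (n - p)))"
  by (simp add: tensor_complex_def)

lemma tensor_complex_graded [simp]: "\<lbrakk>graded C; graded D\<rbrakk> \<Longrightarrow> graded (tensor_complex R C D)"
  by (simp add: graded_def cmod_tensor_complex fin_prod_module)

lemma gpure_inject:
  assumes "p + q = n"
  shows "gpure R C D p q x y = (\<lambda>j\<in>{..n}. if j = p then pure R (cmod C p) (cmod D q) x y
    else \<zero>\<^bsub>tensor R (cmod C j) (cmod D (n - j))\<^esub>)"
  by (simp only: gpure_def assms)

lemma gpure_component:
  "\<lbrakk>p + q = n; j \<le> n\<rbrakk> \<Longrightarrow> gpure R C D p q x y j = (if j = p then pure R (cmod C p) (cmod D q) x y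
    else \<zero>\<^bsub>tensor R (cmod C j) (cmod D (n - j))\<^esub>)"
  by (simp add: gpure_inject)

lemma gpure_bilinear:
  assumes "graded C" "graded D" "p + q = n"
  shows "bilinear R (cmod C p) (cmod D q) (cmod (tensor_complex R C D) n) (gpure R C D p q)"
proof -
  let ?T = "\<lambda>j. tensor R (cmod C j) (cmod D (n - j))"
  have q: "q = n - p" "p \<le> n" using assms(3) by auto
  have "(\<lambda>x. \<lambda>j\<in>{..n}. if j = p then x else \<zero>\<^bsub>?T j\<^esub>) \<in> mod_hom R (?T p) (fin_prod_mod R {..n} ?T)"
    by (rule fin_prod_inject_hom) (use assms q in auto)
  from bilinear_post[OF pure_bilinear this]
  have "bilinear R (cmod C p) (cmod D (n - p)) (fin_prod_mod R {..n} ?T)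
    (\<lambda>x y. \<lambda>j\<in>{..n}. if j = p then pure R (cmod C p) (cmod D (n - p)) x y else \<zero>\<^bsub>?T j\<^esub>)"
    using assms by simp
  moreover have "gpure R C D p (n - p) = (\<lambda>x y. \<lambda>j\<in>{..n}. if j = p then pure R (cmod C p) (cmod D (n - p)) x y else \<zero>\<^bsub>?T j\<^esub>)"
    by (intro ext gpure_inject) (simp add: q(2))
  ultimately show ?thesis by (simp add: cmod_tensor_complex q(1))
qed

lemma gpure_closed [simp]:
  "\<lbrakk>graded C; graded D; x \<in> carrier (cmod C p); y \<in> carrier (cmod D q); p + q = n\<rbrakk>
    \<Longrightarrow> gpure R C D p q x y \<in> carrier (cmod (tensor_complex R C D) n)"
  by (rule bilinear_closed[OF gpure_bilinear])

lemma tensor_complex_spans: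
  assumes C: "graded C" and D: "graded D"
    and A: "\<And>p. spans R (cmod C p) (A p)" and B: "\<And>q. spans R (cmod D q) (B q)"
  shows "spans R (cmod (tensor_complex R C D) n)
    {gpure R C D p q a b |p q a b. p + q = n \<and> a \<in> A p \<and> b \<in> B q}"
proof -
  let ?T = "\<lambda>j. tensor R (cmod C j) (cmod D (n - j))"
  let ?G = "\<lambda>p. {pure R (cmod C p) (cmod D (n - p)) a b |a b. a \<in> A p \<and> b \<in> B (n - p)}"
  let ?i = "\<lambda>p x. \<lambda>j\<in>{..n}. if j = p then x else \<zero>\<^bsub>?T j\<^esub>"
  have "spans R (fin_prod_mod R {..n} ?T) (\<Union>p\<in>{..n}. ?i p ` ?G p)"
    by (rule fin_prod_spans) (use C D in \<open>simp_all add: tensor_spans A B\<close>)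
  moreover have "(\<Union>p\<in>{..n}. ?i p ` ?G p) = {gpure R C D p q a b |p q a b. p + q = n \<and> a \<in> A p \<and> b \<in> B q}"
    (is "?L = ?R")
  proof (intro equalityI subsetI)
    fix z assume "z \<in> ?L"
    then obtain p a b where z: "p \<le> n" "a \<in> A p" "b \<in> B (n - p)"
      "z = ?i p (pure R (cmod C p) (cmod D (n - p)) a b)" by auto
    then have "z = gpure R C D p (n - p) a b" using gpure_inject[of p "n - p" n C D a b] by simp
    moreover have "p + (n - p) = n" using z(1) by simp
    ultimately show "z \<in> ?R" using z(2,3) by blast
  next
    fix z assume "z \<in> ?R"
    then obtain p q a b where z: "p + q = n" "a \<in> A p" "b \<in> B q" "z = gpure R C D p q a b" by auto
    then have q: "q = n - p" "p \<le> n" by auto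
    have "z = ?i p (pure R (cmod C p) (cmod D q) a b)" using z gpure_inject[OF z(1)] by simp
    then show "z \<in> ?L" using z unfolding q by (intro UN_I[of p]) (use q in auto)
  qed
  ultimately show ?thesis by (simp add: cmod_tensor_complex)
qed

text \<open>Linear maps on \<open>(C \<otimes> D)\<^sub>n\<close> are compared on homogeneous tensors of generators. The generating sets
  are all of \<open>C\<close> and \<open>D\<close> where an identity holds for arbitrary tensors, and the classes of cells where it
  involves the explicit form of the diagonal.\<close>

lemma tensor_complex_hom_eqI:
  assumes "graded C" "graded D" "module R N"
    and "\<And>p. spans R (cmod C p) (A p)" "\<And>q. spans R (cmod D q) (B q)"
    and "f \<in> mod_hom R (cmod (tensor_complex R C D) n) N" "g \<in> mod_hom R (cmod (tensor_complex R C D) n) N"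
    and "\<And>p q a b. \<lbrakk>p + q = n; a \<in> A p; b \<in> B q\<rbrakk> \<Longrightarrow> f (gpure R C D p q a b) = g (gpure R C D p q a b)"
    and "z \<in> carrier (cmod (tensor_complex R C D) n)"
  shows "f z = g z"
  by (rule mod_hom_eqI[OF tensor_complex_spans[OF assms(1,2,4,5)] _ assms(3,6,7) _ assms(9)])
    (use assms(1,2) in simp, clarify, rule assms(8), simp_all)

lemma tensor_chain_map_hom:
  assumes "graded C" "graded D" "graded C'" "graded D'"
    and "\<And>p. f p \<in> mod_hom R (cmod C p) (cmod C' p)" "\<And>q. g q \<in> mod_hom R (cmod D q) (cmod D' q)"
  shows "tensor_chain_map R C D C' D' f g n
    \<in> mod_hom R (cmod (tensor_complex R C D) n) (cmod (tensor_complex R C' D') n)"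
  unfolding cmod_tensor_complex tensor_chain_map_def
proof (rule fin_prod_tuple_hom)
  fix p assume p: "p \<in> {..n}"
  show "(\<lambda>z. tensor_hom R (cmod C p) (cmod D (n - p)) (cmod C' p) (cmod D' (n - p)) (f p) (g (n - p)) (z p))
    \<in> mod_hom R (fin_prod_mod R {..n} (\<lambda>p. tensor R (cmod C p) (cmod D (n - p)))) (tensor R (cmod C' p) (cmod D' (n - p)))"
    by (rule mod_hom_comp[OF fin_prod_component_hom[OF p] tensor_hom_hom]) (use assms in simp_all)
qed (use assms in \<open>simp add: fin_prod_module\<close>)

lemma tensor_chain_map_gpure:
  assumes "graded C" "graded D" "graded C'" "graded D'"
    and "\<And>p. f p \<in> mod_hom R (cmod C p) (cmod C' p)" "\<And>q. g q \<in> mod_hom R (cmod D q) (cmod D' q)"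
    and "p + q = n" "x \<in> carrier (cmod C p)" "y \<in> carrier (cmod D q)"
  shows "tensor_chain_map R C D C' D' f g n (gpure R C D p q x y) = gpure R C' D' p q (f p x) (g q y)"
proof -
  have "tensor_hom R (cmod C j) (cmod D (n - j)) (cmod C' j) (cmod D' (n - j)) (f j) (g (n - j)) (gpure R C D p q x y j)
     = gpure R C' D' p q (f p x) (g q y) j" if "j \<le> n" for j
    using assms(1-4,7-) that
    by (auto simp: gpure_component[OF assms(7)] tensor_hom_pure[OF _ _ _ _ assms(5,6)] tensor_hom_zero[OF _ _ _ _ assms(5,6)])
  then show ?thesis
    by (auto simp: tensor_chain_map_def fun_eq_iff gpure_inject[OF assms(7), of C' D'])
qed

lemma tensor_complex_diff_hom:
  assumes "dgraded C" "dgraded D"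
  shows "diff (tensor_complex R C D) n \<in> mod_hom R (cmod (tensor_complex R C D) (Suc n)) (cmod (tensor_complex R C D) n)"
proof -
  note [simp] = dgraded_graded[OF assms(1)] dgraded_graded[OF assms(2)]
  show ?thesis
    unfolding cmod_tensor_complex
    apply (simp add: tensor_complex_def)
    apply (rule fin_prod_tuple_hom)
     apply (simp add: fin_prod_module)
    subgoal for p
      apply (rule mod_hom_plus)
        apply simp
       apply (rule mod_hom_comp[OF fin_prod_component_hom])
        apply simp
       apply simp
       apply (rule tensor_hom_hom; simp add: dgraded_diff assms mod_hom_id)
      apply (rule mod_hom_scale)
        apply simp
       apply (rule mod_hom_comp[OF fin_prod_component_hom])
        apply simp
       apply (simp add: Suc_diff_le)
       apply (rule tensor_hom_hom; simp add: dgraded_diff assms mod_hom_id)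
      apply simp
      done
    done
qed

text \<open>In degree \<open>0\<close> there is no \<open>\<partial>x\<close>, and \<open>p - 1\<close> is truncated subtraction; hence the conditionals.\<close>

lemma tensor_complex_diff_gpure:
  assumes "dgraded C" "dgraded D" and n: "p + q = Suc n"
    and x: "x \<in> carrier (cmod C p)" and y: "y \<in> carrier (cmod D q)"
  shows "diff (tensor_complex R C D) n (gpure R C D p q x y) =
    (if p = 0 then \<zero>\<^bsub>cmod (tensor_complex R C D) n\<^esub> else gpure R C D (p - 1) q (diff C (p - 1) x) y)
    \<oplus>\<^bsub>cmod (tensor_complex R C D) n\<^esub> sign R p \<odot>\<^bsub>cmod (tensor_complex R C D) n\<^esub>
    (if q = 0 then \<zero>\<^bsub>cmod (tensor_complex R C D) n\<^esub> else gpure R C D p (q - 1) x (diff D (q - 1) y))"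
    (is "_ = ?l \<oplus>\<^bsub>?V\<^esub> _ \<odot>\<^bsub>_\<^esub> ?r")
proof -
  note [simp] = dgraded_graded[OF assms(1)] dgraded_graded[OF assms(2)]
  let ?T = "\<lambda>j. tensor R (cmod C j) (cmod D (n - j))"
  have l: "?l j = (if Suc j = p then pure R (cmod C j) (cmod D q) (diff C j x) y else \<zero>\<^bsub>?T j\<^esub>)"
    if "j \<le> n" for j
    using that n by (cases p) (auto simp: cmod_tensor_complex fin_prod_sel gpure_component)
  have r: "?r j = (if j = p then pure R (cmod C p) (cmod D (n - j)) x (diff D (n - j) y) else \<zero>\<^bsub>?T j\<^esub>)"
    if "j \<le> n" for j
    using that n by (cases q) (auto simp: cmod_tensor_complex fin_prod_sel gpure_component)
  have 1: "tensor_hom R (cmod C (Suc j)) (cmod D (n - j)) (cmod C j) (cmod D (n - j)) (diff C j) (\<lambda>y. y)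
      (gpure R C D p q x y (Suc j)) = ?l j" if j: "j \<le> n" for j
  proof (cases "Suc j = p")
    case True
    then have pq: "p = Suc j" "q = n - j" using n by auto
    have "gpure R C D p q x y (Suc j) = pure R (cmod C (Suc j)) (cmod D (n - j)) x y"
      using gpure_component[OF n, of "Suc j" C D x y] j pq by simp
    then show ?thesis using x y
      by (simp add: l[OF j] True) (simp add: pq tensor_hom_pure dgraded_diff assms mod_hom_id)
  next
    case False
    then show ?thesis using gpure_component[OF n, of "Suc j" C D x y] j
      by (simp add: l[OF j] tensor_hom_zero dgraded_diff assms mod_hom_id)
  qed
  have 2: "tensor_hom R (cmod C j) (cmod D (Suc (n - j))) (cmod C j) (cmod D (n - j)) (\<lambda>y. y) (diff D (n - j))
      (gpure R C D p q x y j) = ?r j" if j: "j \<le> n" for j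
  proof (cases "j = p")
    case True
    then have pq: "p = j" "q = Suc (n - j)" using n j by auto
    have "gpure R C D p q x y j = pure R (cmod C j) (cmod D (Suc (n - j))) x y"
      using gpure_component[OF n, of j C D x y] j pq by simp
    then show ?thesis using x y
      by (simp only: r[OF j]) (simp add: pq tensor_hom_pure dgraded_diff assms mod_hom_id)
  next
    case False
    then show ?thesis using gpure_component[OF n, of j C D x y] j
      by (simp add: r[OF j] Suc_diff_le tensor_hom_zero dgraded_diff assms mod_hom_id)
  qed
  have 3: "sign R j \<odot>\<^bsub>?T j\<^esub> ?r j = sign R p \<odot>\<^bsub>?T j\<^esub> ?r j" if j: "j \<le> n" for j
    by (simp add: r[OF j])
  have "diff (tensor_complex R C D) n (gpure R C D p q x y) = (\<lambda>j\<in>{..n}. ?l j \<oplus>\<^bsub>?T j\<^esub> sign R p \<odot>\<^bsub>?T j\<^esub> ?r j)"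
  proof -
    have d: "diff (tensor_complex R C D) n z = (\<lambda>j\<in>{..n}.
        tensor_hom R (cmod C (Suc j)) (cmod D (n - j)) (cmod C j) (cmod D (n - j)) (diff C j) (\<lambda>y. y) (z (Suc j))
        \<oplus>\<^bsub>?T j\<^esub> sign R j \<odot>\<^bsub>?T j\<^esub>
          tensor_hom R (cmod C j) (cmod D (Suc (n - j))) (cmod C j) (cmod D (n - j)) (\<lambda>y. y) (diff D (n - j)) (z j))" for z
      by (simp add: tensor_complex_def)
    show ?thesis unfolding d by (rule restrict_ext) (simp only: 1 2 3 atMost_iff)
  qed
  also have "(\<lambda>j\<in>{..n}. l j \<oplus>\<^bsub>?T j\<^esub> sign R p \<odot>\<^bsub>?T j\<^esub> r j) = l \<oplus>\<^bsub>?V\<^esub> sign R p \<odot>\<^bsub>?V\<^esub> r" for l r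
    by (auto simp: cmod_tensor_complex fin_prod_sel fun_eq_iff)
  finally show ?thesis .
qed

section \<open>The symmetry and the unit isomorphisms\<close>

lemma swap_hom:
  assumes "graded C"
  shows "swap_action R C n \<in> mod_hom R (cmod (tensor_complex R C C) n) (cmod (tensor_complex R C C) n)"
  unfolding cmod_tensor_complex swap_action_def
proof (rule fin_prod_tuple_hom)
  fix p assume p: "p \<in> {..n}"
  then have e: "n - (n - p) = p" and p': "n - p \<in> {..n}" by auto
  let ?T = "tensor R (cmod C p) (cmod C (n - p))"
  have "tensor_lift R (cmod C (n - p)) (cmod C p) ?T (\<lambda>x y. pure R (cmod C p) (cmod C (n - p)) y x)
      \<in> mod_hom R (tensor R (cmod C (n - p)) (cmod C p)) ?T"
    by (rule tensor_lift_hom) (use assms in \<open>simp_all add: bilinear_flip pure_bilinear\<close>)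
  then have "tensor_lift R (cmod C (n - p)) (cmod C p) ?T (\<lambda>x y. pure R (cmod C p) (cmod C (n - p)) y x)
      \<in> mod_hom R (tensor R (cmod C (n - p)) (cmod C (n - (n - p)))) ?T" by (simp add: e)
  from mod_hom_scale[OF _ mod_hom_comp[OF fin_prod_component_hom[OF p', where M = "\<lambda>j. tensor R (cmod C j) (cmod C (n - j))"] this]]
  show "(\<lambda>z. sign R (p * (n - p)) \<odot>\<^bsub>?T\<^esub> tensor_lift R (cmod C (n - p)) (cmod C p) ?T
      (\<lambda>x y. pure R (cmod C p) (cmod C (n - p)) y x) (z (n - p)))
    \<in> mod_hom R (fin_prod_mod R {..n} (\<lambda>p. tensor R (cmod C p) (cmod C (n - p)))) ?T"
    using assms by simp
qed (use assms in \<open>simp add: fin_prod_module\<close>)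

lemma swap_gpure:
  assumes C: "graded C" and n: "p + q = n" and x: "x \<in> carrier (cmod C p)" and y: "y \<in> carrier (cmod C q)"
  shows "swap_action R C n (gpure R C C p q x y)
    = sign R (p * q) \<odot>\<^bsub>cmod (tensor_complex R C C) n\<^esub> gpure R C C q p y x"
proof -
  have n': "q + p = n" using n by simp
  have "sign R (j * (n - j)) \<odot>\<^bsub>tensor R (cmod C j) (cmod C (n - j))\<^esub>
      tensor_lift R (cmod C (n - j)) (cmod C j) (tensor R (cmod C j) (cmod C (n - j)))
        (\<lambda>x y. pure R (cmod C j) (cmod C (n - j)) y x) (gpure R C C p q x y (n - j))
    = sign R (p * q) \<odot>\<^bsub>tensor R (cmod C j) (cmod C (n - j))\<^esub> gpure R C C q p y x j" if j: "j \<le> n" for j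
  proof -
    let ?T = "tensor R (cmod C j) (cmod C (n - j))"
    let ?l = "tensor_lift R (cmod C (n - j)) (cmod C j) ?T (\<lambda>x y. pure R (cmod C j) (cmod C (n - j)) y x)"
    have b: "bilinear R (cmod C (n - j)) (cmod C j) ?T (\<lambda>x y. pure R (cmod C j) (cmod C (n - j)) y x)"
      using C by (simp add: bilinear_flip pure_bilinear)
    show ?thesis
    proof (cases "j = q")
      case True
      then have pq: "q = j" "p = n - j" using n by auto
      have "gpure R C C p q x y (n - j) = pure R (cmod C (n - j)) (cmod C j) x y"
        using gpure_component[OF n, of "n - j" C C x y] pq by simp
      moreover have "gpure R C C q p y x j = pure R (cmod C j) (cmod C (n - j)) y x"
        using gpure_component[OF n', of j C C y x] j pq by simp
      moreover have "?l (pure R (cmod C (n - j)) (cmod C j) x y) = pure R (cmod C j) (cmod C (n - j)) y x"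
        by (rule tensor_lift_pure[OF _ _ _ b]) (use C x y pq in simp_all)
      ultimately show ?thesis by (simp add: pq mult.commute)
    next
      case False
      then have "n - j \<noteq> p" using n j by auto
      then have "gpure R C C p q x y (n - j) = \<zero>\<^bsub>tensor R (cmod C (n - j)) (cmod C j)\<^esub>"
        using gpure_component[OF n, of "n - j" C C x y] j by simp
      moreover have "gpure R C C q p y x j = \<zero>\<^bsub>?T\<^esub>"
        using gpure_component[OF n', of j C C y x] j False by simp
      moreover have "?l \<zero>\<^bsub>tensor R (cmod C (n - j)) (cmod C j)\<^esub> = \<zero>\<^bsub>?T\<^esub>"
        by (rule mod_hom_zero[OF _ _ tensor_lift_hom[OF _ _ _ b]]) (use C in simp_all)
      ultimately show ?thesis using C by simp
    qed
  qed
  then show ?thesis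
    by (auto simp: swap_action_def cmod_tensor_complex fin_prod_sel fun_eq_iff)
qed

lemma swap_swap:
  assumes C: "graded C" and z: "z \<in> carrier (cmod (tensor_complex R C C) n)"
  shows "swap_action R C n (swap_action R C n z) = z"
proof (rule tensor_complex_hom_eqI[OF C C _ spans_carrier spans_carrier mod_hom_comp[OF swap_hom[OF C] swap_hom[OF C]] mod_hom_id _ z])
  fix p q a b assume n: "p + q = n" and a: "a \<in> carrier (cmod C p)" and b: "b \<in> carrier (cmod C q)"
  have n': "q + p = n" using n by simp
  show "swap_action R C n (swap_action R C n (gpure R C C p q a b)) = gpure R C C p q a b"
    using C n n' a b
    by (simp add: swap_gpure mod_homD(3)[OF swap_hom] mod_assoc[symmetric] sign_square mult.commute)
qed (use C in simp)

text \<open>On \<open>x \<otimes> y\<close> both sides are combinations of \<open>y \<otimes> \<partial>x\<close> and \<open>\<partial>y \<otimes> x\<close>; the sign \<open>(-1)\<^sup>p\<^sup>q\<close> in \<open>T\<close> is what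
  makes the coefficients agree.\<close>

lemma swap_diff:
  assumes C: "dgraded C" and z: "z \<in> carrier (cmod (tensor_complex R C C) (Suc n))"
  shows "swap_action R C n (diff (tensor_complex R C C) n z)
    = diff (tensor_complex R C C) n (swap_action R C (Suc n) z)"
proof -
  note g [simp] = dgraded_graded[OF C]
  let ?V = "cmod (tensor_complex R C C) n"
  note D = tensor_complex_diff_hom[OF C C, of n]
  show ?thesis
  proof (rule tensor_complex_hom_eqI[OF g g _ spans_carrier spans_carrier mod_hom_comp[OF D swap_hom[OF g]] mod_hom_comp[OF swap_hom[OF g] D] _ z])
    fix p q a b assume n: "p + q = Suc n" and a: "a \<in> carrier (cmod C p)" and b: "b \<in> carrier (cmod C q)"
    have n': "q + p = Suc n" using n by simp
    have "swap_action R C n \<zero>\<^bsub>?V\<^esub> = \<zero>\<^bsub>?V\<^esub>" by (rule mod_hom_zero[OF _ _ swap_hom]) simp_all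
    note s [simp] = this swap_gpure mod_homD(2,3)[OF swap_hom] mod_homD(3)[OF D]
      tensor_complex_diff_gpure[OF C C]
    consider (00) p' q' where "p = Suc p'" "q = Suc q'" | (0) q' where "p = 0" "q = Suc q'"
      | (1) p' where "p = Suc p'" "q = 0" using n by (cases p; cases q) auto
    then show "swap_action R C n (diff (tensor_complex R C C) n (gpure R C C p q a b)) =
       diff (tensor_complex R C C) n (swap_action R C (Suc n) (gpure R C C p q a b))"
    proof cases
      case 00
      then have e: "p' + Suc q' = n" "Suc p' + q' = n" "Suc q' + p' = n" "q' + Suc p' = n"
        "Suc p' + Suc q' = Suc n" "Suc q' + Suc p' = Suc n" using n by auto
      have ab: "a \<in> carrier (cmod C (Suc p'))" "b \<in> carrier (cmod C (Suc q'))" using a b 00 by auto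
      let ?x = "gpure R C C (Suc q') p' b (diff C p' a)" and ?y = "gpure R C C q' (Suc p') (diff C q' b) a"
      have c: "?x \<in> carrier ?V" "?y \<in> carrier ?V" using C ab e by simp_all
      have l: "swap_action R C n (diff (tensor_complex R C C) n (gpure R C C p q a b)) =
          sign R (p' * Suc q') \<odot>\<^bsub>?V\<^esub> ?x \<oplus>\<^bsub>?V\<^esub> sign R (Suc p') \<odot>\<^bsub>?V\<^esub> (sign R (Suc p' * q') \<odot>\<^bsub>?V\<^esub> ?y)"
        using e C ab by (simp add: 00)
      have r: "diff (tensor_complex R C C) n (swap_action R C (Suc n) (gpure R C C p q a b)) =
          sign R (Suc p' * Suc q') \<odot>\<^bsub>?V\<^esub> (?y \<oplus>\<^bsub>?V\<^esub> sign R (Suc q') \<odot>\<^bsub>?V\<^esub> ?x)"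
        using e C ab by (simp add: 00)
      have s1: "sign R (Suc p') \<otimes> sign R (Suc p' * q') = sign R (Suc p' * Suc q')"
        and s2: "sign R (Suc p' * Suc q') \<otimes> sign R (Suc q') = sign R (p' * Suc q')"
        by (auto simp: sign_parity l_minus r_minus)
      show ?thesis unfolding l r using c
        by (simp add: mod_r_distr mod_assoc[symmetric] s1 s2 del: mult_Suc mult_Suc_right)
          (simp add: mod_ac)
    next
      case 0
      then show ?thesis using n n' C b a by simp
    next
      case 1
      then show ?thesis using n n' C b a by simp
    qed
  qed simp_all
qed

lemma unit_complex_sel:
  "carrier (cmod (unit_complex R) n) = (if n = 0 then carrier R else {\<zero>})"
  "x \<oplus>\<^bsub>cmod (unit_complex R) n\<^esub> y = x \<oplus> y"
  "\<zero>\<^bsub>cmod (unit_complex R) n\<^esub> = \<zero>"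
  "r \<odot>\<^bsub>cmod (unit_complex R) n\<^esub> y = r \<otimes> y"
  "diff (unit_complex R) n = (\<lambda>x. \<zero>)"
  by (simp_all add: unit_complex_def)

lemma unit_complex_graded [simp]: "graded (unit_complex R)"
  unfolding graded_def
proof
  fix n
  have "abelian_group (cmod (unit_complex R) n)"
    by (rule abelian_groupI) (auto simp: unit_complex_sel a_ac l_neg split: if_splits intro: bexI[of _ "\<ominus> _"])
  then show "module R (cmod (unit_complex R) n)"
    by (rule moduleI[OF is_cring]) (auto simp: unit_complex_sel l_distr r_distr m_assoc split: if_splits)
qed

lemma smult_bilinear:
  "module R M \<Longrightarrow> bilinear R (cmod (unit_complex R) 0) M M (\<lambda>r x. r \<odot>\<^bsub>M\<^esub> x)"
  by (rule bilinearI; rule mod_homI) (auto simp: unit_complex_sel mod_l_distr mod_r_distr mod_assoc mod_smult_comm)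

lemma left_unitor_hom:
  assumes "graded C"
  shows "left_unitor R C n \<in> mod_hom R (cmod (tensor_complex R (unit_complex R) C) n) (cmod C n)"
proof -
  have "tensor_lift R (cmod (unit_complex R) 0) (cmod C (n - 0)) (cmod C n) (\<lambda>r c. r \<odot>\<^bsub>cmod C n\<^esub> c)
     \<in> mod_hom R (tensor R (cmod (unit_complex R) 0) (cmod C (n - 0))) (cmod C n)"
    by (rule tensor_lift_hom) (use assms in \<open>simp_all add: smult_bilinear\<close>)
  from mod_hom_comp[OF fin_prod_component_hom[of 0 "{..n}" "\<lambda>j. tensor R (cmod (unit_complex R) j) (cmod C (n - j))"] this]
  show ?thesis by (simp add: cmod_tensor_complex left_unitor_def[abs_def])
qed

lemma right_unitor_hom:
  assumes "graded C"
  shows "right_unitor R C n \<in> mod_hom R (cmod (tensor_complex R C (unit_complex R)) n) (cmod C n)"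
proof -
  have "tensor_lift R (cmod C n) (cmod (unit_complex R) (n - n)) (cmod C n) (\<lambda>c r. r \<odot>\<^bsub>cmod C n\<^esub> c)
     \<in> mod_hom R (tensor R (cmod C n) (cmod (unit_complex R) (n - n))) (cmod C n)"
    by (rule tensor_lift_hom) (use assms in \<open>simp_all add: bilinear_flip smult_bilinear\<close>)
  from mod_hom_comp[OF fin_prod_component_hom[of n "{..n}" "\<lambda>j. tensor R (cmod C j) (cmod (unit_complex R) (n - j))"] this]
  show ?thesis by (simp add: cmod_tensor_complex right_unitor_def[abs_def])
qed

lemma left_unitor_gpure:
  assumes C: "graded C" and n: "p + q = n" and r: "r \<in> carrier (cmod (unit_complex R) p)" and c: "c \<in> carrier (cmod C q)"
  shows "left_unitor R C n (gpure R (unit_complex R) C p q r c) = (if p = 0 then r \<odot>\<^bsub>cmod C n\<^esub> c else \<zero>\<^bsub>cmod C n\<^esub>)"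
proof -
  have b: "bilinear R (cmod (unit_complex R) 0) (cmod C n) (cmod C n) (\<lambda>r c. r \<odot>\<^bsub>cmod C n\<^esub> c)"
    using C by (simp add: smult_bilinear)
  show ?thesis
    using gpure_component[OF n, of 0 "unit_complex R" C r c] n r c C
      tensor_lift_pure[OF _ _ _ b, of r c] mod_hom_zero[OF _ _ tensor_lift_hom[OF _ _ _ b]]
    by (auto simp: left_unitor_def)
qed

lemma right_unitor_gpure:
  assumes C: "graded C" and n: "p + q = n" and r: "r \<in> carrier (cmod (unit_complex R) q)" and c: "c \<in> carrier (cmod C p)"
  shows "right_unitor R C n (gpure R C (unit_complex R) p q c r) = (if q = 0 then r \<odot>\<^bsub>cmod C n\<^esub> c else \<zero>\<^bsub>cmod C n\<^esub>)"
proof -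
  have b: "bilinear R (cmod C n) (cmod (unit_complex R) 0) (cmod C n) (\<lambda>c r. r \<odot>\<^bsub>cmod C n\<^esub> c)"
    using C by (simp add: bilinear_flip smult_bilinear)
  show ?thesis
    using gpure_component[OF n, of n C "unit_complex R" c r] n r c C
      tensor_lift_pure[OF _ _ _ b, of c r] mod_hom_zero[OF _ _ tensor_lift_hom[OF _ _ _ b]]
    by (auto simp: right_unitor_def)
qed

section \<open>The category of coalgebras\<close>

lemma tensor_chain_map_ident:
  assumes "graded C" "graded D" "\<And>p x. x \<in> carrier (cmod C p) \<Longrightarrow> f p x = x" "\<And>q y. y \<in> carrier (cmod D q) \<Longrightarrow> g q y = y"
    and z: "z \<in> carrier (cmod (tensor_complex R C D) n)"
  shows "tensor_chain_map R C D C D f g n z = z"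
proof -
  have f: "f p \<in> mod_hom R (cmod C p) (cmod C p)" for p
    by (rule mod_hom_cong[OF mod_hom_id]) (use assms(1,3) in simp_all)
  have g: "g p \<in> mod_hom R (cmod D p) (cmod D p)" for p
    by (rule mod_hom_cong[OF mod_hom_id]) (use assms(2,4) in simp_all)
  note a = assms(1,2) assms(1,2)
  show ?thesis
    by (rule tensor_complex_hom_eqI[OF assms(1,2) _ spans_carrier spans_carrier tensor_chain_map_hom[OF a f g] mod_hom_id _ z])
      (use assms(1,2) in \<open>simp_all add: tensor_chain_map_gpure[OF a f g] assms(3,4)\<close>)
qed

lemma tensor_chain_map_comp:
  assumes "graded C" "graded D" "graded C'" "graded D'" "graded C''" "graded D''"
    and f: "\<And>p. f p \<in> mod_hom R (cmod C p) (cmod C' p)" and g: "\<And>q. g q \<in> mod_hom R (cmod D q) (cmod D' q)"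
    and f': "\<And>p. f' p \<in> mod_hom R (cmod C' p) (cmod C'' p)" and g': "\<And>q. g' q \<in> mod_hom R (cmod D' q) (cmod D'' q)"
    and h: "\<And>p x. x \<in> carrier (cmod C p) \<Longrightarrow> h p x = f' p (f p x)"
    and k: "\<And>q y. y \<in> carrier (cmod D q) \<Longrightarrow> k q y = g' q (g q y)"
    and z: "z \<in> carrier (cmod (tensor_complex R C D) n)"
  shows "tensor_chain_map R C D C'' D'' h k n z
    = tensor_chain_map R C' D' C'' D'' f' g' n (tensor_chain_map R C D C' D' f g n z)"
proof -
  have h': "h p \<in> mod_hom R (cmod C p) (cmod C'' p)" for p
    by (rule mod_hom_cong[OF mod_hom_comp[OF f f']]) (use h assms(1) in simp_all)
  have k': "k q \<in> mod_hom R (cmod D q) (cmod D'' q)" for q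
    by (rule mod_hom_cong[OF mod_hom_comp[OF g g']]) (use k assms(2) in simp_all)
  note H = tensor_chain_map_hom[OF assms(1,2,5,6) h' k'] tensor_chain_map_hom[OF assms(1-4) f g]
    tensor_chain_map_hom[OF assms(3-6) f' g']
  show ?thesis
  proof (rule tensor_complex_hom_eqI[OF assms(1,2) _ spans_carrier spans_carrier H(1) mod_hom_comp[OF H(2,3)] _ z])
    fix p q a b assume n: "p + q = n" and a: "a \<in> carrier (cmod C p)" and b: "b \<in> carrier (cmod D q)"
    show "tensor_chain_map R C D C'' D'' h k n (gpure R C D p q a b)
      = tensor_chain_map R C' D' C'' D'' f' g' n (tensor_chain_map R C D C' D' f g n (gpure R C D p q a b))"
      using n a b mod_homD(1)[OF f a] mod_homD(1)[OF g b]
      by (simp add: tensor_chain_map_gpure[OF assms(1,2,5,6) h' k'] tensor_chain_map_gpure[OF assms(1-4) f g]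
        tensor_chain_map_gpure[OF assms(3-6) f' g'] h k)
  qed (use assms(5,6) in simp)
qed

lemma W_cmod: "cmod (W_complex R) k = free_mod R UNIV"
  by (simp add: W_complex_def)

lemma W_graded [simp]: "graded (W_complex R)"
  by (simp add: graded_def W_cmod)

lemma T_mult_hom: "T_mult \<in> mod_hom R (cmod (W_complex R) k) (cmod (W_complex R) k)"
  unfolding W_cmod by (rule mod_homI) (auto simp: free_mod_sel T_mult_def PiE_iff fun_eq_iff)

lemma W_dgraded [simp]: "dgraded (W_complex R)"
  unfolding dgraded_def
proof (intro conjI allI)
  fix n
  have "(\<lambda>u. u \<oplus>\<^bsub>free_mod R UNIV\<^esub> sign R (Suc n) \<odot>\<^bsub>free_mod R UNIV\<^esub> T_mult u)
    \<in> mod_hom R (free_mod R UNIV) (free_mod R UNIV)"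
    by (intro mod_hom_plus mod_hom_id mod_hom_scale T_mult_hom[unfolded W_cmod]) simp_all
  then show "diff (W_complex R) n \<in> mod_hom R (cmod (W_complex R) (Suc n)) (cmod (W_complex R) n)"
    by (simp add: W_complex_def)
qed simp

lemma chain_complex_dgraded: "is_chain_complex R C \<Longrightarrow> dgraded C"
  by (auto simp: is_chain_complex_def dgraded_def graded_def)

lemma coalgebra_dgraded: "is_coalgebra R C \<Longrightarrow> dgraded C"
  by (auto simp: is_coalgebra_def Let_def intro: chain_complex_dgraded)

lemma coalgebra_coprod_hom:
  "is_coalgebra R C \<Longrightarrow> coprod C n \<in> mod_hom R (cmod (tensor_complex R (W_complex R) C) n) (cmod (tensor_complex R C C) n)"
  by (simp add: is_coalgebra_def is_chain_map_def Let_def)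

lemma coalgebra_homI:
  assumes "\<And>n. f n \<in> extensional (carrier (cmod C n))"
    and "\<And>n. f n \<in> mod_hom R (cmod C n) (cmod D n)"
    and "\<And>n x. x \<in> carrier (cmod C (Suc n)) \<Longrightarrow> f n (diff C n x) = diff D n (f (Suc n) x)"
    and "\<And>n x. x \<in> carrier (cmod C n) \<Longrightarrow> aug D n (f n x) = aug C n x"
    and "\<And>n z. z \<in> carrier (cmod (tensor_complex R (W_complex R) C) n) \<Longrightarrow>
      tensor_chain_map R C C D D f f n (coprod C n z)
        = coprod D n (tensor_chain_map R (W_complex R) C (W_complex R) D (\<lambda>k w. w) f n z)"
  shows "f \<in> coalgebra_hom R C D"
  using assms unfolding coalgebra_hom_def is_chain_map_def by blast

lemma coalgebra_homD:
  assumes "f \<in> coalgebra_hom R C D"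
  shows "f n \<in> extensional (carrier (cmod C n))"
    and "f n \<in> mod_hom R (cmod C n) (cmod D n)"
    and "x \<in> carrier (cmod C (Suc n)) \<Longrightarrow> f n (diff C n x) = diff D n (f (Suc n) x)"
    and "x \<in> carrier (cmod C n) \<Longrightarrow> aug D n (f n x) = aug C n x"
    and "z \<in> carrier (cmod (tensor_complex R (W_complex R) C) n) \<Longrightarrow>
      tensor_chain_map R C C D D f f n (coprod C n z)
        = coprod D n (tensor_chain_map R (W_complex R) C (W_complex R) D (\<lambda>k w. w) f n z)"
  using assms unfolding coalgebra_hom_def is_chain_map_def by blast+

lemma coalgebra_ident_hom:
  assumes C: "is_coalgebra R C"
  shows "(\<lambda>n. \<lambda>c\<in>carrier (cmod C n). c) \<in> coalgebra_hom R C C"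
proof (rule coalgebra_homI)
  note [simp] = coalgebra_dgraded[OF C] dgraded_graded[OF coalgebra_dgraded[OF C]]
  show "(\<lambda>c\<in>carrier (cmod C n). c) \<in> mod_hom R (cmod C n) (cmod C n)" for n
    by (rule mod_hom_cong[OF mod_hom_id]) simp_all
  fix n z assume z: "z \<in> carrier (cmod (tensor_complex R (W_complex R) C) n)"
  have d: "coprod C n z \<in> carrier (cmod (tensor_complex R C C) n)"
    using mod_homD(1)[OF coalgebra_coprod_hom[OF C] z] .
  show "tensor_chain_map R C C C C (\<lambda>n. \<lambda>c\<in>carrier (cmod C n). c) (\<lambda>n. \<lambda>c\<in>carrier (cmod C n). c) n (coprod C n z)
      = coprod C n (tensor_chain_map R (W_complex R) C (W_complex R) C (\<lambda>k w. w) (\<lambda>n. \<lambda>c\<in>carrier (cmod C n). c) n z)"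
    using tensor_chain_map_ident[OF _ _ _ _ d] tensor_chain_map_ident[OF _ _ _ _ z] by simp
qed (use coalgebra_dgraded[OF C] in auto)

lemma coalgebra_comp_hom:
  assumes C: "is_coalgebra R C" and D: "is_coalgebra R D" and E: "is_coalgebra R E"
    and f: "f \<in> coalgebra_hom R C D" and g: "g \<in> coalgebra_hom R D E"
  shows "(\<lambda>n. compose (carrier (cmod C n)) (g n) (f n)) \<in> coalgebra_hom R C E" (is "?h \<in> _")
proof (rule coalgebra_homI)
  note dg = coalgebra_dgraded[OF C] coalgebra_dgraded[OF D] coalgebra_dgraded[OF E]
  note gr [simp] = dg[THEN dgraded_graded]
  note F = coalgebra_homD[OF f] and G = coalgebra_homD[OF g]
  have fc: "f n x \<in> carrier (cmod D n)" if "x \<in> carrier (cmod C n)" for n x using mod_homD(1)[OF F(2) that] .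
  have h: "?h n x = g n (f n x)" if "x \<in> carrier (cmod C n)" for n x using that by (simp add: compose_eq)
  show "?h n \<in> extensional (carrier (cmod C n))" for n by simp
  show "?h n \<in> mod_hom R (cmod C n) (cmod E n)" for n
    by (rule mod_hom_cong[OF mod_hom_comp[OF F(2) G(2)]]) (simp_all add: h)
  show "?h n (diff C n x) = diff E n (?h (Suc n) x)" if "x \<in> carrier (cmod C (Suc n))" for n x
    using that dg fc[OF that] by (simp add: h F(3) G(3))
  show "aug E n (?h n x) = aug C n x" if "x \<in> carrier (cmod C n)" for n x
    using that fc[OF that] by (simp add: h F(4) G(4))
  fix n z assume z: "z \<in> carrier (cmod (tensor_complex R (W_complex R) C) n)"
  have d: "coprod C n z \<in> carrier (cmod (tensor_complex R C C) n)"
    using mod_homD(1)[OF coalgebra_coprod_hom[OF C] z] .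
  have t: "tensor_chain_map R (W_complex R) C (W_complex R) D (\<lambda>k w. w) f n z \<in> carrier (cmod (tensor_complex R (W_complex R) D) n)"
    by (rule mod_homD(1)[OF tensor_chain_map_hom z]) (simp_all add: mod_hom_id F(2))
  have "tensor_chain_map R C C E E ?h ?h n (coprod C n z)
      = tensor_chain_map R D D E E g g n (tensor_chain_map R C C D D f f n (coprod C n z))"
    by (rule tensor_chain_map_comp[OF gr(1) gr(1) gr(2) gr(2) gr(3) gr(3) F(2) F(2) G(2) G(2) h h d])
  also have "\<dots> = coprod E n (tensor_chain_map R (W_complex R) D (W_complex R) E (\<lambda>k w. w) g n
        (tensor_chain_map R (W_complex R) C (W_complex R) D (\<lambda>k w. w) f n z))"
    using F(5)[OF z] G(5)[OF t] by simp
  also have "tensor_chain_map R (W_complex R) D (W_complex R) E (\<lambda>k w. w) g n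
        (tensor_chain_map R (W_complex R) C (W_complex R) D (\<lambda>k w. w) f n z)
     = tensor_chain_map R (W_complex R) C (W_complex R) E (\<lambda>k w. w) ?h n z"
    by (rule tensor_chain_map_comp[OF W_graded gr(1) W_graded gr(2) W_graded gr(3) mod_hom_id F(2) mod_hom_id G(2) refl h z, symmetric])
  finally show "tensor_chain_map R C C E E ?h ?h n (coprod C n z)
      = coprod E n (tensor_chain_map R (W_complex R) C (W_complex R) E (\<lambda>k w. w) ?h n z)" .
qed

lemma coalgebra_category: "category (coalgebra_category R :: (('a, 'm) coalgebra, nat \<Rightarrow> 'm \<Rightarrow> 'm) category)"
  unfolding coalgebra_category_def
proof (rule category.intro; simp; (elim exE conjE)?)
  show "(\<lambda>n. \<lambda>c\<in>carrier (cmod X n). c) \<in> coalgebra_hom R X X" if "is_coalgebra R X" for X :: "('a, 'm) coalgebra"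
    using coalgebra_ident_hom[OF that] .
  show "(\<lambda>n. compose (carrier (cmod X n)) (g n) (f n)) \<in> coalgebra_hom R X Z"
    if "is_coalgebra R X" "is_coalgebra R Y" "is_coalgebra R Z" "f \<in> coalgebra_hom R X Y" "g \<in> coalgebra_hom R Y Z"
    for X Y Z :: "('a, 'm) coalgebra" and f g
    using coalgebra_comp_hom[OF that] .
next
  fix X Y :: "('a, 'm) coalgebra" and f assume f: "f \<in> coalgebra_hom R X Y"
  show "(\<lambda>n. compose (carrier (cmod X n)) (f n) (\<lambda>c\<in>carrier (cmod X n). c)) = f"
    using coalgebra_homD(1)[OF f] by (auto simp: fun_eq_iff compose_def extensional_def)
  show "(\<lambda>n. compose (carrier (cmod X n)) (\<lambda>c\<in>carrier (cmod Y n). c) (f n)) = f"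
    using coalgebra_homD(1)[OF f] mod_homD(1)[OF coalgebra_homD(2)[OF f]]
    by (auto simp: fun_eq_iff compose_def extensional_def)
next
  fix X Y Z V :: "('a, 'm) coalgebra" and f g h assume f: "f \<in> coalgebra_hom R X Y"
  show "(\<lambda>n. compose (carrier (cmod X n)) (h n) (compose (carrier (cmod X n)) (g n) (f n))) =
       (\<lambda>n. compose (carrier (cmod X n)) (compose (carrier (cmod Y n)) (h n) (g n)) (f n))"
    using mod_homD(1)[OF coalgebra_homD(2)[OF f]] by (auto simp: fun_eq_iff compose_def)
qed

end

section \<open>The category of globular sets\<close>

lemma globular_setD:
  assumes "is_globular_set X"
  shows "x \<in> cells X (Suc n) \<Longrightarrow> src X n x \<in> cells X n"
    and "x \<in> cells X (Suc n) \<Longrightarrow> tgt X n x \<in> cells X n"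
    and "x \<in> cells X n \<Longrightarrow> idc X n x \<in> cells X (Suc n)"
    and "x \<in> cells X (Suc (Suc n)) \<Longrightarrow> tgt X n (tgt X (Suc n) x) = tgt X n (src X (Suc n) x)"
    and "x \<in> cells X (Suc (Suc n)) \<Longrightarrow> src X n (src X (Suc n) x) = src X n (tgt X (Suc n) x)"
    and "x \<in> cells X n \<Longrightarrow> tgt X n (idc X n x) = x"
    and "x \<in> cells X n \<Longrightarrow> src X n (idc X n x) = x"
  using assms unfolding is_globular_set_def by blast+

lemma globular_homI:
  assumes "\<And>n. F n \<in> cells X n \<rightarrow>\<^sub>E cells Y n"
    and "\<And>n x. x \<in> cells X (Suc n) \<Longrightarrow> F n (src X n x) = src Y n (F (Suc n) x)"
    and "\<And>n x. x \<in> cells X (Suc n) \<Longrightarrow> F n (tgt X n x) = tgt Y n (F (Suc n) x)"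
    and "\<And>n x. x \<in> cells X n \<Longrightarrow> F (Suc n) (idc X n x) = idc Y n (F n x)"
  shows "F \<in> globular_hom X Y"
  using assms unfolding globular_hom_def by blast

lemma globular_homD:
  assumes "F \<in> globular_hom X Y"
  shows "F n \<in> cells X n \<rightarrow>\<^sub>E cells Y n"
    and "x \<in> cells X n \<Longrightarrow> F n x \<in> cells Y n"
    and "x \<in> cells X (Suc n) \<Longrightarrow> F n (src X n x) = src Y n (F (Suc n) x)"
    and "x \<in> cells X (Suc n) \<Longrightarrow> F n (tgt X n x) = tgt Y n (F (Suc n) x)"
    and "x \<in> cells X n \<Longrightarrow> F (Suc n) (idc X n x) = idc Y n (F n x)"
  using assms unfolding globular_hom_def by blast+

lemma globular_category: "category globular_category"
  unfolding globular_category_def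
proof (rule category.intro; simp)
  fix X :: "'x globular_set" assume "is_globular_set X"
  then show "(\<lambda>n. \<lambda>x\<in>cells X n. x) \<in> globular_hom X X"
    by (auto simp: globular_hom_def is_globular_set_def)
next
  fix X Y Z :: "'x globular_set" and f g
  assume X: "is_globular_set X" and f: "f \<in> globular_hom X Y" and g: "g \<in> globular_hom Y Z"
  show "(\<lambda>n. compose (cells X n) (g n) (f n)) \<in> globular_hom X Z"
    by (rule globular_homI) (simp_all add: compose_def globular_setD[OF X] globular_homD(2-)[OF f] globular_homD(2-)[OF g])
next
  fix X Y :: "'x globular_set" and f assume f: "f \<in> globular_hom X Y"
  then have c: "f n \<in> cells X n \<rightarrow>\<^sub>E cells Y n" for n by (simp add: globular_hom_def)
  then show "(\<lambda>n. compose (cells X n) (f n) (\<lambda>x\<in>cells X n. x)) = f"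
    by (auto simp: fun_eq_iff compose_def PiE_iff extensional_def)
  show "(\<lambda>n. compose (cells X n) (\<lambda>x\<in>cells Y n. x) (f n)) = f"
    using c by (auto simp: fun_eq_iff compose_def PiE_iff extensional_def)
next
  fix X Y Z V :: "'x globular_set" and f g h assume "f \<in> globular_hom X Y"
  then have c: "f n \<in> cells X n \<rightarrow>\<^sub>E cells Y n" for n by (simp add: globular_hom_def)
  show "(\<lambda>n. compose (cells X n) (h n) (compose (cells X n) (g n) (f n))) =
       (\<lambda>n. compose (cells X n) (compose (cells Y n) (h n) (g n)) (f n))"
    using c by (auto simp: fun_eq_iff compose_def PiE_iff)
qed

context cring
begin

section \<open>Chains of a globular set\<close>

lemma degenerate_sub_submodule: "submodule (degenerate_sub R X n) R (free_mod R (cells X n))"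
proof (rule submodule_of_closed)
  show "\<zero>\<^bsub>free_mod R (cells X n)\<^esub> \<in> degenerate_sub R X n"
    using mod_closed(2)[OF free_mod_module] by (simp add: degenerate_sub_def) (simp add: free_mod_sel)
  show "a \<oplus>\<^bsub>free_mod R (cells X n)\<^esub> b \<in> degenerate_sub R X n"
    if "a \<in> degenerate_sub R X n" "b \<in> degenerate_sub R X n" for a b
    using that free_mod_closed_add[of a "cells X n" b] by (simp add: degenerate_sub_def) (simp add: free_mod_sel)
  show "r \<odot>\<^bsub>free_mod R (cells X n)\<^esub> a \<in> degenerate_sub R X n"
    if "r \<in> carrier R" "a \<in> degenerate_sub R X n" for r a
    using that free_mod_closed_smult[of r a "cells X n"] by (simp add: degenerate_sub_def) (simp add: free_mod_sel)
qed (auto simp: degenerate_sub_def)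

lemma chains_module [simp]: "module R (chains R X n)"
  unfolding chains_def by (rule quot_mod_module[OF free_mod_module degenerate_sub_submodule])

lemma cell_class_closed [simp]: "cell_class R X n x \<in> carrier (chains R X n)"
  by (simp add: cell_class_def chains_def quot_mod_carrier)

lemma cell_class_degenerate:
  assumes "x \<in> degenerate X n" shows "cell_class R X n x = \<zero>\<^bsub>chains R X n\<^esub>"
proof -
  have "free_gen R (cells X n) x \<in> degenerate_sub R X n"
    using assms by (auto simp: degenerate_sub_def) (auto simp: free_gen_def)
  then show ?thesis
    unfolding cell_class_def chains_def
    by (simp add: quot_proj_zero_iff[OF free_mod_module degenerate_sub_submodule])
qed

lemma chains_spans: "spans R (chains R X n) (cell_class R X n ` cells X n)"
  using quot_mod_spans[OF free_mod_module degenerate_sub_submodule free_mod_spans, of X n]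
  by (simp add: chains_def cell_class_def[abs_def] image_image)

lemma
  assumes N: "module R N" and f: "\<And>x. x \<in> cells X n \<Longrightarrow> f x \<in> carrier N"
    and f0: "\<And>x. \<lbrakk>x \<in> cells X n; x \<in> degenerate X n\<rbrakk> \<Longrightarrow> f x = \<zero>\<^bsub>N\<^esub>"
  shows chains_lift_hom: "chains_lift R X n N f \<in> mod_hom R (chains R X n) N"
    and chains_lift_cell: "x \<in> cells X n \<Longrightarrow> chains_lift R X n N f (cell_class R X n x) = f x"
proof -
  interpret N: module R N by fact
  have f': "f \<in> cells X n \<rightarrow> carrier N" using f by simp
  note l = free_lift_hom[OF N f']
  have kill: "free_lift R (cells X n) N f u = \<zero>\<^bsub>N\<^esub>" if u: "u \<in> degenerate_sub R X n" for u
    unfolding free_lift_def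
  proof (rule N.add.finprod_one_eqI)
    fix x assume x: "x \<in> {s \<in> cells X n. u s \<noteq> \<zero>}"
    then have "x \<in> degenerate X n" "u x \<in> carrier R" using u by (auto simp: degenerate_sub_def free_mod_sel)
    then show "u x \<odot>\<^bsub>N\<^esub> f x = \<zero>\<^bsub>N\<^esub>" using x f0[of x] by simp
  qed
  note L = free_mod_module degenerate_sub_submodule N l kill
  show "chains_lift R X n N f \<in> mod_hom R (chains R X n) N"
    unfolding chains_lift_def chains_def by (rule quot_lift_hom[OF L])
  show "chains_lift R X n N f (cell_class R X n x) = f x" if "x \<in> cells X n"
    unfolding chains_lift_def cell_class_def
    by (simp add: quot_lift_coset[OF L free_gen_closed] free_lift_gen[OF N f' that])
qed

text \<open>The unit complex in degree \<open>0\<close> serves as \<open>R\<close> regarded as a module over itself. For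
  nondegenerate \<open>y\<close> the coefficient at \<open>y\<close> vanishes on degenerate cells, so it is defined on classes.\<close>

definition coeff :: "'x globular_set \<Rightarrow> nat \<Rightarrow> 'x \<Rightarrow> ('x \<Rightarrow> 'a) set \<Rightarrow> 'a" where
  "coeff X n y = chains_lift R X n (cmod (unit_complex R) 0) (\<lambda>x. if x = y then \<one> else \<zero>)"

lemma
  assumes "y \<notin> degenerate X n"
  shows coeff_hom: "coeff X n y \<in> mod_hom R (chains R X n) (cmod (unit_complex R) 0)"
    and coeff_cell: "x \<in> cells X n \<Longrightarrow> coeff X n y (cell_class R X n x) = (if x = y then \<one> else \<zero>)"
  unfolding coeff_def
  by (rule chains_lift_hom chains_lift_cell; use assms in \<open>auto simp: unit_complex_sel\<close>)+

text \<open>The coefficient functional at \<open>y\<close> is induced by evaluation at \<open>y\<close> on the free module. If all of them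
  vanish on a chain, then any representative is supported on degenerate cells.\<close>

lemma chain_eq_zeroI:
  assumes c: "c \<in> carrier (chains R X n)"
    and zero: "\<And>y. \<lbrakk>y \<in> cells X n; y \<notin> degenerate X n\<rbrakk> \<Longrightarrow> coeff X n y c = \<zero>"
  shows "c = \<zero>\<^bsub>chains R X n\<^esub>"
proof -
  let ?F = "free_mod R (cells X n)"
  let ?p = "\<lambda>u. degenerate_sub R X n +>\<^bsub>?F\<^esub> u"
  obtain u where u: "u \<in> carrier ?F" "c = ?p u"
    using c by (auto simp: chains_def quot_mod_carrier)
  have p: "?p \<in> mod_hom R ?F (chains R X n)"
    unfolding chains_def by (rule quot_proj_hom[OF free_mod_module degenerate_sub_submodule])
  have "coeff X n y (?p u) = u y" if y: "y \<in> cells X n" "y \<notin> degenerate X n" for y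
  proof (rule mod_hom_eqI[OF free_mod_spans free_mod_module _ mod_hom_comp[OF p coeff_hom[OF y(2)]] _ _ u(1)])
    show "(\<lambda>u. u y) \<in> mod_hom R ?F (cmod (unit_complex R) 0)"
      using y by (intro mod_homI) (auto simp: free_mod_sel unit_complex_sel)
    show "coeff X n y (?p a) = a y" if gen: "a \<in> free_gen R (cells X n) ` cells X n" for a
    proof -
      obtain x where x: "x \<in> cells X n" "a = free_gen R (cells X n) x" using gen by blast
      then show ?thesis using coeff_cell[OF y(2) x(1)] y by (auto simp: cell_class_def free_gen_def)
    qed
  qed simp
  then have "u \<in> degenerate_sub R X n" using zero u by (auto simp: degenerate_sub_def)
  then show ?thesis
    unfolding chains_def u(2) by (simp add: quot_proj_zero_iff[OF free_mod_module degenerate_sub_submodule u(1)])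
qed

lemma chain_eqI:
  assumes "c \<in> carrier (chains R X n)" "d \<in> carrier (chains R X n)"
    and "\<And>y. \<lbrakk>y \<in> cells X n; y \<notin> degenerate X n\<rbrakk> \<Longrightarrow> coeff X n y c = coeff X n y d"
  shows "c = d"
proof (rule mod_eq_of_minus[OF chains_module assms(1,2)])
  show "c \<ominus>\<^bsub>chains R X n\<^esub> d = \<zero>\<^bsub>chains R X n\<^esub>"
  proof (rule chain_eq_zeroI)
    fix y assume y: "y \<in> cells X n" "y \<notin> degenerate X n"
    have "coeff X n y d \<in> carrier (cmod (unit_complex R) 0)" using mod_homD(1)[OF coeff_hom[OF y(2)] assms(2)] .
    then show "coeff X n y (c \<ominus>\<^bsub>chains R X n\<^esub> d) = \<zero>"
      using mod_hom_minus[OF chains_module _ coeff_hom[OF y(2)] assms(1,2)] assms(3)[OF y]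
        mod_minus_zero[of "cmod (unit_complex R) 0"] by (simp add: unit_complex_sel)
  qed (use assms in simp)
qed

abbreviation "Ch X \<equiv> globular_chains R X"

abbreviation "Coalg X \<equiv> globular_coalgebra R X"

lemma cmod_globular_chains [simp]: "cmod (Ch X) n = chains R X n"
  by (simp add: globular_chains_def)

lemma globular_chains_graded [simp]: "graded (Ch X)"
  by (simp add: graded_def)

lemma degenerate_SucE:
  assumes "x \<in> degenerate X (Suc n)" obtains x' where "x' \<in> cells X n" "x = idc X n x'"
  using assms by auto

lemma
  assumes X: "is_globular_set X"
  shows globular_diff_hom: "diff (Ch X) n \<in> mod_hom R (chains R X (Suc n)) (chains R X n)"
    and globular_diff_cell: "x \<in> cells X (Suc n) \<Longrightarrow> diff (Ch X) n (cell_class R X (Suc n) x)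
      = cell_class R X n (tgt X n x) \<ominus>\<^bsub>chains R X n\<^esub> cell_class R X n (src X n x)"
  unfolding globular_chains_def chain_complex.simps
  by (rule chains_lift_hom chains_lift_cell;
      (elim degenerate_SucE)?; simp add: globular_setD[OF X] mod_minus_zero)+

lemma globular_chains_dgraded [simp]: "is_globular_set X \<Longrightarrow> dgraded (Ch X)"
  by (simp add: dgraded_def globular_diff_hom)

lemma globular_chains_complex:
  assumes X: "is_globular_set X" shows "is_chain_complex R (Ch X)"
  unfolding is_chain_complex_def
proof (intro conjI allI ballI)
  fix n c assume c: "c \<in> carrier (cmod (Ch X) (Suc (Suc n)))"
  let ?d = "diff (Ch X)"
  note D = globular_diff_hom[OF X]
  have "?d n (?d (Suc n) c) = \<zero>\<^bsub>chains R X n\<^esub>"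
  proof (rule mod_hom_eqI[OF chains_spans chains_module chains_module mod_hom_comp[OF D D] mod_hom_const_zero])
    fix a assume "a \<in> cell_class R X (Suc (Suc n)) ` cells X (Suc (Suc n))"
    then obtain x where x: "x \<in> cells X (Suc (Suc n))" "a = cell_class R X (Suc (Suc n)) x" by auto
    then show "?d n (?d (Suc n) a) = \<zero>\<^bsub>chains R X n\<^esub>"
      by (simp add: globular_diff_cell[OF X] globular_setD[OF X] mod_hom_minus[OF chains_module chains_module D] mod_minus_zero)
  qed (use c in simp_all)
  then show "?d n (?d (Suc n) c) = \<zero>\<^bsub>cmod (Ch X) n\<^esub>" by simp
qed (simp_all add: globular_diff_hom[OF X])

end

section \<open>Iterated sources and targets\<close>

lemma iter_same [simp]: "iter_tgt X n n x = x" "iter_src X n n x = x"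
  by (cases n; simp)+

lemma iter_closed:
  assumes X: "is_globular_set X" and "k \<le> n" "x \<in> cells X n"
  shows "iter_tgt X k n x \<in> cells X k" "iter_src X k n x \<in> cells X k"
  using assms(2,3) by (induction n arbitrary: x) (auto simp: globular_setD[OF X] le_Suc_eq)

text \<open>The source and the target of a cell are parallel, so their iterated boundaries agree in every
  dimension below their own.\<close>

lemma iter_tgt_src:
  assumes X: "is_globular_set X" and "k < n" "x \<in> cells X (Suc n)"
  shows "iter_tgt X k n (src X n x) = iter_tgt X k n (tgt X n x)"
  using assms(2,3) by (cases n) (auto simp: globular_setD(4)[OF X])

lemma iter_src_tgt:
  assumes X: "is_globular_set X" and "k < n" "x \<in> cells X (Suc n)"
  shows "iter_src X k n (tgt X n x) = iter_src X k n (src X n x)"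
  using assms(2,3) by (cases n) (auto simp: globular_setD(5)[OF X])

lemma iter_step:
  assumes X: "is_globular_set X" and "Suc k \<le> n" "x \<in> cells X n"
  shows "tgt X k (iter_tgt X (Suc k) n x) = iter_tgt X k n x"
    and "src X k (iter_tgt X (Suc k) n x) = iter_src X k n x"
    and "tgt X k (iter_src X (Suc k) n x) = iter_tgt X k n x"
    and "src X k (iter_src X (Suc k) n x) = iter_src X k n x"
  using assms(2,3)
proof (induction n arbitrary: x)
  case (Suc m)
  { case 1 then show ?case using Suc(1)[of "tgt X m x"] by (cases "k = m") (auto simp: globular_setD[OF X]) }
  { case 2 then show ?case using Suc(2)[of "tgt X m x"] iter_src_tgt[OF X, of k m x]
      by (cases "k = m") (auto simp: globular_setD[OF X]) }
  { case 3 then show ?case using Suc(3)[of "src X m x"] iter_tgt_src[OF X, of k m x]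
      by (cases "k = m") (auto simp: globular_setD[OF X]) }
  { case 4 then show ?case using Suc(4)[of "src X m x"] by (cases "k = m") (auto simp: globular_setD[OF X]) }
qed auto

context cring
begin

section \<open>The diagonal\<close>

abbreviation "CC X \<equiv> cmod (tensor_complex R (Ch X) (Ch X))"

lemma Delta_cell_eqs:
  "n < k \<Longrightarrow> Delta_cell R X k n x = \<zero>\<^bsub>CC X (n + k)\<^esub>"
  "Delta_cell R X n n x = gpure R (Ch X) (Ch X) n n (cell_class R X n x) (cell_class R X n x)"
  "k < n \<Longrightarrow> Delta_cell R X k n x =
    gpure R (Ch X) (Ch X) k n (cell_class R X k (iter_tgt X k n x)) (cell_class R X n x)
    \<oplus>\<^bsub>CC X (n + k)\<^esub> sign R (Suc n * k) \<odot>\<^bsub>CC X (n + k)\<^esub>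
    gpure R (Ch X) (Ch X) n k (cell_class R X n x) (cell_class R X k (iter_src X k n x))"
  by (simp_all add: Delta_cell_def Let_def)

lemma CC_module [simp]: "module R (CC X n)"
  by simp

lemma gpure_chains_zero:
  "\<lbrakk>p + q = n; y \<in> carrier (chains R X q)\<rbrakk> \<Longrightarrow>
    gpure R (Ch X) (Ch X) p q \<zero>\<^bsub>chains R X p\<^esub> y = \<zero>\<^bsub>CC X n\<^esub>"
  "\<lbrakk>p + q = n; y \<in> carrier (chains R X p)\<rbrakk> \<Longrightarrow>
    gpure R (Ch X) (Ch X) p q y \<zero>\<^bsub>chains R X q\<^esub> = \<zero>\<^bsub>CC X n\<^esub>"
  using bilinear_zero[OF gpure_bilinear[of "Ch X" "Ch X" p q n]] by simp_all

lemma Delta_cell_closed: "Delta_cell R X k n x \<in> carrier (CC X (n + k))"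
proof -
  consider "n < k" | "n = k" | "k < n" by linarith
  then show ?thesis by cases (simp_all add: Delta_cell_eqs)
qed

text \<open>Every tensor that occurs has the class of \<open>x\<close> as a factor.\<close>

lemma Delta_cell_degenerate:
  assumes "x \<in> degenerate X n" shows "Delta_cell R X k n x = \<zero>\<^bsub>CC X (n + k)\<^esub>"
proof -
  consider "n < k" | "k = n" | "k < n" by linarith
  then show ?thesis
    by cases (simp_all add: Delta_cell_eqs cell_class_degenerate[OF assms] gpure_chains_zero[where n = "n + k"] gpure_chains_zero[where n = "n + n"])
qed

lemma Delta_hom: "n + k = m \<Longrightarrow> Delta R X k n \<in> mod_hom R (chains R X n) (CC X m)"
  unfolding Delta_def by clarify (rule chains_lift_hom; simp add: Delta_cell_closed Delta_cell_degenerate)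

lemma Delta_closed [simp]:
  "\<lbrakk>n + k = m; c \<in> carrier (chains R X n)\<rbrakk> \<Longrightarrow> Delta R X k n c \<in> carrier (CC X m)"
  by (rule mod_homD(1)[OF Delta_hom])

lemma Delta_on_cell: "x \<in> cells X n \<Longrightarrow> Delta R X k n (cell_class R X n x) = Delta_cell R X k n x"
  unfolding Delta_def by (rule chains_lift_cell; simp add: Delta_cell_closed Delta_cell_degenerate)

lemma Delta_small: "\<lbrakk>n < k; n + k = m; c \<in> carrier (chains R X n)\<rbrakk> \<Longrightarrow> Delta R X k n c = \<zero>\<^bsub>CC X m\<^esub>"
  by (rule mod_hom_eqI[OF chains_spans _ _ Delta_hom mod_hom_const_zero])
    (auto simp: Delta_on_cell Delta_cell_eqs)

lemma gpure_chains_minus: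
  assumes "p + q = n"
  shows "\<lbrakk>u \<in> carrier (chains R X p); u' \<in> carrier (chains R X p); v \<in> carrier (chains R X q)\<rbrakk> \<Longrightarrow>
    gpure R (Ch X) (Ch X) p q (u \<ominus>\<^bsub>chains R X p\<^esub> u') v =
    gpure R (Ch X) (Ch X) p q u v
      \<oplus>\<^bsub>CC X n\<^esub> (\<ominus> \<one>) \<odot>\<^bsub>CC X n\<^esub> gpure R (Ch X) (Ch X) p q u' v"
  "\<lbrakk>u \<in> carrier (chains R X p); v \<in> carrier (chains R X q); v' \<in> carrier (chains R X q)\<rbrakk> \<Longrightarrow>
    gpure R (Ch X) (Ch X) p q u (v \<ominus>\<^bsub>chains R X q\<^esub> v') =
    gpure R (Ch X) (Ch X) p q u v
      \<oplus>\<^bsub>CC X n\<^esub> (\<ominus> \<one>) \<odot>\<^bsub>CC X n\<^esub> gpure R (Ch X) (Ch X) p q u v'"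
  using bilinear_minus[OF gpure_bilinear[of "Ch X" "Ch X" p q n], of u u' v]
    bilinear_minus[OF bilinear_flip[OF gpure_bilinear[of "Ch X" "Ch X" p q n]], of v v' u]
  by (simp_all add: assms mod_minus)

text \<open>For \<open>k < n\<close> the cells \<open>tgt x\<close> and \<open>src x\<close> have the same \<open>k\<close>-dimensional boundaries \<open>t\<close> and \<open>s\<close>, so the
  values of the diagonal on them differ by \<open>t \<otimes> \<partial>x \<plusminus> \<partial>x \<otimes> s\<close>. For \<open>k = n\<close> the left-hand side is
  \<open>tgt x \<otimes> tgt x - src x \<otimes> src x\<close>, and it has the same form after the mixed term \<open>tgt x \<otimes> src x\<close> is
  subtracted and added.\<close>

lemma Delta_of_boundary:
  assumes X: "is_globular_set X" and x: "x \<in> cells X (Suc n)" and k: "k \<le> n" and m: "n + k = m"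
  defines "c \<equiv> cell_class R X (Suc n) x"
  defines "dc \<equiv> cell_class R X n (tgt X n x) \<ominus>\<^bsub>chains R X n\<^esub> cell_class R X n (src X n x)"
  shows "Delta R X k n (diff (Ch X) n c) =
    gpure R (Ch X) (Ch X) k n (cell_class R X k (iter_tgt X k (Suc n) x)) dc
    \<oplus>\<^bsub>CC X m\<^esub> sign R (Suc n * k) \<odot>\<^bsub>CC X m\<^esub>
    gpure R (Ch X) (Ch X) n k dc (cell_class R X k (iter_src X k (Suc n) x))"
proof -
  let ?g = "gpure R (Ch X) (Ch X)"
  let ?V = "CC X m"
  let ?t = "cell_class R X n (tgt X n x)" and ?s = "cell_class R X n (src X n x)"
  have m': "k + n = m" using m by simp
  have V: "module R ?V" by simp
  have cl: "tgt X n x \<in> cells X n" "src X n x \<in> cells X n" using globular_setD[OF X] x by auto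
  have L: "Delta R X k n (diff (Ch X) n c) =
      Delta_cell R X k n (tgt X n x) \<oplus>\<^bsub>?V\<^esub> (\<ominus> \<one>) \<odot>\<^bsub>?V\<^esub> Delta_cell R X k n (src X n x)"
    unfolding c_def using cl mod_minus[OF V] Delta_cell_closed[of X k n] m
    by (simp add: globular_diff_cell[OF X x] mod_hom_minus[OF _ _ Delta_hom[OF m]] Delta_on_cell)
  show ?thesis
  proof (cases "k = n")
    case True
    have s1: "sign R (Suc n * k) = \<one>" unfolding True by (simp add: sign_parity)
    define A M B where "A = ?g n n ?t ?t" and "M = ?g n n ?t ?s" and "B = ?g n n ?s ?s"
    have c: "A \<in> carrier ?V" "M \<in> carrier ?V" "B \<in> carrier ?V"
      unfolding A_def M_def B_def using m True by simp_all
    have "A \<oplus>\<^bsub>?V\<^esub> (\<ominus> \<one>) \<odot>\<^bsub>?V\<^esub> B = (A \<oplus>\<^bsub>?V\<^esub> (\<ominus> \<one>) \<odot>\<^bsub>?V\<^esub> M) \<oplus>\<^bsub>?V\<^esub> (M \<oplus>\<^bsub>?V\<^esub> (\<ominus> \<one>) \<odot>\<^bsub>?V\<^esub> B)"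
    proof -
      interpret V: module R ?V by (rule V)
      show ?thesis using c by (simp add: V.smult_l_minus V.a_assoc V.add.inv_solve_left V.r_neg1)
    qed
    then show ?thesis unfolding L s1 dc_def A_def M_def B_def using m
      by (simp add: True Delta_cell_eqs gpure_chains_minus[where n = m])
  next
    case False
    then have k: "k < n" using k by simp
    have d: "Delta_cell R X k n y = ?g k n (cell_class R X k (iter_tgt X k n y)) (cell_class R X n y)
        \<oplus>\<^bsub>?V\<^esub> sign R (Suc n * k) \<odot>\<^bsub>?V\<^esub> ?g n k (cell_class R X n y) (cell_class R X k (iter_src X k n y))" for y
      using Delta_cell_eqs(3)[OF k] m by simp
    have i: "iter_tgt X k n (src X n x) = iter_tgt X k n (tgt X n x)"
      "iter_src X k n (tgt X n x) = iter_src X k n (src X n x)"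
      using iter_tgt_src[OF X k x] iter_src_tgt[OF X k x] by auto
    show ?thesis unfolding L dc_def d using m m' k
      by (simp add: i gpure_chains_minus[where n = m] mod_r_distr mod_smult_comm[where r = "\<ominus> \<one>"] del: mult_Suc)
        (simp add: mod_ac del: mult_Suc)
  qed
qed

text \<open>The homotopy identity \<open>\<partial>\<Delta>\<^sub>k = (1 + (-1)\<^sup>kT)\<Delta>\<^sub>k\<^sub>-\<^sub>1 + (-1)\<^sup>k\<Delta>\<^sub>k\<partial>\<close>, where \<open>a\<close> stands for \<open>\<Delta>\<^sub>k\<^sub>-\<^sub>1x\<close>.
  For \<open>k < n\<close> write \<open>\<Delta>\<^sub>kx = u \<otimes> x \<plusminus> x \<otimes> v\<close>. The parts of the boundary with a factor \<open>\<partial>x\<close> are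
  \<open>(-1)\<^sup>k\<Delta>\<^sub>k(\<partial>x)\<close> by \<open>Delta_of_boundary\<close>; since \<open>\<partial>u = \<partial>v = t\<^sub>k\<^sub>-\<^sub>1x - s\<^sub>k\<^sub>-\<^sub>1x\<close> by globularity, the other parts
  are the terms of \<open>a\<close> and of its transpose.\<close>

lemma Delta_boundary_cell:
  assumes X: "is_globular_set X" and x: "x \<in> cells X n" and m: "n + k = Suc m"
  defines "c \<equiv> cell_class R X n x"
  defines "a \<equiv> (if k = 0 then \<zero>\<^bsub>CC X m\<^esub> else Delta R X (k - 1) n c)"
  shows "diff (tensor_complex R (Ch X) (Ch X)) m (Delta R X k n c) =
    (a \<oplus>\<^bsub>CC X m\<^esub> sign R k \<odot>\<^bsub>CC X m\<^esub> swap_action R (Ch X) m a)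
    \<oplus>\<^bsub>CC X m\<^esub> sign R k \<odot>\<^bsub>CC X m\<^esub>
      (if n = 0 then \<zero>\<^bsub>CC X m\<^esub> else Delta R X k (n - 1) (diff (Ch X) (n - 1) c))"
proof -
  let ?G = "Ch X"
  let ?g = "gpure R ?G ?G"
  let ?V = "CC X m"
  let ?d = "diff (tensor_complex R ?G ?G) m"
  have V: "module R ?V" by simp
  have dg: "dgraded ?G" using X by simp
  have c: "c \<in> carrier (chains R X n)" by (simp add: c_def)
  note D' = tensor_complex_diff_hom[OF dg dg, of m] and T = swap_hom[of ?G m]
  note dgp = tensor_complex_diff_gpure[OF dg dg]
  have d0: "?d \<zero>\<^bsub>CC X (Suc m)\<^esub> = \<zero>\<^bsub>?V\<^esub>" by (rule mod_hom_zero[OF _ _ D']) simp_all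
  have T0: "swap_action R ?G m \<zero>\<^bsub>?V\<^esub> = \<zero>\<^bsub>?V\<^esub>" by (rule mod_hom_zero[OF _ _ T]) simp_all
  have neg: "z \<oplus>\<^bsub>?V\<^esub> (\<ominus> \<one>) \<odot>\<^bsub>?V\<^esub> z = \<zero>\<^bsub>?V\<^esub>" if "z \<in> carrier ?V" for z
    using that V by (simp add: mod_l_minus mod_r_neg)
  consider (small) k' where "k = Suc k'" "n < k'" | (edge) k' where "k = Suc k'" "n = k'"
    | (diag) k' where "k = Suc k'" "n = Suc k'" | (gen) n' where "n = Suc n'" "k \<le> n'"
    using m by (cases k; cases n) (auto, force)
  then show ?thesis
  proof cases
    case small
    have z: "n = 0 \<or> (\<exists>n'. n = Suc n' \<and> diff ?G n' c \<in> carrier (chains R X n'))"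
      using c mod_homD(1)[OF globular_diff_hom[OF X]] by (cases n) auto
    show ?thesis using small m c z
      by (auto simp: a_def Delta_small T0 d0)
  next
    case edge
    have z: "n = 0 \<or> (\<exists>n'. n = Suc n' \<and> diff ?G n' c \<in> carrier (chains R X n'))"
      using c mod_homD(1)[OF globular_diff_hom[OF X]] by (cases n) auto
    have nn: "n + n = m" using edge m by simp
    have a: "a = ?g n n c c" using x edge by (simp add: a_def c_def Delta_on_cell Delta_cell_eqs)
    \<comment> \<open>For \<open>k = n + 1\<close> the tensor \<open>a = x \<otimes> x\<close> cancels against its transpose.\<close>
    have "sign R k \<otimes> sign R (n * n) = \<ominus> \<one>" using edge by (simp add: sign_parity r_minus)
    then have "a \<oplus>\<^bsub>?V\<^esub> sign R k \<odot>\<^bsub>?V\<^esub> swap_action R ?G m a = \<zero>\<^bsub>?V\<^esub>"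
      using nn c V by (simp add: a swap_gpure mod_assoc[symmetric] neg)
    then show ?thesis using edge m c z by (auto simp: Delta_small d0)
  next
    case diag
    define t s where "t = cell_class R X k' (tgt X k' x)" and "s = cell_class R X k' (src X k' x)"
    have x': "x \<in> cells X (Suc k')" using x diag by simp
    have dc: "diff ?G k' c = t \<ominus>\<^bsub>chains R X k'\<^esub> s"
      using globular_diff_cell[OF X x'] diag by (simp add: c_def t_def s_def)
    have ts: "t \<in> carrier (chains R X k')" "s \<in> carrier (chains R X k')" by (simp_all add: t_def s_def)
    have c': "c \<in> carrier (chains R X (Suc k'))" using c diag by simp
    have e: "k' + Suc k' = m" "Suc k' + k' = m" using diag m by auto
    have D: "Delta R X k n c = ?g n n c c" using x diag by (simp add: c_def Delta_on_cell Delta_cell_eqs)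
    have a: "a = ?g k' n t c \<oplus>\<^bsub>?V\<^esub> sign R (Suc n * k') \<odot>\<^bsub>?V\<^esub> ?g n k' c s"
      using x diag Delta_cell_eqs(3)[of k' n X x] e by (simp add: a_def c_def Delta_on_cell t_def s_def)
    have z: "Delta R X k (n - 1) (diff ?G (n - 1) c) = \<zero>\<^bsub>?V\<^esub>"
      using diag m dc ts by (simp add: Delta_small)
    have L: "?d (Delta R X k n c) = ?g k' n (diff ?G k' c) c \<oplus>\<^bsub>?V\<^esub> sign R n \<odot>\<^bsub>?V\<^esub> ?g n k' c (diff ?G k' c)"
      unfolding D using diag m c' by (simp add: dgp)
    \<comment> \<open>Here \<open>\<partial>(x \<otimes> x)\<close> itself consists of the four terms of \<open>a\<close> and its transpose.\<close>
    define A A' B B' where "A = ?g k' n t c" and "A' = ?g k' n s c" and "B = ?g n k' c t" and "B' = ?g n k' c s"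
    have cl: "A \<in> carrier ?V" "A' \<in> carrier ?V" "B \<in> carrier ?V" "B' \<in> carrier ?V"
      unfolding A_def A'_def B_def B'_def using ts c' e diag by simp_all
    have L': "?d (Delta R X k n c) = (A \<oplus>\<^bsub>?V\<^esub> (\<ominus> \<one>) \<odot>\<^bsub>?V\<^esub> A') \<oplus>\<^bsub>?V\<^esub> sign R n \<odot>\<^bsub>?V\<^esub> (B \<oplus>\<^bsub>?V\<^esub> (\<ominus> \<one>) \<odot>\<^bsub>?V\<^esub> B')"
      unfolding L dc A_def A'_def B_def B'_def using e diag ts c' by (simp add: gpure_chains_minus[where n = m])
    have a': "a = A \<oplus>\<^bsub>?V\<^esub> sign R (Suc n * k') \<odot>\<^bsub>?V\<^esub> B'" unfolding a A_def B'_def ..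
    have Ta: "swap_action R ?G m a = sign R (k' * n) \<odot>\<^bsub>?V\<^esub> B \<oplus>\<^bsub>?V\<^esub> sign R (Suc n * k') \<odot>\<^bsub>?V\<^esub> (sign R (n * k') \<odot>\<^bsub>?V\<^esub> A')"
      unfolding a A'_def B_def using e diag ts c'
      by (simp add: mod_homD(2,3)[OF T] swap_gpure del: mult_Suc mult_Suc_right)
    show ?thesis unfolding L' z Ta unfolding a' using diag V cl
      by (cases "even k'") (simp_all add: sign_parity mod_r_distr mod_assoc[symmetric] l_minus r_minus mod_ac)
  next
    case gen
    define u v where "u = cell_class R X k (iter_tgt X k n x)" and "v = cell_class R X k (iter_src X k n x)"
    have x': "x \<in> cells X (Suc n')" using x gen by simp
    define dc where "dc = diff ?G n' c"
    have dcc: "dc \<in> carrier (chains R X n')" and uv: "u \<in> carrier (chains R X k)" "v \<in> carrier (chains R X k)"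
      using mod_homD(1)[OF globular_diff_hom[OF X], of c n'] c gen by (simp_all add: dc_def u_def v_def)
    have e: "n' + k = m" "k + n' = m" "k + n = Suc m" using gen m by auto
    define P Q where "P = ?g k n' u dc" and "Q = ?g n' k dc v"
    have PQ: "P \<in> carrier ?V" "Q \<in> carrier ?V" unfolding P_def Q_def using dcc uv e by simp_all
    have D: "Delta R X k n c = ?g k n u c \<oplus>\<^bsub>CC X (Suc m)\<^esub> sign R (Suc n * k) \<odot>\<^bsub>CC X (Suc m)\<^esub> ?g n k c v"
      using x gen m Delta_cell_eqs(3)[of k n X x] by (simp add: c_def Delta_on_cell u_def v_def)
    have z: "Delta R X k (n - 1) (diff ?G (n - 1) c) = P \<oplus>\<^bsub>?V\<^esub> sign R (n * k) \<odot>\<^bsub>?V\<^esub> Q"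
      using Delta_of_boundary[OF X x' gen(2) e(1)] globular_diff_cell[OF X x'] gen
      by (simp add: c_def u_def v_def P_def Q_def dc_def)
    define L1 L2 where "L1 = (if k = 0 then \<zero>\<^bsub>?V\<^esub> else ?g (k - 1) n (diff ?G (k - 1) u) c)"
      and "L2 = (if k = 0 then \<zero>\<^bsub>?V\<^esub> else ?g n (k - 1) c (diff ?G (k - 1) v))"
    have du: "?d (?g k n u c) = L1 \<oplus>\<^bsub>?V\<^esub> sign R k \<odot>\<^bsub>?V\<^esub> P"
      using dgp[OF e(3), of u c] uv c gen by (simp add: L1_def P_def dc_def)
    have dv: "?d (?g n k c v) = Q \<oplus>\<^bsub>?V\<^esub> sign R n \<odot>\<^bsub>?V\<^esub> L2"
      using dgp[OF m, of c v] uv c gen by (simp add: L2_def Q_def dc_def)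
    have gc: "?g k n u c \<in> carrier (CC X (Suc m))" "?g n k c v \<in> carrier (CC X (Suc m))"
      using uv c m e by simp_all
    have L: "?d (Delta R X k n c) = (L1 \<oplus>\<^bsub>?V\<^esub> sign R k \<odot>\<^bsub>?V\<^esub> P) \<oplus>\<^bsub>?V\<^esub> sign R (Suc n * k) \<odot>\<^bsub>?V\<^esub> (Q \<oplus>\<^bsub>?V\<^esub> sign R n \<odot>\<^bsub>?V\<^esub> L2)"
      unfolding D using gc by (simp add: mod_homD(2,3)[OF D'] du dv del: mult_Suc) 
    show ?thesis
    proof (cases k)
      case 0
      then have "L1 = \<zero>\<^bsub>?V\<^esub>" "L2 = \<zero>\<^bsub>?V\<^esub>" "a = \<zero>\<^bsub>?V\<^esub>" by (simp_all add: L1_def L2_def a_def)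
      then show ?thesis unfolding L z using 0 gen(1) PQ V by (simp add: T0)
    next
      case (Suc k')
      define t s where "t = cell_class R X k' (iter_tgt X k' n x)" and "s = cell_class R X k' (iter_src X k' n x)"
      have ts: "t \<in> carrier (chains R X k')" "s \<in> carrier (chains R X k')" by (simp_all add: t_def s_def)
      have e': "k' + n = m" "n + k' = m" using Suc m by auto
      have kn: "Suc k' \<le> n" using gen Suc by simp
      have "diff ?G k' u = t \<ominus>\<^bsub>chains R X k'\<^esub> s" "diff ?G k' v = t \<ominus>\<^bsub>chains R X k'\<^esub> s"
        using globular_diff_cell[OF X iter_closed(1)[OF X kn x]] globular_diff_cell[OF X iter_closed(2)[OF X kn x]]
          iter_step[OF X kn x] Suc by (simp_all add: u_def v_def t_def s_def)
      note duv = this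
      define A A' B B' where "A = ?g k' n t c" and "A' = ?g k' n s c" and "B = ?g n k' c t" and "B' = ?g n k' c s"
      have cl: "A \<in> carrier ?V" "A' \<in> carrier ?V" "B \<in> carrier ?V" "B' \<in> carrier ?V"
        unfolding A_def A'_def B_def B'_def using ts c e' by simp_all
      have L12: "L1 = A \<oplus>\<^bsub>?V\<^esub> (\<ominus> \<one>) \<odot>\<^bsub>?V\<^esub> A'" "L2 = B \<oplus>\<^bsub>?V\<^esub> (\<ominus> \<one>) \<odot>\<^bsub>?V\<^esub> B'"
        unfolding L1_def L2_def A_def A'_def B_def B'_def using Suc duv ts c e'
        by (simp_all add: gpure_chains_minus[where n = m])
      have a': "a = A \<oplus>\<^bsub>?V\<^esub> sign R (Suc n * k') \<odot>\<^bsub>?V\<^esub> B'"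
        unfolding A_def B'_def using x Suc kn Delta_cell_eqs(3)[of k' n X x] e'
        by (simp add: a_def c_def Delta_on_cell t_def s_def)
      have Ta: "swap_action R ?G m a = sign R (k' * n) \<odot>\<^bsub>?V\<^esub> B \<oplus>\<^bsub>?V\<^esub> sign R (Suc n * k') \<odot>\<^bsub>?V\<^esub> (sign R (n * k') \<odot>\<^bsub>?V\<^esub> A')"
        unfolding a' A_def A'_def B_def B'_def using e' ts c
        by (simp add: mod_homD(2,3)[OF T] swap_gpure del: mult_Suc mult_Suc_right)
      show ?thesis unfolding L L12 z Ta unfolding a' using gen(1) Suc V cl PQ
        by (cases "even k'"; cases "even n")
          (simp_all add: sign_parity mod_r_distr mod_assoc[symmetric] l_minus r_minus mod_ac)
    qed
  qed
qed

lemma Delta_boundary: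
  assumes X: "is_globular_set X" and c: "c \<in> carrier (chains R X n)" and m: "n + k = Suc m"
  defines "a \<equiv> (if k = 0 then \<zero>\<^bsub>CC X m\<^esub> else Delta R X (k - 1) n c)"
  shows "diff (tensor_complex R (Ch X) (Ch X)) m (Delta R X k n c) =
    (a \<oplus>\<^bsub>CC X m\<^esub> sign R k \<odot>\<^bsub>CC X m\<^esub> swap_action R (Ch X) m a)
    \<oplus>\<^bsub>CC X m\<^esub> sign R k \<odot>\<^bsub>CC X m\<^esub>
      (if n = 0 then \<zero>\<^bsub>CC X m\<^esub> else Delta R X k (n - 1) (diff (Ch X) (n - 1) c))"
proof -
  let ?G = "Ch X"
  let ?V = "CC X m"
  let ?a = "\<lambda>c. if k = 0 then \<zero>\<^bsub>?V\<^esub> else Delta R X (k - 1) n c"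
  let ?b = "\<lambda>c. if n = 0 then \<zero>\<^bsub>?V\<^esub> else Delta R X k (n - 1) (diff ?G (n - 1) c)"
  have V: "module R ?V" by simp
  have dg: "dgraded ?G" using X by simp
  note D = tensor_complex_diff_hom[OF dg dg, of m] and T = swap_hom[of ?G m, OF globular_chains_graded]
  have a: "?a \<in> mod_hom R (chains R X n) ?V"
    using m mod_hom_const_zero[OF V] Delta_hom[of n "k - 1" m X] by (cases k) simp_all
  have b: "?b \<in> mod_hom R (chains R X n) ?V"
    using m mod_hom_const_zero[OF V] mod_hom_comp[OF globular_diff_hom[OF X, of "n - 1"] Delta_hom[of "n - 1" k m X]]
    by (cases n) simp_all
  have l: "(\<lambda>c. diff (tensor_complex R ?G ?G) m (Delta R X k n c)) \<in> mod_hom R (chains R X n) ?V"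
    by (rule mod_hom_comp[OF Delta_hom[OF m] D])
  have r: "(\<lambda>c. (?a c \<oplus>\<^bsub>?V\<^esub> sign R k \<odot>\<^bsub>?V\<^esub> swap_action R ?G m (?a c)) \<oplus>\<^bsub>?V\<^esub> sign R k \<odot>\<^bsub>?V\<^esub> ?b c)
      \<in> mod_hom R (chains R X n) ?V"
    by (intro mod_hom_plus mod_hom_scale V a b sign_closed mod_hom_comp[OF a T])
  show ?thesis unfolding a_def
  proof (rule mod_hom_eqI[OF chains_spans chains_module V l r _ c])
    fix e assume "e \<in> cell_class R X n ` cells X n"
    then obtain x where "x \<in> cells X n" "e = cell_class R X n x" by blast
    then show "diff (tensor_complex R ?G ?G) m (Delta R X k n e) =
        (?a e \<oplus>\<^bsub>?V\<^esub> sign R k \<odot>\<^bsub>?V\<^esub> swap_action R ?G m (?a e)) \<oplus>\<^bsub>?V\<^esub> sign R k \<odot>\<^bsub>?V\<^esub> ?b e"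
      using Delta_boundary_cell[OF X _ m] by blast
  qed
qed

section \<open>The globular coalgebra\<close>

lemma globular_coalgebra_sel [simp]:
  "cmod (Coalg X) = chains R X"
  "diff (Coalg X) = diff (Ch X)"
  by (simp_all add: globular_coalgebra_def globular_chains_def Let_def)

text \<open>Constructions on complexes read the modules and the differential of a coalgebra, nothing else.\<close>

lemma forget_coalgebra [simp]:
  "tensor_complex R (Coalg X) D = tensor_complex R (Ch X) D"
  "tensor_complex R E (Coalg X) = tensor_complex R E (Ch X)"
  "swap_action R (Coalg X) = swap_action R (Ch X)"
  "left_unitor R (Coalg X) = left_unitor R (Ch X)"
  "right_unitor R (Coalg X) = right_unitor R (Ch X)"
  "tensor_chain_map R (Coalg X) A1 A2 A3 = tensor_chain_map R (Ch X) A1 A2 A3"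
  "tensor_chain_map R B1 (Coalg X) B2 B3 = tensor_chain_map R B1 (Ch X) B2 B3"
  "tensor_chain_map R C1 C2 (Coalg X) C3 = tensor_chain_map R C1 C2 (Ch X) C3"
  "tensor_chain_map R D1 D2 D3 (Coalg X) = tensor_chain_map R D1 D2 D3 (Ch X)"
  by (simp_all add: tensor_complex_def swap_action_def left_unitor_def right_unitor_def tensor_chain_map_def fun_eq_iff)

abbreviation "WC X \<equiv> cmod (tensor_complex R (W_complex R) (Ch X))"

definition coprod_term :: "'x globular_set \<Rightarrow> nat \<Rightarrow> nat \<Rightarrow> (bool \<Rightarrow> 'a) \<Rightarrow> ('x \<Rightarrow> 'a) set \<Rightarrow> nat \<Rightarrow> (('x \<Rightarrow> 'a) set \<times> ('x \<Rightarrow> 'a) set \<Rightarrow> 'a) set" where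
  "coprod_term X k n w c = w False \<odot>\<^bsub>CC X n\<^esub> Delta R X k (n - k) c
     \<oplus>\<^bsub>CC X n\<^esub> w True \<odot>\<^bsub>CC X n\<^esub> swap_action R (Ch X) n (Delta R X k (n - k) c)"

lemma coprod_eq: "coprod (Coalg X) n z = (\<Oplus>\<^bsub>CC X n\<^esub>k\<in>{..n}.
    tensor_lift R (cmod (W_complex R) k) (chains R X (n - k)) (CC X n) (coprod_term X k n) (z k))"
  by (simp add: globular_coalgebra_def Let_def coprod_term_def[abs_def])

lemma W_eval_hom: "(\<lambda>w. w i) \<in> mod_hom R (cmod (W_complex R) k) (cmod (unit_complex R) 0)"
  by (rule mod_homI) (auto simp: W_cmod free_mod_sel unit_complex_sel)

lemma W_eval_closed [simp]: "w \<in> carrier (cmod (W_complex R) k) \<Longrightarrow> w i \<in> carrier R"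
  by (auto simp: W_cmod free_mod_sel)

lemma coprod_term_bilinear:
  assumes "k \<le> n"
  shows "bilinear R (cmod (W_complex R) k) (chains R X (n - k)) (CC X n) (coprod_term X k n)"
proof -
  have D: "Delta R X k (n - k) \<in> mod_hom R (chains R X (n - k)) (CC X n)" by (rule Delta_hom) (use assms in simp)
  note TD = mod_hom_comp[OF D swap_hom[OF globular_chains_graded]]
  show ?thesis
  proof (rule bilinearI)
    fix c assume c: "c \<in> carrier (chains R X (n - k))"
    show "(\<lambda>w. coprod_term X k n w c) \<in> mod_hom R (cmod (W_complex R) k) (CC X n)"
      unfolding coprod_term_def
      by (intro mod_hom_plus mod_hom_scalar W_eval_hom CC_module mod_homD(1)[OF D c] mod_homD(1)[OF TD c])
  next
    fix w assume w: "w \<in> carrier (cmod (W_complex R) k)"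
    show "coprod_term X k n w \<in> mod_hom R (chains R X (n - k)) (CC X n)"
      unfolding coprod_term_def[abs_def]
      by (intro mod_hom_plus mod_hom_scale D TD CC_module W_eval_closed[OF w])
  qed
qed

lemma coprod_summand_hom:
  assumes "k \<le> n"
  shows "(\<lambda>z. tensor_lift R (cmod (W_complex R) k) (chains R X (n - k)) (CC X n) (coprod_term X k n) (z k))
    \<in> mod_hom R (WC X n) (CC X n)"
proof -
  have "tensor_lift R (cmod (W_complex R) k) (chains R X (n - k)) (CC X n) (coprod_term X k n)
      \<in> mod_hom R (tensor R (cmod (W_complex R) k) (chains R X (n - k))) (CC X n)"
    by (rule tensor_lift_hom[OF _ _ _ coprod_term_bilinear[OF assms]]) simp_all
  from mod_hom_comp[OF fin_prod_component_hom[of k "{..n}" "\<lambda>j. tensor R (cmod (W_complex R) j) (chains R X (n - j))"] this]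
  show ?thesis using assms by (simp add: cmod_tensor_complex)
qed

lemma coprod_hom: "coprod (Coalg X) n \<in> mod_hom R (WC X n) (CC X n)"
  unfolding coprod_eq[abs_def] by (rule mod_hom_finsum) (auto intro: coprod_summand_hom)

text \<open>The family \<open>w \<otimes> c\<close> has the single nonzero component \<open>k\<close>, so one summand of the coproduct survives.\<close>

lemma coprod_gpure:
  assumes n: "k + q = n" and w: "w \<in> carrier (cmod (W_complex R) k)" and c: "c \<in> carrier (chains R X q)"
  shows "coprod (Coalg X) n (gpure R (W_complex R) (Ch X) k q w c) =
    w False \<odot>\<^bsub>CC X n\<^esub> Delta R X k q c \<oplus>\<^bsub>CC X n\<^esub> w True \<odot>\<^bsub>CC X n\<^esub> swap_action R (Ch X) n (Delta R X k q c)"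
proof -
  let ?z = "gpure R (W_complex R) (Ch X) k q w c"
  let ?V = "CC X n"
  interpret V: module R ?V by simp
  let ?f = "\<lambda>j. tensor_lift R (cmod (W_complex R) j) (chains R X (n - j)) ?V (coprod_term X j n) (?z j)"
  have q: "q = n - k" and kn: "k \<le> n" using n by auto
  have z: "?z \<in> carrier (WC X n)" using n w c by simp
  have fc: "?f j \<in> carrier ?V" if "j \<le> n" for j using mod_homD(1)[OF coprod_summand_hom[OF that] z] .
  have f0: "?f j = \<zero>\<^bsub>?V\<^esub>" if "j \<in> {..n} - {k}" for j
  proof -
    have j: "j \<le> n" "j \<noteq> k" using that by auto
    then have "?z j = \<zero>\<^bsub>tensor R (cmod (W_complex R) j) (chains R X (n - j))\<^esub>"
      using gpure_component[OF n j(1), of "W_complex R" "Ch X" w c] by simp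
    then show ?thesis
      using mod_hom_zero[OF _ _ tensor_lift_hom[OF _ _ _ coprod_term_bilinear[OF j(1)]]] by simp
  qed
  have "coprod (Coalg X) n ?z = (\<Oplus>\<^bsub>?V\<^esub>j\<in>{k}. ?f j)" unfolding coprod_eq
    by (rule V.add.finprod_mono_neutral_cong_left[symmetric]) (use kn f0 fc in auto)
  also have "\<dots> = ?f k" using fc[OF kn] by simp
  also have "\<dots> = coprod_term X k n w c"
  proof -
    have "?z k = pure R (cmod (W_complex R) k) (chains R X (n - k)) w c"
      using gpure_component[OF n kn, of "W_complex R" "Ch X" w c] q by simp
    then show ?thesis using w c q
      by (simp add: tensor_lift_pure[OF _ _ _ coprod_term_bilinear[OF kn]])
  qed
  finally show ?thesis by (simp add: coprod_term_def q)
qed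

lemma aug_hom: "aug (Coalg X) n \<in> mod_hom R (chains R X n) (cmod (unit_complex R) n)"
  and aug_cell: "x \<in> cells X n \<Longrightarrow> aug (Coalg X) n (cell_class R X n x) = (if n = 0 then \<one> else \<zero>)"
proof -
  have e: "aug (Coalg X) n
    = chains_lift R X n (cmod (unit_complex R) n) (\<lambda>x. if n = 0 then \<one> else \<zero>)"
    by (simp add: globular_coalgebra_def Let_def)
  show "aug (Coalg X) n \<in> mod_hom R (chains R X n) (cmod (unit_complex R) n)"
    unfolding e by (rule chains_lift_hom) (auto simp: unit_complex_sel)
  show "aug (Coalg X) n (cell_class R X n x) = (if n = 0 then \<one> else \<zero>)" if "x \<in> cells X n"
    unfolding e by (rule chains_lift_cell[OF _ _ _ that]) (auto simp: unit_complex_sel)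
qed

lemma aug_chain_map:
  assumes X: "is_globular_set X"
  shows "is_chain_map R (Coalg X) (unit_complex R) (aug (Coalg X))"
  unfolding is_chain_map_def
proof (intro conjI allI ballI)
  fix n c assume c: "c \<in> carrier (cmod (Coalg X) (Suc n))"
  have "aug (Coalg X) n (diff (Ch X) n c) = \<zero>\<^bsub>cmod (unit_complex R) n\<^esub>"
  proof (rule mod_hom_eqI[OF chains_spans chains_module _ mod_hom_comp[OF globular_diff_hom[OF X] aug_hom] mod_hom_const_zero])
    fix a assume "a \<in> cell_class R X (Suc n) ` cells X (Suc n)"
    then obtain x where x: "x \<in> cells X (Suc n)" "a = cell_class R X (Suc n) x" by blast
    have z: "(if n = 0 then \<one> else \<zero>) \<in> carrier (cmod (unit_complex R) n)" by (simp add: unit_complex_sel)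
    show "aug (Coalg X) n (diff (Ch X) n a) = \<zero>\<^bsub>cmod (unit_complex R) n\<^esub>"
      using x globular_setD(1,2)[OF X x(1)] mod_minus_zero[OF _ z]
      by (simp add: globular_diff_cell[OF X] mod_hom_minus[OF _ _ aug_hom] aug_cell split del: if_split)
  qed (use c in simp_all)
  then show "aug (Coalg X) n (diff (Coalg X) n c)
      = diff (unit_complex R) n (aug (Coalg X) (Suc n) c)"
    by (simp add: unit_complex_sel)
qed (use aug_hom in simp)

text \<open>On \<open>e\<^sub>k \<otimes> c\<close> this is the homotopy identity for \<open>\<Delta>\<^sub>k\<close>. As \<open>T\<close> is an involution that commutes with \<open>\<partial>\<close>,
  applying \<open>T\<close> to that identity gives the case of \<open>T e\<^sub>k \<otimes> c\<close>.\<close>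

lemma coprod_chain_map:
  assumes X: "is_globular_set X" and z: "z \<in> carrier (WC X (Suc n))"
  shows "coprod (Coalg X) n (diff (tensor_complex R (W_complex R) (Ch X)) n z)
    = diff (tensor_complex R (Ch X) (Ch X)) n (coprod (Coalg X) (Suc n) z)"
proof -
  let ?G = "Ch X" and ?W = "W_complex R"
  let ?V = "CC X n"
  let ?d = "diff (tensor_complex R ?G ?G) n" and ?D = "diff (tensor_complex R ?W ?G) n"
  let ?T = "swap_action R ?G n"
  let ?C = "coprod (Coalg X)"
  have dg: "dgraded ?G" using X by simp
  have V: "module R ?V" by simp
  note d = tensor_complex_diff_hom[OF dg dg, of n] and D = tensor_complex_diff_hom[OF W_dgraded dg, of n]
  note T = swap_hom[OF globular_chains_graded, of X n]
  show ?thesis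
  proof (rule tensor_complex_hom_eqI[OF W_graded globular_chains_graded V spans_carrier spans_carrier
        mod_hom_comp[OF D coprod_hom] mod_hom_comp[OF coprod_hom d] _ z])
    fix k q w c assume n: "k + q = Suc n" and w: "w \<in> carrier (cmod ?W k)" and c': "c \<in> carrier (cmod ?G q)"
    then have c: "c \<in> carrier (chains R X q)" by simp
    have n': "q + k = Suc n" using n by simp
    define A where "A = (if k = 0 then \<zero>\<^bsub>?V\<^esub> else Delta R X (k - 1) q c)"
    define P where "P = (if q = 0 then \<zero>\<^bsub>?V\<^esub> else Delta R X k (q - 1) (diff ?G (q - 1) c))"
    have dc: "diff ?G (q - 1) c \<in> carrier (chains R X (q - 1))" if "q \<noteq> 0"
      using mod_homD(1)[OF globular_diff_hom[OF X], of c "q - 1"] c that by simp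
    have AP: "A \<in> carrier ?V" "P \<in> carrier ?V" using n c dc by (simp_all add: A_def P_def)
    have TAP: "?T A \<in> carrier ?V" "?T P \<in> carrier ?V" using mod_homD(1)[OF T] AP by simp_all
    have TT: "?T (?T A) = A" using swap_swap[OF globular_chains_graded AP(1)] .
    have T0: "?T \<zero>\<^bsub>?V\<^esub> = \<zero>\<^bsub>?V\<^esub>" by (rule mod_hom_zero[OF V V T])
    have E: "?d (Delta R X k q c) = (A \<oplus>\<^bsub>?V\<^esub> sign R k \<odot>\<^bsub>?V\<^esub> ?T A) \<oplus>\<^bsub>?V\<^esub> sign R k \<odot>\<^bsub>?V\<^esub> P"
      unfolding A_def P_def by (rule Delta_boundary[OF X c n'])
    have Dc: "Delta R X k q c \<in> carrier (CC X (Suc n))" using n' c by simp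
    have TDc: "swap_action R ?G (Suc n) (Delta R X k q c) \<in> carrier (CC X (Suc n))"
      using mod_homD(1)[OF swap_hom[OF globular_chains_graded] Dc] .
    have TE: "?d (swap_action R ?G (Suc n) (Delta R X k q c)) = (?T A \<oplus>\<^bsub>?V\<^esub> sign R k \<odot>\<^bsub>?V\<^esub> A) \<oplus>\<^bsub>?V\<^esub> sign R k \<odot>\<^bsub>?V\<^esub> ?T P"
      using swap_diff[OF dg Dc] AP TAP by (simp add: E mod_homD(2,3)[OF T] TT)
    have w': "w False \<in> carrier R" "w True \<in> carrier R" using w by simp_all
    have R: "?d (?C (Suc n) (gpure R ?W ?G k q w c)) =
        w False \<odot>\<^bsub>?V\<^esub> ((A \<oplus>\<^bsub>?V\<^esub> sign R k \<odot>\<^bsub>?V\<^esub> ?T A) \<oplus>\<^bsub>?V\<^esub> sign R k \<odot>\<^bsub>?V\<^esub> P) \<oplus>\<^bsub>?V\<^esub>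
        w True \<odot>\<^bsub>?V\<^esub> ((?T A \<oplus>\<^bsub>?V\<^esub> sign R k \<odot>\<^bsub>?V\<^esub> A) \<oplus>\<^bsub>?V\<^esub> sign R k \<odot>\<^bsub>?V\<^esub> ?T P)"
      using w' Dc TDc by (simp add: coprod_gpure[OF n w c] mod_homD(2,3)[OF d] E TE)
    let ?l = "if k = 0 then \<zero>\<^bsub>WC X n\<^esub> else gpure R ?W ?G (k - 1) q (diff ?W (k - 1) w) c"
      and ?r = "if q = 0 then \<zero>\<^bsub>WC X n\<^esub> else gpure R ?W ?G k (q - 1) w (diff ?G (q - 1) c)"
    have C0: "?C n \<zero>\<^bsub>WC X n\<^esub> = \<zero>\<^bsub>?V\<^esub>" by (rule mod_hom_zero[OF _ V coprod_hom]) simp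
    have dw: "diff ?W (k - 1) w False = w False \<oplus> sign R k \<otimes> w True"
      "diff ?W (k - 1) w True = w True \<oplus> sign R k \<otimes> w False" if "k \<noteq> 0"
      using that by (simp_all add: W_complex_def free_mod_sel T_mult_def)
    have l: "?C n ?l = (w False \<oplus> sign R k \<otimes> w True) \<odot>\<^bsub>?V\<^esub> A \<oplus>\<^bsub>?V\<^esub> (w True \<oplus> sign R k \<otimes> w False) \<odot>\<^bsub>?V\<^esub> ?T A"
    proof (cases k)
      case 0
      then show ?thesis using w' V by (simp add: A_def T0 C0)
    next
      case (Suc k')
      have "diff ?W k' w \<in> carrier (cmod ?W k')" using mod_homD(1)[OF dgraded_diff[OF W_dgraded]] w Suc by simp
      then show ?thesis using coprod_gpure[of k' q n "diff ?W k' w" c X] n c dw Suc by (simp add: A_def)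
    qed
    have r: "?C n ?r = w False \<odot>\<^bsub>?V\<^esub> P \<oplus>\<^bsub>?V\<^esub> w True \<odot>\<^bsub>?V\<^esub> ?T P"
    proof (cases q)
      case 0
      then show ?thesis using w' V by (simp add: P_def T0 C0)
    next
      case (Suc q')
      then show ?thesis using coprod_gpure[of k q' n w "diff ?G q' c" X] n w dc by (simp add: P_def)
    qed
    have lr: "?l \<in> carrier (WC X n)" "?r \<in> carrier (WC X n)"
    proof -
      show "?l \<in> carrier (WC X n)" using n w c by (cases k) simp_all
      show "?r \<in> carrier (WC X n)" using n w c dc by (cases q) simp_all
    qed
    have L: "?C n (?D (gpure R ?W ?G k q w c)) = ?C n ?l \<oplus>\<^bsub>?V\<^esub> sign R k \<odot>\<^bsub>?V\<^esub> ?C n ?r"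
      unfolding tensor_complex_diff_gpure[OF W_dgraded dg n w c']
      using lr by (simp add: mod_homD(2,3)[OF coprod_hom] split del: if_split)
    show "?C n (?D (gpure R ?W ?G k q w c)) = ?d (?C (Suc n) (gpure R ?W ?G k q w c))"
      unfolding L l r R using w' AP TAP V
      by (simp add: mod_l_distr mod_r_distr mod_assoc[symmetric] m_comm) (simp add: mod_ac)
  qed
qed

lemma coprod_equivariant:
  assumes z: "z \<in> carrier (WC X n)"
  shows "coprod (Coalg X) n
      (tensor_chain_map R (W_complex R) (Ch X) (W_complex R) (Ch X) (\<lambda>k. T_mult) (\<lambda>k c. c) n z)
    = swap_action R (Ch X) n (coprod (Coalg X) n z)"
proof -
  let ?G = "Ch X" and ?W = "W_complex R"
  let ?V = "CC X n"
  have V: "module R ?V" by simp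
  note T = swap_hom[OF globular_chains_graded, of X n]
  note gr = W_graded globular_chains_graded W_graded globular_chains_graded
  have S: "tensor_chain_map R ?W ?G ?W ?G (\<lambda>k. T_mult) (\<lambda>k c. c) n \<in> mod_hom R (WC X n) (WC X n)"
    by (rule tensor_chain_map_hom[OF gr]) (simp_all add: T_mult_hom mod_hom_id)
  show ?thesis
  proof (rule tensor_complex_hom_eqI[OF W_graded globular_chains_graded V spans_carrier spans_carrier
        mod_hom_comp[OF S coprod_hom] mod_hom_comp[OF coprod_hom T] _ z])
    fix k q w c assume n: "k + q = n" and w: "w \<in> carrier (cmod ?W k)" and c': "c \<in> carrier (cmod ?G q)"
    then have c: "c \<in> carrier (chains R X q)" by simp
    have Dc: "Delta R X k q c \<in> carrier ?V" using n c by simp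
    have TDc: "swap_action R ?G n (Delta R X k q c) \<in> carrier ?V" using mod_homD(1)[OF T Dc] .
    have tw: "T_mult w \<in> carrier (cmod ?W k)" using mod_homD(1)[OF T_mult_hom w] .
    have e: "tensor_chain_map R ?W ?G ?W ?G (\<lambda>k. T_mult) (\<lambda>k c. c) n (gpure R ?W ?G k q w c)
      = gpure R ?W ?G k q (T_mult w) c"
      by (rule tensor_chain_map_gpure[OF gr T_mult_hom mod_hom_id n w c'])
    have "w False \<in> carrier R" "w True \<in> carrier R" using w by simp_all
    then show "coprod (Coalg X) n (tensor_chain_map R ?W ?G ?W ?G (\<lambda>k. T_mult) (\<lambda>k c. c) n (gpure R ?W ?G k q w c))
      = swap_action R ?G n (coprod (Coalg X) n (gpure R ?W ?G k q w c))"
      unfolding e coprod_gpure[OF n w c] coprod_gpure[OF n tw c] using Dc TDc V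
      by (simp add: mod_homD(2,3)[OF T] swap_swap T_mult_def mod_ac)
  qed
qed

lemma W_aug_hom: "W_aug R k \<in> mod_hom R (cmod (W_complex R) k) (cmod (unit_complex R) k)"
proof (cases k)
  case 0
  have "(\<lambda>w. w False \<oplus>\<^bsub>cmod (unit_complex R) 0\<^esub> w True) \<in> mod_hom R (cmod (W_complex R) 0) (cmod (unit_complex R) 0)"
    by (intro mod_hom_plus W_eval_hom graded_module unit_complex_graded)
  then show ?thesis using 0 by (simp add: W_aug_def[abs_def] unit_complex_sel)
next
  case (Suc k')
  then show ?thesis
    using mod_hom_const_zero[OF graded_module[OF unit_complex_graded], of k "cmod (W_complex R) k"]
    by (simp add: W_aug_def[abs_def] unit_complex_sel)
qed

lemma W_counit_gpure:
  assumes n: "k + q = n" and w: "w \<in> carrier (cmod (W_complex R) k)" and c: "c \<in> carrier (chains R X q)"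
  shows "left_unitor R (Ch X) n
      (tensor_chain_map R (W_complex R) (Ch X) (unit_complex R) (Ch X) (W_aug R) (\<lambda>k c. c) n
        (gpure R (W_complex R) (Ch X) k q w c))
    = (if k = 0 then (w False \<oplus> w True) \<odot>\<^bsub>chains R X n\<^esub> c else \<zero>\<^bsub>chains R X n\<^esub>)"
proof -
  let ?G = "Ch X" and ?W = "W_complex R"
  have c': "c \<in> carrier (cmod ?G q)" using c by simp
  have e: "tensor_chain_map R ?W ?G (unit_complex R) ?G (W_aug R) (\<lambda>k c. c) n (gpure R ?W ?G k q w c)
      = gpure R (unit_complex R) ?G k q (W_aug R k w) c"
    by (rule tensor_chain_map_gpure[OF W_graded globular_chains_graded unit_complex_graded globular_chains_graded W_aug_hom mod_hom_id n w c'])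
  show ?thesis unfolding e left_unitor_gpure[OF globular_chains_graded n mod_homD(1)[OF W_aug_hom w] c']
    by (simp add: W_aug_def)
qed

text \<open>The map \<open>id \<otimes> \<epsilon>\<close>, followed by \<open>C \<otimes> R \<cong> C\<close>, and its mirror image.\<close>

definition counit_right :: "'x globular_set \<Rightarrow> nat \<Rightarrow> (nat \<Rightarrow> (('x \<Rightarrow> 'a) set \<times> ('x \<Rightarrow> 'a) set \<Rightarrow> 'a) set) \<Rightarrow> ('x \<Rightarrow> 'a) set" where
  "counit_right X n z = right_unitor R (Ch X) n
    (tensor_chain_map R (Ch X) (Ch X) (Ch X) (unit_complex R)
      (\<lambda>k c. c) (aug (Coalg X)) n z)"

definition counit_left :: "'x globular_set \<Rightarrow> nat \<Rightarrow> (nat \<Rightarrow> (('x \<Rightarrow> 'a) set \<times> ('x \<Rightarrow> 'a) set \<Rightarrow> 'a) set) \<Rightarrow> ('x \<Rightarrow> 'a) set" where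
  "counit_left X n z = left_unitor R (Ch X) n
    (tensor_chain_map R (Ch X) (Ch X) (unit_complex R) (Ch X)
      (aug (Coalg X)) (\<lambda>k c. c) n z)"

lemma counit_hom:
  "counit_right X n \<in> mod_hom R (CC X n) (chains R X n)"
  "counit_left X n \<in> mod_hom R (CC X n) (chains R X n)"
proof -
  let ?G = "Ch X"
  have a: "aug (Coalg X) k \<in> mod_hom R (cmod ?G k) (cmod (unit_complex R) k)" for k
    using aug_hom by simp
  note g = globular_chains_graded[of X]
  show "counit_right X n \<in> mod_hom R (CC X n) (chains R X n)"
    using mod_hom_comp[OF tensor_chain_map_hom[OF g g g unit_complex_graded mod_hom_id a] right_unitor_hom[OF g]]
    by (simp add: counit_right_def[abs_def])
  show "counit_left X n \<in> mod_hom R (CC X n) (chains R X n)"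
    using mod_hom_comp[OF tensor_chain_map_hom[OF g g unit_complex_graded g a mod_hom_id] left_unitor_hom[OF g]]
    by (simp add: counit_left_def[abs_def])
qed

lemma counit_gpure:
  assumes n: "p + q = n" and x: "x \<in> carrier (chains R X p)" and y: "y \<in> carrier (chains R X q)"
  shows "counit_right X n (gpure R (Ch X) (Ch X) p q x y)
      = (if q = 0 then aug (Coalg X) q y \<odot>\<^bsub>chains R X n\<^esub> x else \<zero>\<^bsub>chains R X n\<^esub>)"
    and "counit_left X n (gpure R (Ch X) (Ch X) p q x y)
      = (if p = 0 then aug (Coalg X) p x \<odot>\<^bsub>chains R X n\<^esub> y else \<zero>\<^bsub>chains R X n\<^esub>)"
proof -
  let ?G = "Ch X"
  have a: "aug (Coalg X) k \<in> mod_hom R (cmod ?G k) (cmod (unit_complex R) k)" for k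
    using aug_hom by simp
  note g = globular_chains_graded[of X]
  have x': "x \<in> carrier (cmod ?G p)" and y': "y \<in> carrier (cmod ?G q)" using x y by auto
  show "counit_right X n (gpure R ?G ?G p q x y) = (if q = 0 then aug (Coalg X) q y \<odot>\<^bsub>chains R X n\<^esub> x else \<zero>\<^bsub>chains R X n\<^esub>)"
    unfolding counit_right_def
    unfolding tensor_chain_map_gpure[OF g g g unit_complex_graded mod_hom_id a n x' y']
    using right_unitor_gpure[OF g n mod_homD(1)[OF a y'] x'] by simp
  show "counit_left X n (gpure R ?G ?G p q x y) = (if p = 0 then aug (Coalg X) p x \<odot>\<^bsub>chains R X n\<^esub> y else \<zero>\<^bsub>chains R X n\<^esub>)"
    unfolding counit_left_def
    unfolding tensor_chain_map_gpure[OF g g unit_complex_graded g a mod_hom_id n x' y']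
    using left_unitor_gpure[OF g n mod_homD(1)[OF a x'] y'] by simp
qed

text \<open>The counit sees vertices only. For \<open>k > 0\<close> no factor of \<open>\<Delta>\<^sub>kx\<close> is a vertex; for \<open>k = 0\<close> each of the
  two maps keeps the term in which it meets a vertex.\<close>

lemma counit_Delta_cell:
  assumes X: "is_globular_set X" and x: "x \<in> cells X q" and n: "k + q = n"
  shows "counit_right X n (Delta_cell R X k q x) = (if k = 0 then cell_class R X q x else \<zero>\<^bsub>chains R X n\<^esub>)"
    and "counit_left X n (Delta_cell R X k q x) = (if k = 0 then cell_class R X q x else \<zero>\<^bsub>chains R X n\<^esub>)"
proof -
  have n': "q + k = n" using n by simp
  note H = counit_hom[of X n]
  have z: "counit_right X n \<zero>\<^bsub>CC X n\<^esub> = \<zero>\<^bsub>chains R X n\<^esub>" "counit_left X n \<zero>\<^bsub>CC X n\<^esub> = \<zero>\<^bsub>chains R X n\<^esub>"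
    by (rule mod_hom_zero[OF _ _ H(1)] mod_hom_zero[OF _ _ H(2)]; simp)+
  consider (small) "q < k" | (eq) "k = q" | (big) "k < q" by linarith
  then have "counit_right X n (Delta_cell R X k q x) = (if k = 0 then cell_class R X q x else \<zero>\<^bsub>chains R X n\<^esub>) \<and>
    counit_left X n (Delta_cell R X k q x) = (if k = 0 then cell_class R X q x else \<zero>\<^bsub>chains R X n\<^esub>)"
  proof cases
    case small
    then show ?thesis using z n' by (simp add: Delta_cell_eqs)
  next
    case eq
    then show ?thesis using n x by (auto simp: Delta_cell_eqs counit_gpure aug_cell)
  next
    case big
    have ts: "iter_tgt X k q x \<in> cells X k" "iter_src X k q x \<in> cells X k"
      using iter_closed[OF X _ x, of k] big by auto
    have g: "gpure R (Ch X) (Ch X) k q (cell_class R X k (iter_tgt X k q x)) (cell_class R X q x) \<in> carrier (CC X n)"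
      "gpure R (Ch X) (Ch X) q k (cell_class R X q x) (cell_class R X k (iter_src X k q x)) \<in> carrier (CC X n)"
      using n n' by simp_all
    have "k = 0 \<Longrightarrow> q = n" using n by simp
    then show ?thesis using big n n' g ts
      by (cases "k = 0") (simp_all add: Delta_cell_eqs(3) mod_homD(2,3)[OF H(1)] mod_homD(2,3)[OF H(2)] counit_gpure aug_cell)
  qed
  then show "counit_right X n (Delta_cell R X k q x) = (if k = 0 then cell_class R X q x else \<zero>\<^bsub>chains R X n\<^esub>)"
    "counit_left X n (Delta_cell R X k q x) = (if k = 0 then cell_class R X q x else \<zero>\<^bsub>chains R X n\<^esub>)" by auto
qed

text \<open>The transposition exchanges the two counit maps, so both laws for the terms \<open>T e\<^sub>k \<otimes> c\<close> follow from
  those for \<open>e\<^sub>k \<otimes> c\<close>.\<close>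

lemma counit_swap:
  assumes z: "z \<in> carrier (CC X n)"
  shows "counit_right X n (swap_action R (Ch X) n z) = counit_left X n z"
    and "counit_left X n (swap_action R (Ch X) n z) = counit_right X n z"
proof -
  let ?G = "Ch X"
  note g = globular_chains_graded[of X]
  note H = counit_hom[of X n] and T = swap_hom[OF g, of n]
  have ac: "aug (Coalg X) 0 a \<in> carrier R" if "a \<in> carrier (chains R X 0)" for a
    using mod_homD(1)[OF aug_hom that] by (simp add: unit_complex_sel)
  have "counit_right X n (swap_action R ?G n (gpure R ?G ?G p q a b)) = counit_left X n (gpure R ?G ?G p q a b) \<and>
    counit_left X n (swap_action R ?G n (gpure R ?G ?G p q a b)) = counit_right X n (gpure R ?G ?G p q a b)"
    if n: "p + q = n" and a: "a \<in> carrier (cmod ?G p)" and b: "b \<in> carrier (cmod ?G q)" for p q a b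
  proof -
    have n': "q + p = n" using n by simp
    show ?thesis using n n' a b ac
      by (auto simp: swap_gpure[OF g n a b] mod_homD(3)[OF H(1)] mod_homD(3)[OF H(2)] counit_gpure)
  qed
  note e = this
  show "counit_right X n (swap_action R ?G n z) = counit_left X n z"
    by (rule tensor_complex_hom_eqI[OF g g _ spans_carrier spans_carrier mod_hom_comp[OF T H(1)] H(2) _ z]) (use e in auto)
  show "counit_left X n (swap_action R ?G n z) = counit_right X n z"
    by (rule tensor_complex_hom_eqI[OF g g _ spans_carrier spans_carrier mod_hom_comp[OF T H(2)] H(1) _ z]) (use e in auto)
qed

lemma coprod_counit:
  assumes X: "is_globular_set X" and z: "z \<in> carrier (WC X n)"
  shows "counit_right X n (coprod (Coalg X) n z)
      = left_unitor R (Ch X) n (tensor_chain_map R (W_complex R) (Ch X) (unit_complex R) (Ch X) (W_aug R) (\<lambda>k c. c) n z)"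
    (is "?r z = ?w z")
    and "counit_left X n (coprod (Coalg X) n z)
      = left_unitor R (Ch X) n (tensor_chain_map R (W_complex R) (Ch X) (unit_complex R) (Ch X) (W_aug R) (\<lambda>k c. c) n z)"
    (is "?l z = _")
proof -
  let ?G = "Ch X" and ?W = "W_complex R"
  note g = globular_chains_graded[of X]
  note H = counit_hom[of X n]
  have w: "?w \<in> mod_hom R (WC X n) (chains R X n)"
    using mod_hom_comp[OF tensor_chain_map_hom[OF W_graded g unit_complex_graded g W_aug_hom mod_hom_id] left_unitor_hom[OF g]]
    by simp
  have s: "spans R (cmod ?G q) (cell_class R X q ` cells X q)" for q using chains_spans by simp
  have e: "?r (gpure R ?W ?G k q w c) = ?w (gpure R ?W ?G k q w c) \<and> ?l (gpure R ?W ?G k q w c) = ?w (gpure R ?W ?G k q w c)"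
    if n: "k + q = n" and w: "w \<in> carrier (cmod ?W k)" and c: "c \<in> cell_class R X q ` cells X q" for k q w c
  proof -
    obtain x where x: "x \<in> cells X q" "c = cell_class R X q x" using c by blast
    have n': "q + k = n" using n by simp
    have cc: "c \<in> carrier (chains R X q)" using x by simp
    have D: "Delta R X k q c = Delta_cell R X k q x" using x Delta_on_cell by simp
    have Dc: "Delta_cell R X k q x \<in> carrier (CC X n)" using Delta_cell_closed[of X k q x] n' by simp
    have TDc: "swap_action R ?G n (Delta_cell R X k q x) \<in> carrier (CC X n)" using mod_homD(1)[OF swap_hom[OF g] Dc] .
    have w': "w False \<in> carrier R" "w True \<in> carrier R" using w by simp_all
    have "k = 0 \<Longrightarrow> q = n" using n by simp
    then show ?thesis
      unfolding coprod_gpure[OF n w cc] W_counit_gpure[OF n w cc] D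
      using Dc TDc w' x
      by (simp add: mod_homD(2,3)[OF H(1)] mod_homD(2,3)[OF H(2)] counit_swap counit_Delta_cell[OF X x(1) n] mod_l_distr)
  qed
  show "?r z = ?w z"
    by (rule tensor_complex_hom_eqI[OF W_graded g _ spans_carrier s mod_hom_comp[OF coprod_hom H(1)] w _ z]) (use e in auto)
  show "?l z = ?w z"
    by (rule tensor_complex_hom_eqI[OF W_graded g _ spans_carrier s mod_hom_comp[OF coprod_hom H(2)] w _ z]) (use e in auto)
qed

lemma globular_coalgebra_is_coalgebra:
  assumes X: "is_globular_set X"
  shows "is_coalgebra R (Coalg X)"
proof -
  have "is_chain_complex R (Coalg X)"
    using globular_chains_complex[OF X] by (simp add: is_chain_complex_def)
  moreover have "is_chain_map R (tensor_complex R (W_complex R) (Ch X))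
      (tensor_complex R (Ch X) (Ch X)) (coprod (Coalg X))"
    using coprod_hom[of X] coprod_chain_map[OF X] by (simp add: is_chain_map_def)
  ultimately show ?thesis
    using aug_chain_map[OF X] coprod_equivariant[where X = X] coprod_counit[OF X]
    by (simp add: is_coalgebra_def Let_def counit_left_def counit_right_def)
qed

section \<open>Functoriality\<close>

lemma degenerate_map:
  assumes F: "F \<in> globular_hom X Y" and x: "x \<in> degenerate X n"
  shows "F n x \<in> degenerate Y n"
  using x globular_homD(2,5)[OF F] by (cases n) auto

lemma iter_map:
  assumes X: "is_globular_set X" and F: "F \<in> globular_hom X Y" and "k \<le> n" "x \<in> cells X n"
  shows "iter_tgt Y k n (F n x) = F k (iter_tgt X k n x)" "iter_src Y k n (F n x) = F k (iter_src X k n x)"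
  using assms(3,4)
  by (induction n arbitrary: x) (auto simp: globular_homD(3,4)[OF F, symmetric] globular_setD[OF X] le_Suc_eq)

lemma
  assumes F: "F \<in> globular_hom X Y"
  shows globular_chain_map_hom: "globular_chain_map R X Y F n \<in> mod_hom R (chains R X n) (chains R Y n)"
    and globular_chain_map_cell: "x \<in> cells X n \<Longrightarrow>
      globular_chain_map R X Y F n (cell_class R X n x) = cell_class R Y n (F n x)"
proof -
  let ?l = "chains_lift R X n (chains R Y n) (\<lambda>x. cell_class R Y n (F n x))"
  have l: "?l \<in> mod_hom R (chains R X n) (chains R Y n)"
    by (rule chains_lift_hom) (simp_all add: cell_class_degenerate degenerate_map[OF F])
  show "globular_chain_map R X Y F n \<in> mod_hom R (chains R X n) (chains R Y n)"
    by (rule mod_hom_cong[OF l]) (simp_all add: globular_chain_map_def)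
  show "globular_chain_map R X Y F n (cell_class R X n x) = cell_class R Y n (F n x)" if "x \<in> cells X n"
  proof -
    have "?l (cell_class R X n x) = cell_class R Y n (F n x)"
      by (rule chains_lift_cell[OF _ _ _ that]) (simp_all add: cell_class_degenerate degenerate_map[OF F])
    then show ?thesis by (simp add: globular_chain_map_def)
  qed
qed

lemma tensor_chain_map_swap:
  assumes g: "graded C" "graded D" and f: "\<And>p. f p \<in> mod_hom R (cmod C p) (cmod D p)"
    and z: "z \<in> carrier (cmod (tensor_complex R C C) n)"
  shows "tensor_chain_map R C C D D f f n (swap_action R C n z) = swap_action R D n (tensor_chain_map R C C D D f f n z)"
proof -
  note F = tensor_chain_map_hom[OF g(1,1,2,2) f f, of n]
  show ?thesis
  proof (rule tensor_complex_hom_eqI[OF g(1,1) _ spans_carrier spans_carrier mod_hom_comp[OF swap_hom[OF g(1)] F] mod_hom_comp[OF F swap_hom[OF g(2)]] _ z])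
    fix p q a b assume n: "p + q = n" and a: "a \<in> carrier (cmod C p)" and b: "b \<in> carrier (cmod C q)"
    have n': "q + p = n" using n by simp
    show "tensor_chain_map R C C D D f f n (swap_action R C n (gpure R C C p q a b)) =
      swap_action R D n (tensor_chain_map R C C D D f f n (gpure R C C p q a b))"
      using g n n' a b mod_homD(1)[OF f]
      by (simp add: swap_gpure mod_homD(3)[OF F] tensor_chain_map_gpure[OF g(1,1,2,2) f f])
  qed (use g in simp)
qed

lemma globular_chain_map_coalgebra_hom:
  assumes X: "is_globular_set X" and Y: "is_globular_set Y" and F: "F \<in> globular_hom X Y"
  shows "globular_chain_map R X Y F \<in> coalgebra_hom R (Coalg X) (Coalg Y)"
proof (rule coalgebra_homI)
  let ?f = "globular_chain_map R X Y F"
  let ?G = "Ch X" and ?H = "Ch Y" and ?W = "W_complex R"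
  note f = globular_chain_map_hom[OF F] and fc = globular_chain_map_cell[OF F]
  note gX = globular_chains_graded[of X] and gY = globular_chains_graded[of Y]
  have f': "?f n \<in> mod_hom R (cmod ?G n) (cmod ?H n)" for n using f by simp
  show "?f n \<in> extensional (carrier (cmod (Coalg X) n))" for n
    by (simp add: globular_chain_map_def)
  show "?f n \<in> mod_hom R (cmod (Coalg X) n) (cmod (Coalg Y) n)" for n using f by simp
  show "?f n (diff (Coalg X) n c) = diff (Coalg Y) n (?f (Suc n) c)"
    if "c \<in> carrier (cmod (Coalg X) (Suc n))" for n c
    unfolding globular_coalgebra_sel
  proof (rule mod_hom_eqI[OF chains_spans chains_module chains_module mod_hom_comp[OF globular_diff_hom[OF X] f] mod_hom_comp[OF f globular_diff_hom[OF Y]]])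
    fix a assume "a \<in> cell_class R X (Suc n) ` cells X (Suc n)"
    then obtain x where x: "x \<in> cells X (Suc n)" "a = cell_class R X (Suc n) x" by blast
    then show "?f n (diff ?G n a) = diff ?H n (?f (Suc n) a)"
      using globular_setD(1,2)[OF X x(1)] globular_homD(2)[OF F x(1)]
      by (simp add: globular_diff_cell[OF X] globular_diff_cell[OF Y] mod_hom_minus[OF _ _ f] fc globular_homD(3,4)[OF F])
  qed (use that in simp)
  show "aug (Coalg Y) n (?f n c) = aug (Coalg X) n c"
    if "c \<in> carrier (cmod (Coalg X) n)" for n c
  proof (rule mod_hom_eqI[OF chains_spans chains_module _ mod_hom_comp[OF f aug_hom] aug_hom])
    fix a assume "a \<in> cell_class R X n ` cells X n"
    then show "aug (Coalg Y) n (?f n a) = aug (Coalg X) n a"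
      using globular_homD(2)[OF F] by (auto simp: fc aug_cell)
  qed (use that in simp_all)
  fix n z assume z: "z \<in> carrier (cmod (tensor_complex R ?W (Coalg X)) n)"
  let ?ff = "tensor_chain_map R ?G ?G ?H ?H ?f ?f n" and ?wf = "tensor_chain_map R ?W ?G ?W ?H (\<lambda>k w. w) ?f n"
  note FF = tensor_chain_map_hom[OF gX gX gY gY f' f', of n]
  note WF = tensor_chain_map_hom[OF W_graded gX W_graded gY mod_hom_id f', of n]
  have s: "spans R (cmod ?G q) (cell_class R X q ` cells X q)" for q using chains_spans by simp
  have "?ff (coprod (Coalg X) n z) = coprod (Coalg Y) n (?wf z)"
  proof (rule tensor_complex_hom_eqI[OF W_graded gX _ spans_carrier s mod_hom_comp[OF coprod_hom FF] mod_hom_comp[OF WF coprod_hom]])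
    fix k q w c assume n: "k + q = n" and w: "w \<in> carrier (cmod ?W k)" and "c \<in> cell_class R X q ` cells X q"
    then obtain x where x: "x \<in> cells X q" "c = cell_class R X q x" by blast
    have n': "q + k = n" using n by simp
    have cc: "c \<in> carrier (chains R X q)" and cc': "c \<in> carrier (cmod ?G q)" using x by simp_all
    have fcc: "?f q c \<in> carrier (chains R Y q)" using mod_homD(1)[OF f cc] .
    have Dc: "Delta R X k q c \<in> carrier (CC X n)" using n' cc by simp
    have TDc: "swap_action R ?G n (Delta R X k q c) \<in> carrier (CC X n)" using mod_homD(1)[OF swap_hom[OF gX] Dc] .
    have w': "w False \<in> carrier R" "w True \<in> carrier R" using w by simp_all
    have FFg: "?ff (gpure R ?G ?G p p' (cell_class R X p y) (cell_class R X p' y'))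
       = gpure R ?H ?H p p' (cell_class R Y p (F p y)) (cell_class R Y p' (F p' y'))"
      if "p + p' = n" "y \<in> cells X p" "y' \<in> cells X p'" for p p' y y'
      using tensor_chain_map_gpure[OF gX gX gY gY f' f' that(1), of "cell_class R X p y" "cell_class R X p' y'"] that(2,3)
      by (simp add: fc)
    have nat: "?ff (Delta R X k q c) = Delta R Y k q (?f q c)"
    proof -
      have "?ff (Delta_cell R X k q x) = Delta_cell R Y k q (F q x)"
      proof -
        consider (small) "q < k" | (eq) "k = q" | (big) "k < q" by linarith
        then show ?thesis
        proof cases
          case small
          have "?ff \<zero>\<^bsub>CC X n\<^esub> = \<zero>\<^bsub>CC Y n\<^esub>" by (rule mod_hom_zero[OF _ _ FF]) simp_all
          then show ?thesis using small n' by (simp add: Delta_cell_eqs)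
        next
          case eq
          then show ?thesis using n x FFg[of q q x x] by (simp add: Delta_cell_eqs)
        next
          case big
          have ts: "iter_tgt X k q x \<in> cells X k" "iter_src X k q x \<in> cells X k"
            using iter_closed[OF X _ x(1), of k] big by auto
          have g: "gpure R ?G ?G k q (cell_class R X k (iter_tgt X k q x)) (cell_class R X q x) \<in> carrier (CC X n)"
            "gpure R ?G ?G q k (cell_class R X q x) (cell_class R X k (iter_src X k q x)) \<in> carrier (CC X n)"
            using n n' by simp_all
          show ?thesis using big n n' g ts x(1)
            by (simp add: Delta_cell_eqs(3) mod_homD(2,3)[OF FF] FFg iter_map[OF X F] del: mult_Suc)
        qed
      qed
      then show ?thesis using x globular_homD(2)[OF F x(1)] by (simp add: Delta_on_cell fc)
    qed
    have e: "?wf (gpure R ?W ?G k q w c) = gpure R ?W ?H k q w (?f q c)"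
      by (rule tensor_chain_map_gpure[OF W_graded gX W_graded gY mod_hom_id f' n w cc'])
    show "?ff (coprod (Coalg X) n (gpure R ?W ?G k q w c)) = coprod (Coalg Y) n (?wf (gpure R ?W ?G k q w c))"
      unfolding e coprod_gpure[OF n w cc] coprod_gpure[OF n w fcc]
      using Dc TDc w' by (simp add: mod_homD(2,3)[OF FF] nat tensor_chain_map_swap[OF gX gY f'])
  qed (use z in simp_all)
  then show "tensor_chain_map R (Coalg X) (Coalg X) (Coalg Y) (Coalg Y) ?f ?f n
       (coprod (Coalg X) n z)
    = coprod (Coalg Y) n (tensor_chain_map R ?W (Coalg X) ?W (Coalg Y) (\<lambda>k w. w) ?f n z)"
    by simp
qed

lemma globular_functor:
  "functor_between (globular_category :: ('x globular_set, nat \<Rightarrow> 'x \<Rightarrow> 'x) category) (coalgebra_category R)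
    (globular_coalgebra R) (globular_chain_map R)"
proof (rule functor_between.intro[OF globular_category coalgebra_category functor_between_axioms.intro])
  fix X :: "'x globular_set" assume "X \<in> Ob globular_category"
  then have X: "is_globular_set X" by (simp add: globular_category_def)
  then show "Coalg X \<in> Ob (coalgebra_category R)"
    by (simp add: coalgebra_category_def globular_coalgebra_is_coalgebra)
  have id: "(\<lambda>n. \<lambda>x\<in>cells X n. x) \<in> globular_hom X X"
    using category.Idt_in[OF globular_category, of X] X by (simp add: globular_category_def)
  have "globular_chain_map R X X (\<lambda>n. \<lambda>x\<in>cells X n. x) n c = c" if c: "c \<in> carrier (chains R X n)" for n c
    by (rule mod_hom_eqI[OF chains_spans chains_module chains_module globular_chain_map_hom[OF id] mod_hom_id _ c])
      (auto simp: globular_chain_map_cell[OF id])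
  then show "globular_chain_map R X X (Idt globular_category X) = Idt (coalgebra_category R) (Coalg X)"
    by (auto simp: globular_category_def coalgebra_category_def fun_eq_iff globular_chain_map_def restrict_def)
next
  fix X Y :: "'x globular_set" and F
  assume "X \<in> Ob globular_category" "Y \<in> Ob globular_category" "F \<in> Hom globular_category X Y"
  then show "globular_chain_map R X Y F \<in> Hom (coalgebra_category R) (Coalg X) (Coalg Y)"
    by (simp add: globular_category_def coalgebra_category_def globular_chain_map_coalgebra_hom)
next
  fix X Y Z :: "'x globular_set" and F H
  assume a: "X \<in> Ob globular_category" "Y \<in> Ob globular_category" "Z \<in> Ob globular_category"
    "F \<in> Hom globular_category X Y" "H \<in> Hom globular_category Y Z"
  then have F: "F \<in> globular_hom X Y" and H: "H \<in> globular_hom Y Z"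
    and HF: "(\<lambda>n. compose (cells X n) (H n) (F n)) \<in> globular_hom X Z"
    using category.Comp_in[OF globular_category a] by (simp_all add: globular_category_def)
  have "globular_chain_map R X Z (\<lambda>n. compose (cells X n) (H n) (F n)) n c
      = globular_chain_map R Y Z H n (globular_chain_map R X Y F n c)" if c: "c \<in> carrier (chains R X n)" for n c
    by (rule mod_hom_eqI[OF chains_spans chains_module chains_module globular_chain_map_hom[OF HF]
          mod_hom_comp[OF globular_chain_map_hom[OF F] globular_chain_map_hom[OF H]] _ c])
      (auto simp: globular_chain_map_cell[OF HF] globular_chain_map_cell[OF F] globular_chain_map_cell[OF H]
        globular_homD(2)[OF F] compose_eq)
  moreover have "globular_chain_map R X Z (\<lambda>n. compose (cells X n) (H n) (F n)) n c = undefined"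
    if "c \<notin> carrier (chains R X n)" for n c using that by (simp add: globular_chain_map_def)
  ultimately have "globular_chain_map R X Z (\<lambda>n. compose (cells X n) (H n) (F n))
      = (\<lambda>n. compose (carrier (chains R X n)) (globular_chain_map R Y Z H n) (globular_chain_map R X Y F n))"
    by (auto simp: fun_eq_iff compose_def restrict_def)
  then show "globular_chain_map R X Z (Comp globular_category X Y Z H F) =
    Comp (coalgebra_category R) (Coalg X) (Coalg Y) (globular_coalgebra R Z)
      (globular_chain_map R Y Z H) (globular_chain_map R X Y F)"
    by (simp add: globular_category_def coalgebra_category_def)
qed

end

text \<open>A degenerate cell is determined by its target. This recovers from boundary data the cells that are
  invisible as chains.\<close>

lemma degenerate_eq:
  assumes "is_globular_set Y" "y \<in> degenerate Y (Suc n)"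
  shows "y = idc Y n (tgt Y n y)"
  using assms globular_setD(6)[OF assms(1)] by auto

context cring
begin

section \<open>Coefficients in tensor products\<close>

text \<open>The coefficient of \<open>y \<otimes> y'\<close>; \<open>bicoeff\<close> below reads it off from the component of bidegree \<open>(p, q)\<close>.\<close>

definition tensor_coeff :: "'x globular_set \<Rightarrow> nat \<Rightarrow> nat \<Rightarrow> 'x \<Rightarrow> 'x \<Rightarrow> (('x \<Rightarrow> 'a) set \<times> ('x \<Rightarrow> 'a) set \<Rightarrow> 'a) set \<Rightarrow> 'a" where
  "tensor_coeff Y p q y y' = tensor_lift R (chains R Y p) (chains R Y q) (cmod (unit_complex R) 0)
    (\<lambda>u v. coeff Y p y u \<otimes> coeff Y q y' v)"

lemma coeff_closed [simp]:
  "\<lbrakk>y \<notin> degenerate Y n; c \<in> carrier (chains R Y n)\<rbrakk> \<Longrightarrow> coeff Y n y c \<in> carrier R"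
  using mod_homD(1)[OF coeff_hom] by (simp add: unit_complex_sel)

lemma
  assumes y: "y \<notin> degenerate Y p" and y': "y' \<notin> degenerate Y q"
  shows tensor_coeff_hom: "tensor_coeff Y p q y y' \<in> mod_hom R (tensor R (chains R Y p) (chains R Y q)) (cmod (unit_complex R) 0)"
    and tensor_coeff_pure: "\<lbrakk>u \<in> carrier (chains R Y p); v \<in> carrier (chains R Y q)\<rbrakk> \<Longrightarrow>
      tensor_coeff Y p q y y' (pure R (chains R Y p) (chains R Y q) u v) = coeff Y p y u \<otimes> coeff Y q y' v"
proof -
  let ?U = "cmod (unit_complex R) 0"
  have b: "bilinear R (chains R Y p) (chains R Y q) ?U (\<lambda>u v. coeff Y p y u \<otimes> coeff Y q y' v)"
    using bilinear_pre[OF smult_bilinear[of ?U] coeff_hom[OF y] coeff_hom[OF y']]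
    by (simp add: unit_complex_sel)
  show "tensor_coeff Y p q y y' \<in> mod_hom R (tensor R (chains R Y p) (chains R Y q)) ?U"
    unfolding tensor_coeff_def by (rule tensor_lift_hom[OF _ _ _ b]) simp_all
  show "tensor_coeff Y p q y y' (pure R (chains R Y p) (chains R Y q) u v) = coeff Y p y u \<otimes> coeff Y q y' v"
    if "u \<in> carrier (chains R Y p)" "v \<in> carrier (chains R Y q)"
    unfolding tensor_coeff_def by (rule tensor_lift_pure[OF _ _ _ b that]) simp_all
qed

lemma tensor_coeff_zero:
  assumes "y \<notin> degenerate Y p" "y' \<notin> degenerate Y q"
  shows "tensor_coeff Y p q y y' \<zero>\<^bsub>tensor R (chains R Y p) (chains R Y q)\<^esub> = \<zero>"
  using mod_hom_zero[OF _ _ tensor_coeff_hom[OF assms]] by (simp add: unit_complex_sel)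

definition bicoeff :: "'x globular_set \<Rightarrow> nat \<Rightarrow> nat \<Rightarrow> 'x \<Rightarrow> 'x \<Rightarrow> (nat \<Rightarrow> (('x \<Rightarrow> 'a) set \<times> ('x \<Rightarrow> 'a) set \<Rightarrow> 'a) set) \<Rightarrow> 'a" where
  "bicoeff Y p q y y' z = tensor_coeff Y p q y y' (z p)"

lemma bicoeff_hom:
  assumes "y \<notin> degenerate Y p" "y' \<notin> degenerate Y q" "p + q = n"
  shows "bicoeff Y p q y y' \<in> mod_hom R (CC Y n) (cmod (unit_complex R) 0)"
proof -
  have q: "q = n - p" and p: "p \<in> {..n}" using assms(3) by auto
  show ?thesis
    using mod_hom_comp[OF fin_prod_component_hom[OF p, of "\<lambda>p. tensor R (chains R Y p) (chains R Y (n - p))"]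
        tensor_coeff_hom[OF assms(1,2)[unfolded q]]]
    by (simp add: bicoeff_def[abs_def] cmod_tensor_complex q)
qed

lemma bicoeff_gpure:
  assumes "y \<notin> degenerate Y p" "y' \<notin> degenerate Y q" "p + q = n" "p' + q' = n"
    and "u \<in> carrier (chains R Y p')" "v \<in> carrier (chains R Y q')"
  shows "bicoeff Y p q y y' (gpure R (Ch Y) (Ch Y) p' q' u v)
    = (if p = p' then coeff Y p y u \<otimes> coeff Y q y' v else \<zero>)"
proof -
  have q: "n - p = q" and p: "p \<le> n" using assms(3) by auto
  have "p = p' \<Longrightarrow> q = q'" using assms(3,4) by simp
  then show ?thesis
    using assms(5,6) tensor_coeff_pure[OF assms(1,2)] tensor_coeff_zero[OF assms(1,2)]
    by (auto simp: bicoeff_def gpure_component[OF assms(4) p] q)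
qed

end

context domain
begin

section \<open>Faithfulness\<close>

text \<open>Here \<open>1 \<noteq> 0\<close> in \<open>R\<close> enters: the coefficient at \<open>y\<close> separates \<open>y\<close> from all other cells.\<close>

lemma cell_class_inject:
  assumes "y \<in> cells Y n" "y' \<in> cells Y n" "y \<notin> degenerate Y n" "cell_class R Y n y = cell_class R Y n y'"
  shows "y = y'"
proof (rule ccontr)
  assume "y \<noteq> y'"
  then show False using coeff_cell[OF assms(3,1)] coeff_cell[OF assms(3,2)] assms(4) by simp
qed

lemma cell_class_zero_iff:
  assumes "y \<in> cells Y n" shows "cell_class R Y n y = \<zero>\<^bsub>chains R Y n\<^esub> \<longleftrightarrow> y \<in> degenerate Y n"
proof
  assume z: "cell_class R Y n y = \<zero>\<^bsub>chains R Y n\<^esub>"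
  show "y \<in> degenerate Y n"
  proof (rule ccontr)
    assume y: "y \<notin> degenerate Y n"
    have "coeff Y n y \<zero>\<^bsub>chains R Y n\<^esub> = \<zero>"
      using mod_hom_zero[OF _ _ coeff_hom[OF y]] by (simp add: unit_complex_sel)
    then show False using coeff_cell[OF y assms] z by simp
  qed
qed (rule cell_class_degenerate)

text \<open>By induction on the dimension: nondegenerate images are visible as chains, and degenerate ones
  are the identities on their targets, which agree by induction.\<close>

lemma globular_faithful:
  assumes X: "is_globular_set X" and Y: "is_globular_set Y"
    and F: "F \<in> globular_hom X Y" and H: "H \<in> globular_hom X Y"
    and eq: "globular_chain_map R X Y F = globular_chain_map R X Y H"
  shows "F = H"
proof -
  have cl: "cell_class R Y n (F n x) = cell_class R Y n (H n x)" if "x \<in> cells X n" for n x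
    using globular_chain_map_cell[OF F that] globular_chain_map_cell[OF H that] eq by simp
  have "F n x = H n x" if "x \<in> cells X n" for n x
    using that
  proof (induction n arbitrary: x)
    case 0
    then show ?case
      by (intro cell_class_inject[OF globular_homD(2)[OF F 0] globular_homD(2)[OF H 0] _ cl[OF 0]]) simp
  next
    case (Suc n)
    note FH = globular_homD(2)[OF F Suc.prems] globular_homD(2)[OF H Suc.prems]
    show ?case
    proof (cases "F (Suc n) x \<in> degenerate Y (Suc n)")
      case False
      then show ?thesis using cell_class_inject[OF FH _ cl[OF Suc.prems]] by blast
    next
      case True
      then have "H (Suc n) x \<in> degenerate Y (Suc n)"
        using cl[OF Suc.prems] cell_class_zero_iff[OF FH(1)] cell_class_zero_iff[OF FH(2)] by simp
      note FH_eq = degenerate_eq[OF Y True] degenerate_eq[OF Y this]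
      have "tgt Y n (F (Suc n) x) = tgt Y n (H (Suc n) x)"
        using Suc.IH[OF globular_setD(2)[OF X Suc.prems]] globular_homD(4)[OF F Suc.prems] globular_homD(4)[OF H Suc.prems] by simp
      then show ?thesis by (subst FH_eq(1), subst FH_eq(2)) simp
    qed
  qed
  moreover have "F n x = undefined" "H n x = undefined" if "x \<notin> cells X n" for n x
    using globular_homD(1)[OF F, of n] globular_homD(1)[OF H, of n] that by auto
  ultimately have "F n x = H n x" for n x by (cases "x \<in> cells X n") simp_all
  then show ?thesis by (intro ext)
qed

section \<open>Fullness\<close>

text \<open>Compatibility of \<open>f\<close> with each \<open>\<Delta>\<^sub>k\<close> is its compatibility with the coproduct at \<open>e\<^sub>k \<otimes> c\<close>.\<close>

lemma coalgebra_hom_Delta: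
  assumes f: "f \<in> coalgebra_hom R (Coalg X) (Coalg Y)"
    and c: "c \<in> carrier (chains R X n)" and m: "n + k = m"
  shows "tensor_chain_map R (Ch X) (Ch X) (Ch Y) (Ch Y) f f m
    (Delta R X k n c) = Delta R Y k n (f n c)"
proof -
  let ?e = "free_gen R UNIV False"
  let ?G = "Ch X" and ?W = "W_complex R"
  have m': "k + n = m" using m by simp
  \<comment> \<open>The generator \<open>e\<^sub>k\<close>.\<close>
  have e: "?e \<in> carrier (cmod ?W k)" by (simp add: W_cmod)
  have ev: "?e False = \<one>" "?e True = \<zero>" by (simp_all add: free_gen_def)
  have fh: "f i \<in> mod_hom R (cmod ?G i) (cmod (Ch Y) i)" for i
    using coalgebra_homD(2)[OF f] by simp
  have fc: "f n c \<in> carrier (chains R Y n)" using mod_homD(1)[OF fh, of c n] c by simp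
  have c': "c \<in> carrier (cmod ?G n)" using c by simp
  have z: "gpure R ?W ?G k n ?e c \<in> carrier (cmod (tensor_complex R ?W (Coalg X)) m)"
    using m' e c by simp
  have tm: "tensor_chain_map R ?W ?G ?W (Ch Y) (\<lambda>k w. w) f m (gpure R ?W ?G k n ?e c)
    = gpure R ?W (Ch Y) k n ?e (f n c)"
    by (rule tensor_chain_map_gpure[OF W_graded globular_chains_graded W_graded globular_chains_graded mod_hom_id fh m' e c'])
  have D: "Delta R X k n c \<in> carrier (CC X m)" "Delta R Y k n (f n c) \<in> carrier (CC Y m)" using m c fc by simp_all
  have TD: "swap_action R ?G m (Delta R X k n c) \<in> carrier (CC X m)"
    "swap_action R (Ch Y) m (Delta R Y k n (f n c)) \<in> carrier (CC Y m)"
    using mod_homD(1)[OF swap_hom[OF globular_chains_graded]] D by blast+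
  show ?thesis
    using coalgebra_homD(5)[OF f z] D TD unfolding forget_coalgebra tm
    by (simp add: coprod_gpure[OF m' e c] coprod_gpure[OF m' e fc] ev)
qed

lemma diagonal_coefficients:
  assumes y: "y \<in> cells Y n" "y \<notin> degenerate Y n" and y': "y' \<in> cells Y n" "y' \<notin> degenerate Y n"
    and c: "c \<in> carrier (chains R Y n)"
  shows "bicoeff Y n n y y' (Delta R Y n n c) = (if y = y' then coeff Y n y c else \<zero>)"
proof (rule mod_hom_eqI[OF chains_spans chains_module _ mod_hom_comp[OF Delta_hom[OF refl] bicoeff_hom[OF y(2) y'(2) refl]] _ _ c])
  show "(\<lambda>c. if y = y' then coeff Y n y c else \<zero>) \<in> mod_hom R (chains R Y n) (cmod (unit_complex R) 0)"
    using coeff_hom[OF y(2)] mod_hom_const_zero[of "cmod (unit_complex R) 0" "chains R Y n"]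
    by (cases "y = y'") (simp_all add: unit_complex_sel)
  fix e assume "e \<in> cell_class R Y n ` cells Y n"
  then obtain x where "x \<in> cells Y n" "e = cell_class R Y n x" by blast
  then show "bicoeff Y n n y y' (Delta R Y n n e) = (if y = y' then coeff Y n y e else \<zero>)"
    using y y' by (simp add: Delta_on_cell Delta_cell_eqs bicoeff_gpure coeff_cell)
qed simp

text \<open>From \<open>\<Delta>\<^sub>nx = x \<otimes> x\<close> one gets \<open>f(x) \<otimes> f(x) = \<Delta>\<^sub>n(f(x))\<close>, whose right-hand side is diagonal in the basis of
  cells (\<open>diagonal_coefficients\<close>). Hence the coefficients of \<open>f(x)\<close> are idempotents with pairwise
  product \<open>0\<close>. In an integral domain at most one of them is nonzero, and it is \<open>1\<close>.\<close>

lemma coalgebra_hom_cell_cases: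
  assumes f: "f \<in> coalgebra_hom R (Coalg X) (Coalg Y)" and x: "x \<in> cells X n"
  shows "f n (cell_class R X n x) = \<zero>\<^bsub>chains R Y n\<^esub> \<or>
    (\<exists>y\<in>cells Y n. y \<notin> degenerate Y n \<and> f n (cell_class R X n x) = cell_class R Y n y)"
proof -
  let ?c = "cell_class R X n x"
  let ?d = "f n ?c"
  have fh: "f i \<in> mod_hom R (cmod (Ch X) i) (cmod (Ch Y) i)" for i
    using coalgebra_homD(2)[OF f] by simp
  have d: "?d \<in> carrier (chains R Y n)" using mod_homD(1)[OF fh, of ?c n] by simp
  have c': "?c \<in> carrier (cmod (Ch X) n)" by simp
  have "gpure R (Ch Y) (Ch Y) n n ?d ?d = Delta R Y n n ?d"
    using coalgebra_hom_Delta[OF f, of ?c n n "n + n"] x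
      tensor_chain_map_gpure[OF globular_chains_graded globular_chains_graded globular_chains_graded globular_chains_graded fh fh refl c' c']
    by (simp add: Delta_on_cell Delta_cell_eqs)
  then have prod: "coeff Y n y ?d \<otimes> coeff Y n y' ?d = (if y = y' then coeff Y n y ?d else \<zero>)"
    if "y \<in> cells Y n" "y \<notin> degenerate Y n" "y' \<in> cells Y n" "y' \<notin> degenerate Y n" for y y'
    using diagonal_coefficients[OF that d] bicoeff_gpure[OF that(2,4) refl refl d d] by simp
  show ?thesis
  proof (cases "\<exists>y. y \<in> cells Y n \<and> y \<notin> degenerate Y n \<and> coeff Y n y ?d \<noteq> \<zero>")
    case False
    then have "?d = \<zero>\<^bsub>chains R Y n\<^esub>" by (intro chain_eq_zeroI[OF d]) blast
    then show ?thesis ..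
  next
    case True
    then obtain y where y: "y \<in> cells Y n" "y \<notin> degenerate Y n" "coeff Y n y ?d \<noteq> \<zero>" by blast
    have yc: "coeff Y n y ?d \<in> carrier R" using y d by simp
    have one: "coeff Y n y ?d = \<one>"
      using prod[OF y(1,2) y(1,2)] y(3) yc m_lcancel[OF y(3) yc yc one_closed] by simp
    have "?d = cell_class R Y n y"
    proof (rule chain_eqI[OF d cell_class_closed])
      fix z assume z: "z \<in> cells Y n" "z \<notin> degenerate Y n"
      have zc: "coeff Y n z ?d \<in> carrier R" using z d by simp
      have "coeff Y n z ?d = (if y = z then \<one> else \<zero>)"
        using prod[OF y(1,2) z] unfolding one l_one[OF zc] .
      then show "coeff Y n z ?d = coeff Y n z (cell_class R Y n y)"
        by (simp only: coeff_cell[OF z(2) y(1)])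
    qed
    then show ?thesis using y(1,2) by (intro disjI2 bexI[of _ y] conjI)
  qed
qed

text \<open>Compare \<open>\<Delta>\<^sub>kx\<close> with \<open>\<Delta>\<^sub>ky\<close>. As \<open>k \<noteq> n\<close>, their two terms lie in the different bidegrees \<open>(k, n)\<close> and
  \<open>(n, k)\<close>, and the coefficient of the nondegenerate \<open>y\<close> extracts \<open>f(t\<^sub>kx) = t\<^sub>ky\<close> from the first
  and, up to a sign, \<open>f(s\<^sub>kx) = s\<^sub>ky\<close> from the second.\<close>

lemma coalgebra_hom_boundary_cells:
  assumes X: "is_globular_set X" and Y: "is_globular_set Y"
    and f: "f \<in> coalgebra_hom R (Coalg X) (Coalg Y)" and x: "x \<in> cells X n"
    and y: "y \<in> cells Y n" "y \<notin> degenerate Y n" and fx: "f n (cell_class R X n x) = cell_class R Y n y" and k: "k < n"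
  shows "f k (cell_class R X k (iter_tgt X k n x)) = cell_class R Y k (iter_tgt Y k n y)"
    and "f k (cell_class R X k (iter_src X k n x)) = cell_class R Y k (iter_src Y k n y)"
proof -
  let ?G = "Ch X" and ?H = "Ch Y"
  let ?t = "f k (cell_class R X k (iter_tgt X k n x))" and ?s = "f k (cell_class R X k (iter_src X k n x))"
  let ?V = "CC Y (n + k)"
  let ?\<sigma> = "sign R (Suc n * k)"
  have fh: "f i \<in> mod_hom R (cmod ?G i) (cmod ?H i)" for i
    using coalgebra_homD(2)[OF f] by simp
  have fcl: "f i (cell_class R X i z) \<in> carrier (chains R Y i)" for i z using mod_homD(1)[OF fh, of "cell_class R X i z" i] by simp
  have m: "k + n = n + k" by simp
  have cl: "cell_class R X i z \<in> carrier (cmod ?G i)" for i z by simp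
  note gr = globular_chains_graded[of X] globular_chains_graded[of X] globular_chains_graded[of Y] globular_chains_graded[of Y]
  note M = tensor_chain_map_hom[OF gr fh fh, of "n + k"]
  have g1: "gpure R ?G ?G k n (cell_class R X k z) (cell_class R X n x) \<in> carrier (CC X (n + k))"
    and g2: "gpure R ?G ?G n k (cell_class R X n x) (cell_class R X k z) \<in> carrier (CC X (n + k))" for z by simp_all
  let ?x1 = "gpure R ?G ?G k n (cell_class R X k (iter_tgt X k n x)) (cell_class R X n x)"
    and ?x2 = "gpure R ?G ?G n k (cell_class R X n x) (cell_class R X k (iter_src X k n x))"
  have DX: "Delta R X k n (cell_class R X n x) = ?x1 \<oplus>\<^bsub>CC X (n + k)\<^esub> ?\<sigma> \<odot>\<^bsub>CC X (n + k)\<^esub> ?x2"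
    unfolding Delta_on_cell[OF x] by (rule Delta_cell_eqs(3)[OF k])
  have M1: "tensor_chain_map R ?G ?G ?H ?H f f (n + k) ?x1 = gpure R ?H ?H k n ?t (cell_class R Y n y)"
    unfolding fx[symmetric] by (rule tensor_chain_map_gpure[OF gr fh fh m cl cl])
  have M2: "tensor_chain_map R ?G ?G ?H ?H f f (n + k) ?x2 = gpure R ?H ?H n k (cell_class R Y n y) ?s"
    unfolding fx[symmetric] by (rule tensor_chain_map_gpure[OF gr fh fh refl cl cl])
  have MD: "tensor_chain_map R ?G ?G ?H ?H f f (n + k) (Delta R X k n (cell_class R X n x)) =
     gpure R ?H ?H k n ?t (cell_class R Y n y) \<oplus>\<^bsub>?V\<^esub> ?\<sigma> \<odot>\<^bsub>?V\<^esub> gpure R ?H ?H n k (cell_class R Y n y) ?s"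
    unfolding DX M1[symmetric] M2[symmetric]
    by (simp only: mod_homD(2)[OF M g1 mod_closed(5)[OF CC_module sign_closed g2]] mod_homD(3)[OF M sign_closed g2])
  have e: "gpure R ?H ?H k n ?t (cell_class R Y n y) \<oplus>\<^bsub>?V\<^esub> ?\<sigma> \<odot>\<^bsub>?V\<^esub> gpure R ?H ?H n k (cell_class R Y n y) ?s
     = gpure R ?H ?H k n (cell_class R Y k (iter_tgt Y k n y)) (cell_class R Y n y)
       \<oplus>\<^bsub>?V\<^esub> ?\<sigma> \<odot>\<^bsub>?V\<^esub> gpure R ?H ?H n k (cell_class R Y n y) (cell_class R Y k (iter_src Y k n y))"
    (is "?l1 \<oplus>\<^bsub>_\<^esub> _ \<odot>\<^bsub>_\<^esub> ?l2 = ?r1 \<oplus>\<^bsub>_\<^esub> _ \<odot>\<^bsub>_\<^esub> ?r2")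
    using coalgebra_hom_Delta[OF f cell_class_closed[of X n x] refl, of k]
    unfolding MD fx Delta_on_cell[OF y(1)] Delta_cell_eqs(3)[OF k] .
  have c: "?l1 \<in> carrier ?V" "?l2 \<in> carrier ?V" "?r1 \<in> carrier ?V" "?r2 \<in> carrier ?V" using fcl by simp_all
  show "?t = cell_class R Y k (iter_tgt Y k n y)"
  proof (rule chain_eqI[OF fcl cell_class_closed])
    fix z assume z: "z \<in> cells Y k" "z \<notin> degenerate Y k"
    note B = bicoeff_hom[OF z(2) y(2) m] and Bg = bicoeff_gpure[OF z(2) y(2) m]
    have "bicoeff Y k n z y (?l1 \<oplus>\<^bsub>?V\<^esub> ?\<sigma> \<odot>\<^bsub>?V\<^esub> ?l2) = bicoeff Y k n z y (?r1 \<oplus>\<^bsub>?V\<^esub> ?\<sigma> \<odot>\<^bsub>?V\<^esub> ?r2)"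
      using e by simp
    then show "coeff Y k z ?t = coeff Y k z (cell_class R Y k (iter_tgt Y k n y))"
      using c k fcl z y by (simp add: mod_homD(2,3)[OF B] Bg unit_complex_sel coeff_cell[OF y(2,1)] del: mult_Suc)
  qed
  show "?s = cell_class R Y k (iter_src Y k n y)"
  proof (rule chain_eqI[OF fcl cell_class_closed])
    fix z assume z: "z \<in> cells Y k" "z \<notin> degenerate Y k"
    note B = bicoeff_hom[OF y(2) z(2) refl] and Bg = bicoeff_gpure[OF y(2) z(2) refl]
    have "bicoeff Y n k y z (?l1 \<oplus>\<^bsub>?V\<^esub> ?\<sigma> \<odot>\<^bsub>?V\<^esub> ?l2) = bicoeff Y n k y z (?r1 \<oplus>\<^bsub>?V\<^esub> ?\<sigma> \<odot>\<^bsub>?V\<^esub> ?r2)"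
      using e by simp
    then have "?\<sigma> \<otimes> coeff Y k z ?s = ?\<sigma> \<otimes> coeff Y k z (cell_class R Y k (iter_src Y k n y))"
      using c k fcl z y by (simp add: mod_homD(2,3)[OF B] Bg unit_complex_sel coeff_cell[OF y(2,1)] del: mult_Suc)
    then have "?\<sigma> \<otimes> ?\<sigma> \<otimes> coeff Y k z ?s = ?\<sigma> \<otimes> ?\<sigma> \<otimes> coeff Y k z (cell_class R Y k (iter_src Y k n y))"
      using fcl z by (simp add: m_assoc del: mult_Suc)
    then show "coeff Y k z ?s = coeff Y k z (cell_class R Y k (iter_src Y k n y))"
      using fcl z by (simp add: sign_square del: mult_Suc)
  qed
qed

text \<open>The map of cells behind a coalgebra map \<open>f\<close>. A cell that \<open>f\<close> annihilates must become degenerate,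
  hence the identity on the image of its target; any other cell goes to the cell that represents its
  image. The choice is made in dimension \<open>0\<close> without a test because vertices are never annihilated.\<close>

primrec cell_map :: "'x globular_set \<Rightarrow> 'x globular_set \<Rightarrow> (nat \<Rightarrow> ('x \<Rightarrow> 'a) set \<Rightarrow> ('x \<Rightarrow> 'a) set) \<Rightarrow> nat \<Rightarrow> 'x \<Rightarrow> 'x" where
  "cell_map X Y f 0 x = (SOME y. y \<in> cells Y 0 \<and> f 0 (cell_class R X 0 x) = cell_class R Y 0 y)"
| "cell_map X Y f (Suc n) x = (if f (Suc n) (cell_class R X (Suc n) x) = \<zero>\<^bsub>chains R Y (Suc n)\<^esub>
    then idc Y n (cell_map X Y f n (tgt X n x))
    else SOME y. y \<in> cells Y (Suc n) \<and> f (Suc n) (cell_class R X (Suc n) x) = cell_class R Y (Suc n) y)"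

context
  fixes X Y :: "'x globular_set" and f
  assumes X: "is_globular_set X" and Y: "is_globular_set Y"
    and f: "f \<in> coalgebra_hom R (Coalg X) (Coalg Y)"
begin

lemma coalgebra_hom_linear: "f n \<in> mod_hom R (chains R X n) (chains R Y n)"
  using coalgebra_homD(2)[OF f] by simp

text \<open>The counit takes the value \<open>1\<close> on every vertex.\<close>

lemma coalgebra_hom_vertex_nonzero: "x \<in> cells X 0 \<Longrightarrow> f 0 (cell_class R X 0 x) \<noteq> \<zero>\<^bsub>chains R Y 0\<^esub>"
proof
  assume x: "x \<in> cells X 0" and z: "f 0 (cell_class R X 0 x) = \<zero>\<^bsub>chains R Y 0\<^esub>"
  have "aug (Coalg Y) 0 \<zero>\<^bsub>chains R Y 0\<^esub> = \<zero>"
    using mod_hom_zero[OF _ _ aug_hom[of Y 0]] by (simp add: unit_complex_sel)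
  then show False using coalgebra_homD(4)[OF f, of "cell_class R X 0 x" 0] z x by (simp add: aug_cell)
qed

lemma cell_map_spec:
  "x \<in> cells X n \<Longrightarrow> cell_map X Y f n x \<in> cells Y n \<and> f n (cell_class R X n x) = cell_class R Y n (cell_map X Y f n x)"
proof (induction n arbitrary: x)
  case 0
  then have "\<exists>y. y \<in> cells Y 0 \<and> f 0 (cell_class R X 0 x) = cell_class R Y 0 y"
    using coalgebra_hom_cell_cases[OF f 0] coalgebra_hom_vertex_nonzero[OF 0] by blast
  from someI_ex[OF this] show ?case by simp
next
  case (Suc n)
  show ?case
  proof (cases "f (Suc n) (cell_class R X (Suc n) x) = \<zero>\<^bsub>chains R Y (Suc n)\<^esub>")
    case True
    have "cell_map X Y f n (tgt X n x) \<in> cells Y n" using Suc.IH[OF globular_setD(2)[OF X Suc.prems]] by blast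
    then show ?thesis using True globular_setD(3)[OF Y] by (simp add: cell_class_degenerate)
  next
    case False
    then have "\<exists>y. y \<in> cells Y (Suc n) \<and> f (Suc n) (cell_class R X (Suc n) x) = cell_class R Y (Suc n) y"
      using coalgebra_hom_cell_cases[OF f Suc.prems] by blast
    from someI_ex[OF this] show ?thesis using False by simp
  qed
qed

lemma cell_map_unique:
  assumes "x \<in> cells X n" "y \<in> cells Y n" "y \<notin> degenerate Y n" "f n (cell_class R X n x) = cell_class R Y n y"
  shows "cell_map X Y f n x = y"
proof -
  note s = cell_map_spec[OF assms(1)]
  have "cell_class R Y n y = cell_class R Y n (cell_map X Y f n x)"
    using assms(4)[symmetric] conjunct2[OF s] by (rule trans)
  from cell_class_inject[OF assms(2) conjunct1[OF s] assms(3) this] show ?thesis by (rule sym)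
qed

lemma cell_map_collapsed:
  "\<lbrakk>f (Suc n) (cell_class R X (Suc n) x) = \<zero>\<^bsub>chains R Y (Suc n)\<^esub>\<rbrakk> \<Longrightarrow>
    cell_map X Y f (Suc n) x = idc Y n (cell_map X Y f n (tgt X n x))"
  by simp

lemma cell_map_idc:
  assumes x: "x \<in> cells X n" shows "cell_map X Y f (Suc n) (idc X n x) = idc Y n (cell_map X Y f n x)"
proof -
  have "cell_class R X (Suc n) (idc X n x) = \<zero>\<^bsub>chains R X (Suc n)\<^esub>" using x by (simp add: cell_class_degenerate)
  then have "f (Suc n) (cell_class R X (Suc n) (idc X n x)) = \<zero>\<^bsub>chains R Y (Suc n)\<^esub>"
    using mod_hom_zero[OF _ _ coalgebra_hom_linear] by simp
  from cell_map_collapsed[OF this] show ?thesis using globular_setD(6)[OF X x] by simp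
qed

text \<open>As chains, the boundary cells of \<open>x\<close> go to those of its image. This settles the nondegenerate
  ones. A degenerate boundary cell of the image, of dimension \<open>k + 1\<close>, is the identity on its target, which
  is \<open>t\<^sub>k\<close> of the image whether one starts from \<open>t\<^sub>k\<^sub>+\<^sub>1\<close> or from \<open>s\<^sub>k\<^sub>+\<^sub>1\<close>; so induction on \<open>k\<close> for targets also
  yields the claim for sources.\<close>

lemma cell_map_iter:
  assumes x: "x \<in> cells X n" and nz: "f n (cell_class R X n x) \<noteq> \<zero>\<^bsub>chains R Y n\<^esub>" and k: "k < n"
  shows "cell_map X Y f k (iter_tgt X k n x) = iter_tgt Y k n (cell_map X Y f n x)"
    and "cell_map X Y f k (iter_src X k n x) = iter_src Y k n (cell_map X Y f n x)"
proof -
  let ?y = "cell_map X Y f n x"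
  have y: "?y \<in> cells Y n" "f n (cell_class R X n x) = cell_class R Y n ?y" using cell_map_spec[OF x] by auto
  have nd: "?y \<notin> degenerate Y n" using nz y cell_class_zero_iff[OF y(1)] by simp
  have T: "cell_map X Y f k (iter_tgt X k n x) = iter_tgt Y k n ?y" if "k < n" for k
    using that
  proof (induction k)
    case 0
    have c: "iter_tgt X 0 n x \<in> cells X 0" "iter_tgt Y 0 n ?y \<in> cells Y 0"
      using iter_closed(1)[OF X _ x] iter_closed(1)[OF Y _ y(1)] by auto
    show ?case
      by (rule cell_map_unique[OF c _ coalgebra_hom_boundary_cells(1)[OF X Y f x y(1) nd y(2) 0]]) simp
  next
    case (Suc k)
    have le: "Suc k \<le> n" using Suc.prems by simp
    note c = iter_closed(1)[OF X le x] iter_closed(1)[OF Y le y(1)]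
    note b = coalgebra_hom_boundary_cells(1)[OF X Y f x y(1) nd y(2) Suc.prems]
    show ?case
    proof (cases "iter_tgt Y (Suc k) n ?y \<in> degenerate Y (Suc k)")
      case False
      then show ?thesis by (rule cell_map_unique[OF c _ b])
    next
      case True
      have "f (Suc k) (cell_class R X (Suc k) (iter_tgt X (Suc k) n x)) = \<zero>\<^bsub>chains R Y (Suc k)\<^esub>"
        using b unfolding cell_class_degenerate[OF True] .
      from cell_map_collapsed[OF this] have "cell_map X Y f (Suc k) (iter_tgt X (Suc k) n x) = idc Y k (iter_tgt Y k n ?y)"
        using Suc iter_step(1)[OF X le x] by simp
      also have "\<dots> = iter_tgt Y (Suc k) n ?y"
        using degenerate_eq[OF Y True] unfolding iter_step(1)[OF Y le y(1)] by (rule sym)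
      finally show ?thesis .
    qed
  qed
  show "cell_map X Y f k (iter_tgt X k n x) = iter_tgt Y k n ?y" by (rule T[OF k])
  have le: "k \<le> n" using k by simp
  note c = iter_closed(2)[OF X le x] iter_closed(2)[OF Y le y(1)]
  note b = coalgebra_hom_boundary_cells(2)[OF X Y f x y(1) nd y(2) k]
  show "cell_map X Y f k (iter_src X k n x) = iter_src Y k n ?y"
  proof (cases "iter_src Y k n ?y \<in> degenerate Y k")
    case False
    then show ?thesis by (rule cell_map_unique[OF c _ b])
  next
    case True
    then obtain j where j: "k = Suc j" by (cases k) auto
    have le': "Suc j \<le> n" "j < n" using k j by auto
    have "f (Suc j) (cell_class R X (Suc j) (iter_src X (Suc j) n x)) = \<zero>\<^bsub>chains R Y (Suc j)\<^esub>"
      using b cell_class_degenerate[OF True] j by simp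
    from cell_map_collapsed[OF this] have "cell_map X Y f (Suc j) (iter_src X (Suc j) n x) = idc Y j (iter_tgt Y j n ?y)"
      using T[OF le'(2)] iter_step(3)[OF X le'(1) x] by simp
    also have "\<dots> = iter_src Y (Suc j) n ?y"
      using degenerate_eq[OF Y True[unfolded j]] unfolding iter_step(3)[OF Y le'(1) y(1)] by (rule sym)
    finally show ?thesis using j by simp
  qed
qed

text \<open>If \<open>f(x) = 0\<close>, then \<open>f(\<partial>x) = 0\<close>, so source and target of \<open>x\<close> have the same image as chains. If that
  image is \<open>0\<close>, both collapse to identities on the images of their targets, and these targets coincide
  by globularity.\<close>

lemma cell_map_parallel:
  assumes x: "x \<in> cells X (Suc n)" and z: "f (Suc n) (cell_class R X (Suc n) x) = \<zero>\<^bsub>chains R Y (Suc n)\<^esub>"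
  shows "cell_map X Y f n (tgt X n x) = cell_map X Y f n (src X n x)"
proof -
  let ?t = "cell_class R X n (tgt X n x)" and ?s = "cell_class R X n (src X n x)"
  have ts: "tgt X n x \<in> cells X n" "src X n x \<in> cells X n" using globular_setD(1,2)[OF X x] by auto
  have "f n (diff (Ch X) n (cell_class R X (Suc n) x)) = diff (Ch Y) n \<zero>\<^bsub>chains R Y (Suc n)\<^esub>"
    using coalgebra_homD(3)[OF f, of "cell_class R X (Suc n) x" n] z by simp
  also have "\<dots> = \<zero>\<^bsub>chains R Y n\<^esub>" by (rule mod_hom_zero[OF _ _ globular_diff_hom[OF Y]]) simp_all
  finally have "f n ?t \<ominus>\<^bsub>chains R Y n\<^esub> f n ?s = \<zero>\<^bsub>chains R Y n\<^esub>"
    by (simp add: globular_diff_cell[OF X x] mod_hom_minus[OF _ _ coalgebra_hom_linear])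
  then have eq: "f n ?t = f n ?s"
    by (rule mod_eq_of_minus[OF chains_module mod_homD(1)[OF coalgebra_hom_linear cell_class_closed] mod_homD(1)[OF coalgebra_hom_linear cell_class_closed]])
  show ?thesis
  proof (cases "f n ?t = \<zero>\<^bsub>chains R Y n\<^esub>")
    case False
    then have "cell_map X Y f n (tgt X n x) \<notin> degenerate Y n"
      using cell_map_spec[OF ts(1)] cell_class_degenerate[of "cell_map X Y f n (tgt X n x)" Y n] by auto
    then show ?thesis
      by (intro cell_map_unique[OF ts(2), symmetric]) (use cell_map_spec[OF ts(1)] eq in simp_all)
  next
    case True
    then obtain m where n: "n = Suc m" using coalgebra_hom_vertex_nonzero[of "tgt X n x"] ts by (cases n) auto
    have "cell_map X Y f (Suc m) (tgt X (Suc m) x) = idc Y m (cell_map X Y f m (tgt X m (tgt X (Suc m) x)))"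
      "cell_map X Y f (Suc m) (src X (Suc m) x) = idc Y m (cell_map X Y f m (tgt X m (src X (Suc m) x)))"
      using True eq unfolding n by (intro cell_map_collapsed; simp)+
    then show ?thesis using globular_setD(4)[OF X, of x m] x unfolding n by simp
  qed
qed

lemma cell_map_globular_hom: "(\<lambda>n. \<lambda>x\<in>cells X n. cell_map X Y f n x) \<in> globular_hom X Y"
proof (rule globular_homI)
  show "(\<lambda>x\<in>cells X n. cell_map X Y f n x) \<in> cells X n \<rightarrow>\<^sub>E cells Y n" for n using cell_map_spec by auto
  fix n x assume x: "x \<in> cells X (Suc n)"
  have "cell_map X Y f n (tgt X n x) = tgt Y n (cell_map X Y f (Suc n) x) \<and>
    cell_map X Y f n (src X n x) = src Y n (cell_map X Y f (Suc n) x)"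
  proof (cases "f (Suc n) (cell_class R X (Suc n) x) = \<zero>\<^bsub>chains R Y (Suc n)\<^esub>")
    case True
    have "cell_map X Y f n (tgt X n x) \<in> cells Y n" using cell_map_spec[OF globular_setD(2)[OF X x]] by blast
    then show ?thesis using cell_map_collapsed[OF True] cell_map_parallel[OF x True] globular_setD(6,7)[OF Y] by simp
  next
    case False
    then show ?thesis using cell_map_iter[OF x False, of n] by simp
  qed
  then show "(\<lambda>x\<in>cells X n. cell_map X Y f n x) (src X n x) = src Y n ((\<lambda>x\<in>cells X (Suc n). cell_map X Y f (Suc n) x) x)"
    "(\<lambda>x\<in>cells X n. cell_map X Y f n x) (tgt X n x) = tgt Y n ((\<lambda>x\<in>cells X (Suc n). cell_map X Y f (Suc n) x) x)"
    using x globular_setD(1,2)[OF X x] by (simp_all del: cell_map.simps)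
next
  fix n x assume x: "x \<in> cells X n"
  then show "(\<lambda>x\<in>cells X (Suc n). cell_map X Y f (Suc n) x) (idc X n x) = idc Y n ((\<lambda>x\<in>cells X n. cell_map X Y f n x) x)"
    using cell_map_idc[OF x] globular_setD(3)[OF X x] by (simp del: cell_map.simps)
qed

lemma globular_full: "f \<in> globular_chain_map R X Y ` globular_hom X Y"
proof
  let ?F = "\<lambda>n. \<lambda>x\<in>cells X n. cell_map X Y f n x"
  show F: "?F \<in> globular_hom X Y" by (rule cell_map_globular_hom)
  have "f n c = globular_chain_map R X Y ?F n c" if c: "c \<in> carrier (chains R X n)" for n c
    by (rule mod_hom_eqI[OF chains_spans chains_module chains_module coalgebra_hom_linear globular_chain_map_hom[OF F] _ c])
      (auto simp: globular_chain_map_cell[OF F] cell_map_spec simp del: cell_map.simps)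
  moreover have "f n c = globular_chain_map R X Y ?F n c" if c: "c \<notin> carrier (chains R X n)" for n c
    using coalgebra_homD(1)[OF f, of n] c by (simp add: globular_chain_map_def extensional_def)
  ultimately show "f = globular_chain_map R X Y ?F" by blast
qed

end

end

section \<open>The embedding of globular sets into coalgebras\<close>

theorem theorem4:
  fixes R :: "('r, 'q) ring_scheme"
  assumes "domain R"
  shows "fully_faithful_functor
    (globular_category :: ('x globular_set, nat \<Rightarrow> 'x \<Rightarrow> 'x) category)
    (coalgebra_category R)
    (globular_coalgebra R)
    (globular_chain_map R)"
proof -
  interpret domain R by fact
  show ?thesis
  proof (intro fully_faithful_functor.intro fully_faithful_functor_axioms.intro globular_functor)
    fix X Y :: "'x globular_set" assume "X \<in> Ob globular_category" "Y \<in> Ob globular_category"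
    then have X: "is_globular_set X" and Y: "is_globular_set Y" by (simp_all add: globular_category_def)
    show "inj_on (globular_chain_map R X Y) (Hom globular_category X Y)"
      using globular_faithful[OF X Y] by (auto simp: inj_on_def globular_category_def)
    show "Hom (coalgebra_category R) (Coalg X) (Coalg Y)
        \<subseteq> globular_chain_map R X Y ` Hom globular_category X Y"
      using globular_full[OF X Y] by (auto simp: coalgebra_category_def globular_category_def)
  qed
qed

end
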